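(* The variety of complex $8$-dimensional dual mock-Lie algebras has exactly four irreducible components, namely the Zariski closures of the orbits of the rigid algebras $\mathfrak{D}^8_{17}$, $\mathfrak{D}^8_{30}$, $\mathfrak{D}^8_{33}$ and $\mathfrak{D}^8_{36}$, where these algebras have basis $e_1,\dots,e_8$ and multiplication tables $$\mathfrak{D}^8_{17}:\quad e_1e_2=e_7,\ e_3e_4=e_8,\ e_5e_6=e_7+e_8;$$ $$\mathfrak{D}^8_{30}:\quad e_1e_2=e_6,\ e_1e_3=e_7,\ e_2e_3=e_8,\ e_1e_4=e_8,\ e_2e_5=e_7,\ e_4e_5=e_6;$$ $$\mathfrak{D}^8_{33}:\quad e_1e_2=e_5,\ e_2e_3=e_6,\ e_3e_4=e_7,\ e_4e_1=e_8;$$ $$\mathfrak{D}^8_{36}:\quad e_1e_2=e_4,\ e_1e_3=e_5,\ e_2e_3=e_6,\ e_1e_6=e_8,\ e_2e_5=-e_8,\ e_3e_4=e_8,\ e_3e_7=e_8.$$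
   Context: A dual mock-Lie algebra over $\mathbb{C}$ is a complex vector space with a bilinear product that is anticommutative, $xy=-yx$, and antiassociative, $(xy)z=-x(yz)$ for all $x,y,z$. In multiplication tables, the products $e_je_i=-e_ie_j$ are determined by anticommutativity, and all other unlisted products of basis elements are zero. Let $\mathbf{V}=\mathbb{C}^8$. The variety of complex $8$-dimensional dual mock-Lie algebras is the Zariski-closed subset of ${\rm Hom}(\mathbf{V}\otimes\mathbf{V},\mathbf{V})\cong\mathbb{C}^{8^3}$ (coordinates: structure constants) consisting of all dual mock-Lie products $\mu$ on $\mathbf{V}$. The group ${\rm GL}(\mathbf{V})$ acts on it by $(g*\mu)(x\otimes y)=g\mu(g^{-1}x\otimes g^{-1}y)$; orbits $O(\mu)$ correspond to isomorphism classes. An algebra represented by $\mu$ is rigid if $O(\mu)$ is open in the variety (equivalently, the Zariski closure $\overline{O(\mu)}$ is an irreducible component). *)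

theory Defs
  imports "HOL-Analysis.Analysis"
begin

subsection \<open>Bilinear products and the Zariski topology\<close>

type_synonym 'n product = "complex^'n \<Rightarrow> complex^'n \<Rightarrow> complex^'n"

text \<open>The scalar multiplication is the complex one, \<open>(*s)\<close>; the constant \<^const>\<open>bilinear\<close> of
  the library only means bilinear over the reals.\<close>

definition bilinear_products :: "'n::finite product set" where
  "bilinear_products = {\<mu>. (\<forall>x. Vector_Spaces.linear (*s) (*s) (\<mu> x)) \<and>
                            (\<forall>y. Vector_Spaces.linear (*s) (*s) (\<lambda>x. \<mu> x y))}"

abbreviation e :: "'n::finite \<Rightarrow> complex^'n" where
  "e i \<equiv> axis i 1"

definition structure_constant :: "'n::finite \<Rightarrow> 'n \<Rightarrow> 'n \<Rightarrow> 'n product \<Rightarrow> complex" where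
  "structure_constant i j k \<mu> = \<mu> (e i) (e j) $ k"

inductive polynomial_fun :: "('n::finite product \<Rightarrow> complex) \<Rightarrow> bool" where
  const: "polynomial_fun (\<lambda>\<mu>. c)"
| coord: "polynomial_fun (structure_constant i j k)"
| add: "polynomial_fun p \<Longrightarrow> polynomial_fun q \<Longrightarrow> polynomial_fun (\<lambda>\<mu>. p \<mu> + q \<mu>)"
| mult: "polynomial_fun p \<Longrightarrow> polynomial_fun q \<Longrightarrow> polynomial_fun (\<lambda>\<mu>. p \<mu> * q \<mu>)"

definition zero_locus :: "('n::finite product \<Rightarrow> complex) set \<Rightarrow> 'n product set" where
  "zero_locus P = {\<mu> \<in> bilinear_products. \<forall>p\<in>P. p \<mu> = 0}"

definition zariski_closed :: "'n::finite product set \<Rightarrow> bool" where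
  "zariski_closed Z \<longleftrightarrow> (\<exists>P. (\<forall>p\<in>P. polynomial_fun p) \<and> Z = zero_locus P)"

definition zariski :: "'n::finite product topology" where
  "zariski = topology (\<lambda>U. U \<subseteq> bilinear_products \<and> zariski_closed (bilinear_products - U))"

lemma zero_locusD: "\<mu> \<in> zero_locus P \<Longrightarrow> p \<in> P \<Longrightarrow> p \<mu> = 0"
  by (simp add: zero_locus_def)

lemma zariski_closed_Un:
  assumes "zariski_closed A" "zariski_closed B"
  shows "zariski_closed (A \<union> B)"
proof -
  obtain P Q where P: "\<forall>p\<in>P. polynomial_fun p" "A = zero_locus P"
    and Q: "\<forall>q\<in>Q. polynomial_fun q" "B = zero_locus Q"
    using assms unfolding zariski_closed_def by blast
  let ?R = "{\<lambda>\<mu>. p \<mu> * q \<mu> | p q. p \<in> P \<and> q \<in> Q}"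
  have "\<mu> \<in> A \<union> B" if \<mu>: "\<mu> \<in> zero_locus ?R" for \<mu>
  proof (rule ccontr)
    assume *: "\<mu> \<notin> A \<union> B"
    have bil: "\<mu> \<in> bilinear_products"
      using \<mu> by (simp add: zero_locus_def)
    have "\<not> (\<forall>p\<in>P. p \<mu> = 0)" "\<not> (\<forall>q\<in>Q. q \<mu> = 0)"
      using * bil by (simp_all add: P(2) Q(2) zero_locus_def)
    then obtain p q where pq: "p \<in> P" "p \<mu> \<noteq> 0" "q \<in> Q" "q \<mu> \<noteq> 0"
      unfolding Set.ball_simps by (elim bexE)
    have "(\<lambda>\<mu>. p \<mu> * q \<mu>) \<in> ?R" using pq by blast
    from zero_locusD[OF \<mu> this] have "p \<mu> * q \<mu> = 0" .
    with pq show False by simp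
  qed
  moreover have "\<mu> \<in> zero_locus ?R" if "\<mu> \<in> A \<union> B" for \<mu>
    using that unfolding P(2) Q(2) zero_locus_def by fastforce
  ultimately have "A \<union> B = zero_locus ?R" by blast
  moreover have "\<forall>r\<in>?R. polynomial_fun r"
    using P Q by (auto intro: polynomial_fun.mult)
  ultimately show ?thesis unfolding zariski_closed_def by blast
qed

lemma zariski_closed_Inter:
  assumes "\<And>A. A \<in> \<A> \<Longrightarrow> zariski_closed A"
  shows "zariski_closed (bilinear_products \<inter> \<Inter>\<A>)"
proof -
  let ?Q = "{p. polynomial_fun p \<and> (\<exists>A\<in>\<A>. \<forall>\<mu>\<in>A. p \<mu> = 0)}"
  have "\<mu> \<in> A" if \<mu>: "\<mu> \<in> zero_locus ?Q" and A: "A \<in> \<A>" for \<mu> A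
  proof -
    obtain P where P: "\<forall>p\<in>P. polynomial_fun p" "A = zero_locus P"
      using assms[OF A] unfolding zariski_closed_def by (elim exE conjE)
    have "p \<mu> = 0" if "p \<in> P" for p
    proof -
      have "\<forall>\<nu>\<in>A. p \<nu> = 0" using that by (simp add: P(2) zero_locus_def)
      with P(1) that A have "p \<in> ?Q" by blast
      then show ?thesis using \<mu> unfolding zero_locus_def by simp
    qed
    with \<mu> show ?thesis by (simp add: P(2) zero_locus_def)
  qed
  moreover have "\<mu> \<in> bilinear_products" if "\<mu> \<in> zero_locus ?Q" for \<mu>
    using that by (simp add: zero_locus_def)
  moreover have "\<mu> \<in> zero_locus ?Q" if "\<mu> \<in> bilinear_products \<inter> \<Inter>\<A>" for \<mu>
    using that unfolding zero_locus_def by fast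
  ultimately have "bilinear_products \<inter> \<Inter>\<A> = zero_locus ?Q"
    by (intro equalityI subsetI IntI InterI)
  moreover have "\<forall>p\<in>?Q. polynomial_fun p" by simp
  ultimately show ?thesis unfolding zariski_closed_def by (intro exI[of _ ?Q] conjI)
qed

lemma istopology_zariski:
  "istopology (\<lambda>U. U \<subseteq> bilinear_products \<and> zariski_closed (bilinear_products - U))"
proof -
  have Int: "zariski_closed (bilinear_products - S \<inter> T)"
    if "zariski_closed (bilinear_products - S)" "zariski_closed (bilinear_products - T)"
    for S T :: "'a product set"
    using zariski_closed_Un[OF that] by (simp add: Diff_Int)
  have Union: "zariski_closed (bilinear_products - \<Union>\<K>)"
    if "\<forall>K\<in>\<K>. K \<subseteq> bilinear_products \<and> zariski_closed (bilinear_products - K)"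
    for \<K> :: "'a product set set"
  proof -
    have "zariski_closed (bilinear_products \<inter> \<Inter>((\<lambda>K. bilinear_products - K) ` \<K>))"
      by (rule zariski_closed_Inter) (use that in blast)
    moreover have "bilinear_products \<inter> \<Inter>((\<lambda>K. bilinear_products - K) ` \<K>)
        = bilinear_products - \<Union>\<K>" by blast
    ultimately show ?thesis by simp
  qed
  show ?thesis
    unfolding istopology_def
  proof (intro conjI allI impI)
    fix S T :: "'a product set"
    assume S: "S \<subseteq> bilinear_products \<and> zariski_closed (bilinear_products - S)"
      and T: "T \<subseteq> bilinear_products \<and> zariski_closed (bilinear_products - T)"
    show "S \<inter> T \<subseteq> bilinear_products" using S by blast
    show "zariski_closed (bilinear_products - S \<inter> T)"
      by (rule Int) (rule conjunct2[OF S], rule conjunct2[OF T])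
  next
    fix \<K> :: "'a product set set"
    assume K: "\<forall>K\<in>\<K>. K \<subseteq> bilinear_products \<and> zariski_closed (bilinear_products - K)"
    show "\<Union>\<K> \<subseteq> bilinear_products" using K by blast
    show "zariski_closed (bilinear_products - \<Union>\<K>)" by (rule Union[OF K])
  qed
qed

lemma openin_zariski:
  "openin zariski U \<longleftrightarrow> U \<subseteq> bilinear_products \<and> zariski_closed (bilinear_products - U)"
  unfolding zariski_def topology_inverse'[OF istopology_zariski] ..

lemma zariski_closed_bilinear_products: "zariski_closed bilinear_products"
  unfolding zariski_closed_def by (rule exI[of _ "{}"]) (simp add: zero_locus_def)

lemma zariski_closed_empty: "zariski_closed {}"
  unfolding zariski_closed_def
  by (rule exI[of _ "{\<lambda>\<mu>. 1}"]) (auto simp: zero_locus_def intro: polynomial_fun.const)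

lemma topspace_zariski: "topspace zariski = bilinear_products"
proof (rule antisym)
  show "topspace zariski \<subseteq> bilinear_products"
    by (rule conjunct1[OF iffD1[OF openin_zariski openin_topspace]])
  show "bilinear_products \<subseteq> topspace zariski"
    by (rule openin_subset) (simp add: openin_zariski zariski_closed_empty)
qed

lemma closedin_zariski: "closedin zariski Z \<longleftrightarrow> zariski_closed Z"
proof -
  have "Z \<subseteq> bilinear_products" if "zariski_closed Z"
    using that unfolding zariski_closed_def zero_locus_def by blast
  then show ?thesis
    unfolding closedin_def topspace_zariski openin_zariski by (metis Diff_subset double_diff subset_refl)
qed

subsection \<open>Irreducible components of a topological space\<close>

definition irreducible_in :: "'a topology \<Rightarrow> 'a set \<Rightarrow> bool" where
  "irreducible_in X S \<longleftrightarrow> S \<subseteq> topspace X \<and> S \<noteq> {} \<and>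
     (\<forall>A B. closedin X A \<and> closedin X B \<and> S \<subseteq> A \<union> B \<longrightarrow> S \<subseteq> A \<or> S \<subseteq> B)"

definition irreducible_components_of :: "'a topology \<Rightarrow> 'a set set" where
  "irreducible_components_of X =
     {C. irreducible_in X C \<and> (\<forall>S. irreducible_in X S \<and> C \<subseteq> S \<longrightarrow> S = C)}"

subsection \<open>Dual mock-Lie algebras\<close>

definition dual_mock_lie :: "'n::finite product set" where
  "dual_mock_lie = {\<mu> \<in> bilinear_products.
     (\<forall>x y. \<mu> x y = - \<mu> y x) \<and> (\<forall>x y z. \<mu> (\<mu> x y) z = - \<mu> x (\<mu> y z))}"

definition GL_action :: "complex^'n^'n \<Rightarrow> 'n::finite product \<Rightarrow> 'n product" where
  "GL_action g \<mu> = (\<lambda>x y. g *v \<mu> (matrix_inv g *v x) (matrix_inv g *v y))"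

definition orbit :: "'n::finite product \<Rightarrow> 'n product set" where
  "orbit \<mu> = {GL_action g \<mu> | g. invertible g}"

definition rigid :: "'n::finite product \<Rightarrow> bool" where
  "rigid \<mu> \<longleftrightarrow> \<mu> \<in> dual_mock_lie \<and> openin (subtopology zariski dual_mock_lie) (orbit \<mu>)"

subsection \<open>The four algebras\<close>

text \<open>A table is a list of entries \<open>(i, j, v)\<close>, each standing for the product \<open>e\<^sub>i e\<^sub>j = v\<close>.
  If \<open>i \<noteq> j\<close> in every entry and no unordered pair is listed twice, then \<open>table_product\<close> is the
  bilinear product with these values, with \<open>e\<^sub>j e\<^sub>i = - v\<close>, and with all other products of basis
  vectors equal to zero.\<close>

definition table_product :: "('n \<times> 'n \<times> (complex^'n)) list \<Rightarrow> 'n::finite product" where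
  "table_product T = (\<lambda>x y. \<Sum>(i, j, v)\<leftarrow>T. (x $ i * y $ j - x $ j * y $ i) *s v)"

text \<open>The index type \<^typ>\<open>8\<close> consists of the residues modulo 8, so \<open>1, \<dots>, 8\<close> are its eight
  distinct elements, with \<open>8 = 0\<close>.\<close>

definition D17 :: "8 product" where
  "D17 = table_product [(1, 2, e 7), (3, 4, e 8), (5, 6, e 7 + e 8)]"

definition D30 :: "8 product" where
  "D30 = table_product
     [(1, 2, e 6), (1, 3, e 7), (2, 3, e 8), (1, 4, e 8), (2, 5, e 7), (4, 5, e 6)]"

definition D33 :: "8 product" where
  "D33 = table_product [(1, 2, e 5), (2, 3, e 6), (3, 4, e 7), (4, 1, e 8)]"

definition D36 :: "8 product" where
  "D36 = table_product
     [(1, 2, e 4), (1, 3, e 5), (2, 3, e 6), (1, 6, e 8), (2, 5, - e 8), (3, 4, e 8), (3, 7, e 8)]"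

end

theory Submission
  imports Defs
begin

text \<open>
  The triple product \<open>(xy)z\<close> is alternating and all products of four elements vanish. If some
  \<open>(xy)z\<close> is nonzero, then \<open>x, y, z\<close>, their pairwise products and \<open>(xy)z\<close> are seven linearly
  independent vectors, and any eighth vector can be corrected to an annihilating one; so the algebra
  is \<open>D36\<close>, and its orbit is the open set where \<open>(xy)z \<noteq> 0\<close>. Otherwise the product factors as a skew map
  \<open>\<complex>^m \<times> \<complex>^m \<rightarrow> \<complex>^(8 - m)\<close> with \<open>m \<in> {4, 5, 6}\<close>, an element of a linear space of products.

  On each of these three linear spaces the block subgroup of \<open>GL\<^sub>8\<close> acts with a dense orbit, that of
  \<open>D33\<close>, \<open>D30\<close>, \<open>D17\<close>: where a suitable minor \<open>f\<close> of the infinitesimal action is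
  nonzero, orbits are open in the Euclidean topology by the open mapping theorem, and \<open>{f \<noteq> 0}\<close> is
  connected because it meets each complex line in a cofinite set. A product close to such an algebra
  has a truncation in the dense orbit; it cannot be a three-step algebra, since those
  have a five-dimensional subspace multiplying everything into a line, and a two-step algebra is
  determined by its truncation. Thus the four orbits are open and their closures cover the variety.
\<close>

subsection \<open>Bilinear products and the linear group\<close>

text \<open>Density and openness of orbits have to be obtained without dimension theory of
  varieties. One polynomial f per orbit does both: if f is nonzero at D, and f nonzero puts a point
  of the linear space into the orbit, then restriction to lines shows that the orbit is dense there.
  The Euclidean topology serves only to prove that such an f works. Near D the variety itself is not
  linear, so f is composed with the projection onto the linear space, and an algebra must be
  recovered from its projection.

  The bounds on m come from the annihilator. If a two-step product on an 8-dimensional space had a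
  one-dimensional annihilator, its values would lie on that line and it would be a skew form of even
  size with one-dimensional kernel, which cannot exist; so m = 6 is the largest value. If the
  annihilator has dimension 5 or more, three vectors generate modulo it and the values span at most
  three dimensions, so a four-dimensional space fits between values and annihilator and m = 4 still
  serves.

  The four orbits are told apart by annihilator dimensions 2, 3, 4 and by the nonzero triple
  product.\<close>

lemma bilinear_product_linear:
  assumes "\<mu> \<in> bilinear_products"
  shows "Vector_Spaces.linear (*s) (*s) (\<mu> x)" "Vector_Spaces.linear (*s) (*s) (\<lambda>x. \<mu> x y)"
  using assms by (auto simp: bilinear_products_def)

lemma bilinear_product_simps:
  fixes \<mu> :: "'n::finite product"
  assumes "\<mu> \<in> bilinear_products"
  shows "\<mu> (x + y) z = \<mu> x z + \<mu> y z" "\<mu> x (y + z) = \<mu> x y + \<mu> x z"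
    "\<mu> (x - y) z = \<mu> x z - \<mu> y z" "\<mu> x (y - z) = \<mu> x y - \<mu> x z"
    "\<mu> (- x) z = - \<mu> x z" "\<mu> x (- z) = - \<mu> x z"
    "\<mu> (c *s x) y = c *s \<mu> x y" "\<mu> x (c *s y) = c *s \<mu> x y"
    "\<mu> 0 y = 0" "\<mu> x 0 = 0"
    "\<mu> (sum f S) y = (\<Sum>i\<in>S. \<mu> (f i) y)" "\<mu> x (sum f S) = (\<Sum>i\<in>S. \<mu> x (f i))"
proof -
  note l = bilinear_product_linear[OF assms, folded module_hom_iff_linear]
  show "\<mu> (x + y) z = \<mu> x z + \<mu> y z" "\<mu> x (y + z) = \<mu> x y + \<mu> x z"
    using l[THEN module_hom.add] by auto
  show "\<mu> (x - y) z = \<mu> x z - \<mu> y z" "\<mu> x (y - z) = \<mu> x y - \<mu> x z"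
    using l[THEN module_hom.diff] by auto
  show "\<mu> (- x) z = - \<mu> x z" "\<mu> x (- z) = - \<mu> x z"
    using l[THEN module_hom.neg] by auto
  show "\<mu> (c *s x) y = c *s \<mu> x y" "\<mu> x (c *s y) = c *s \<mu> x y"
    using l[THEN module_hom.scale] by auto
  show "\<mu> 0 y = 0" "\<mu> x 0 = 0"
    using l[THEN module_hom.zero] by auto
  show "\<mu> (sum f S) y = (\<Sum>i\<in>S. \<mu> (f i) y)" "\<mu> x (sum f S) = (\<Sum>i\<in>S. \<mu> x (f i))"
    using l[THEN module_hom.sum] by auto
qed

lemma bilinear_productsI:
  fixes \<mu> :: "'n::finite product"
  assumes "\<And>x y z. \<mu> (x + y) z = \<mu> x z + \<mu> y z" "\<And>x y z. \<mu> x (y + z) = \<mu> x y + \<mu> x z"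
    "\<And>c x y. \<mu> (c *s x) y = c *s \<mu> x y" "\<And>c x y. \<mu> x (c *s y) = c *s \<mu> x y"
  shows "\<mu> \<in> bilinear_products"
  using assms by (auto simp: bilinear_products_def Vector_Spaces.linear_iff vec.vector_space_axioms)

lemma bilinear_product_expand:
  assumes "\<mu> \<in> bilinear_products"
  shows "\<mu> x y = (\<Sum>i\<in>UNIV. \<Sum>j\<in>UNIV. (x $ i * y $ j) *s \<mu> (e i) (e j))"
proof -
  have "\<mu> x y = \<mu> (\<Sum>i\<in>UNIV. x $ i *s e i) (\<Sum>j\<in>UNIV. y $ j *s e j)"
    by (simp add: basis_expansion)
  also have "\<dots> = (\<Sum>j\<in>UNIV. \<Sum>i\<in>UNIV. (x $ i * y $ j) *s \<mu> (e i) (e j))"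
    by (simp add: bilinear_product_simps[OF assms] vec.scale_sum_right mult.commute)
  also have "\<dots> = (\<Sum>i\<in>UNIV. \<Sum>j\<in>UNIV. (x $ i * y $ j) *s \<mu> (e i) (e j))"
    by (rule sum.swap)
  finally show ?thesis .
qed

lemma bilinear_product_expand_component:
  assumes "\<mu> \<in> bilinear_products"
  shows "\<mu> x y $ k = (\<Sum>i\<in>UNIV. \<Sum>j\<in>UNIV. x $ i * y $ j * structure_constant i j k \<mu>)"
  by (subst bilinear_product_expand[OF assms]) (simp add: structure_constant_def)

lemma bilinear_product_eqI:
  assumes "\<mu> \<in> bilinear_products" "\<nu> \<in> bilinear_products"
    and "\<And>i j. \<mu> (e i) (e j) = \<nu> (e i) (e j)"
  shows "\<mu> = \<nu>"
proof (intro ext)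
  fix x y
  show "\<mu> x y = \<nu> x y"
    unfolding bilinear_product_expand[OF assms(1), of x y]
      bilinear_product_expand[OF assms(2), of x y] assms(3) ..
qed

section \<open>Matrix inverses and the action of the linear group\<close>

lemma matrix_vector_mult_axis_component [simp]:
  fixes A :: "'a::semiring_1^'n^'m"
  shows "(A *v axis j 1) $ i = A $ i $ j"
  by (simp add: matrix_vector_mult_def axis_def if_distrib sum.delta' cong: if_cong)

lemma invertibleD:
  fixes g :: "'a::field^'n^'n"
  assumes "invertible g"
  shows "g ** matrix_inv g = mat 1" "matrix_inv g ** g = mat 1" "invertible (matrix_inv g)"
proof -
  have "\<exists>A'. g ** A' = mat 1 \<and> A' ** g = mat 1"
    using assms by (simp add: invertible_def)
  from someI_ex[OF this] show *: "g ** matrix_inv g = mat 1" "matrix_inv g ** g = mat 1"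
    by (simp_all add: matrix_inv_def)
  then show "invertible (matrix_inv g)"
    unfolding invertible_def by blast
qed

lemma matrix_inv_eq:
  fixes g :: "'a::field^'n^'n"
  assumes "h ** g = mat 1"
  shows "matrix_inv g = h" "invertible g"
proof -
  show "invertible g" using assms invertible_left_inverse by blast
  then have "h ** (g ** matrix_inv g) = h" by (simp add: invertibleD)
  then show "matrix_inv g = h" by (simp add: matrix_mul_assoc assms)
qed

lemma matrix_inv_mult_vec [simp]:
  fixes g :: "'a::field^'n^'n"
  assumes "invertible g"
  shows "g *v (matrix_inv g *v x) = x" "matrix_inv g *v (g *v x) = x"
  using invertibleD[OF assms] by (simp_all add: matrix_vector_mul_assoc)

lemma GL_action_mem:
  assumes "\<mu> \<in> bilinear_products"
  shows "GL_action g \<mu> \<in> bilinear_products"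
  by (rule bilinear_productsI)
    (simp_all add: GL_action_def bilinear_product_simps[OF assms] vec.add vec.scale)

lemma GL_action_mult:
  assumes "invertible g" "invertible h"
  shows "GL_action g (GL_action h \<mu>) = GL_action (g ** h) \<mu>"
proof -
  have "(matrix_inv h ** matrix_inv g) ** (g ** h) = matrix_inv h ** (matrix_inv g ** g) ** h"
    by (simp add: matrix_mul_assoc)
  also have "\<dots> = mat 1" using assms by (simp add: invertibleD)
  finally have "matrix_inv (g ** h) = matrix_inv h ** matrix_inv g" by (rule matrix_inv_eq)
  then show ?thesis by (simp add: GL_action_def matrix_vector_mul_assoc)
qed

lemma GL_action_one [simp]: "GL_action (mat 1) \<mu> = \<mu>"
proof -
  have "matrix_inv (mat 1) = (mat 1 :: complex^'a^'a)" by (rule matrix_inv_eq) simp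
  then show ?thesis by (simp add: GL_action_def fun_eq_iff)
qed

lemma invertible_mat_1: "invertible (mat 1 :: 'a::field^'n^'n)"
  by (rule matrix_inv_eq(2)[of "mat 1"]) simp

lemma GL_action_inverse:
  assumes "invertible g"
  shows "GL_action g \<mu> = \<nu> \<longleftrightarrow> \<mu> = GL_action (matrix_inv g) \<nu>"
  using GL_action_mult[OF assms invertibleD(3)[OF assms]]
    GL_action_mult[OF invertibleD(3)[OF assms] assms] invertibleD[OF assms] by auto

lemma mem_orbit_self: "\<mu> \<in> orbit \<mu>"
  unfolding orbit_def using invertible_mat_1 GL_action_one[of \<mu>, symmetric] by blast

lemma orbit_GL_action:
  assumes "invertible g" "\<nu> \<in> orbit \<mu>"
  shows "GL_action g \<nu> \<in> orbit \<mu>"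
  using assms GL_action_mult invertible_mult unfolding orbit_def by blast

lemma orbit_sym:
  assumes "\<nu> \<in> orbit \<mu>"
  shows "\<mu> \<in> orbit \<nu>"
proof -
  obtain g where "invertible g" "\<nu> = GL_action g \<mu>"
    using assms by (auto simp: orbit_def)
  then show ?thesis
    using GL_action_inverse[of g \<mu> \<nu>] invertibleD(3) by (auto simp: orbit_def)
qed

lemma orbit_trans:
  assumes "\<nu> \<in> orbit \<mu>" "\<rho> \<in> orbit \<nu>"
  shows "\<rho> \<in> orbit \<mu>"
  using assms orbit_GL_action unfolding orbit_def[of \<nu>] by blast

lemma orbit_subset_bilinear_products:
  "\<mu> \<in> bilinear_products \<Longrightarrow> orbit \<mu> \<subseteq> bilinear_products"
  unfolding orbit_def using GL_action_mem by blast

lemma mem_orbitI: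
  assumes "\<mu> \<in> bilinear_products" "\<nu> \<in> bilinear_products" "invertible h"
    and "\<And>i j. h *v \<mu> (e i) (e j) = \<nu> (h *v e i) (h *v e j)"
  shows "\<nu> \<in> orbit \<mu>"
proof -
  have "\<mu> = GL_action (matrix_inv h) \<nu>"
  proof (rule bilinear_product_eqI[OF assms(1) GL_action_mem[OF assms(2)]])
    fix i j
    have "matrix_inv (matrix_inv h) = h"
      using invertibleD[OF assms(3)] by (intro matrix_inv_eq)
    then show "\<mu> (e i) (e j) = GL_action (matrix_inv h) \<nu> (e i) (e j)"
      using assms(3) by (simp add: GL_action_def flip: assms(4))
  qed
  then have "GL_action h \<mu> = \<nu>" using GL_action_inverse[OF assms(3)] by blast
  then show ?thesis unfolding orbit_def using assms(3) by blast
qed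

section \<open>Invariance of the dual mock-Lie identities\<close>

lemma dual_mock_lieD:
  assumes "\<mu> \<in> dual_mock_lie"
  shows "\<mu> \<in> bilinear_products" "\<mu> x y = - \<mu> y x" "\<mu> (\<mu> x y) z = - \<mu> x (\<mu> y z)"
  using assms unfolding dual_mock_lie_def by blast+

lemma dual_mock_lie_GL_action:
  assumes "\<mu> \<in> dual_mock_lie" "invertible g"
  shows "GL_action g \<mu> \<in> dual_mock_lie"
proof -
  note \<mu> = dual_mock_lieD[OF assms(1)]
  have 1: "GL_action g \<mu> x y = - GL_action g \<mu> y x" for x y
    unfolding GL_action_def by (subst \<mu>(2)) (simp add: vec.neg)
  have 2: "GL_action g \<mu> (GL_action g \<mu> x y) z = - GL_action g \<mu> x (GL_action g \<mu> y z)" for x y z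
    unfolding GL_action_def using assms(2) \<mu>(3) by (simp add: vec.neg)
  show ?thesis unfolding dual_mock_lie_def using GL_action_mem[OF \<mu>(1)] 1 2 by blast
qed

lemma orbit_subset_dual_mock_lie: "\<mu> \<in> dual_mock_lie \<Longrightarrow> orbit \<mu> \<subseteq> dual_mock_lie"
  unfolding orbit_def using dual_mock_lie_GL_action by blast

subsection \<open>Polynomial functions\<close>

lemma polynomial_fun_sum:
  "(\<And>i. i \<in> S \<Longrightarrow> polynomial_fun (p i)) \<Longrightarrow> polynomial_fun (\<lambda>\<mu>. \<Sum>i\<in>S. p i \<mu>)"
  by (induction S rule: infinite_finite_induct) (auto intro: polynomial_fun.intros)

lemma polynomial_fun_prod:
  "(\<And>i. i \<in> S \<Longrightarrow> polynomial_fun (p i)) \<Longrightarrow> polynomial_fun (\<lambda>\<mu>. \<Prod>i\<in>S. p i \<mu>)"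
  by (induction S rule: infinite_finite_induct) (auto intro: polynomial_fun.intros)

lemma polynomial_fun_det:
  fixes A :: "'n::finite product \<Rightarrow> complex^'m^'m"
  assumes "\<And>i j. polynomial_fun (\<lambda>\<mu>. A \<mu> $ i $ j)"
  shows "polynomial_fun (\<lambda>\<mu>. det (A \<mu>))"
  unfolding det_def
  by (intro polynomial_fun_sum polynomial_fun.mult polynomial_fun_prod polynomial_fun.const assms)

text \<open>Agreement is claimed on \<open>bilinear_products\<close> only: elsewhere a product is an
  arbitrary function, not determined by its structure constants, whereas \<open>F\<close> may
  evaluate it away from the basis vectors.\<close>

lemma polynomial_fun_subst:
  assumes "polynomial_fun p"
    and "\<And>i j k. \<exists>q. polynomial_fun q \<and> (\<forall>\<mu>\<in>bilinear_products. q \<mu> = structure_constant i j k (F \<mu>))"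
  shows "\<exists>q. polynomial_fun q \<and> (\<forall>\<mu>\<in>bilinear_products. q \<mu> = p (F \<mu>))"
  using assms(1)
proof induction
  case (const c)
  show ?case by (auto intro: exI[of _ "\<lambda>_. c"] polynomial_fun.const)
next
  case (coord i j k)
  show ?case by (rule assms(2))
next
  case (add p q)
  then obtain p' q' where "polynomial_fun p'" "\<forall>\<mu>\<in>bilinear_products. p' \<mu> = p (F \<mu>)"
    "polynomial_fun q'" "\<forall>\<mu>\<in>bilinear_products. q' \<mu> = q (F \<mu>)" by blast
  then show ?case
    by (intro exI[of _ "\<lambda>\<mu>. p' \<mu> + q' \<mu>"]) (simp add: polynomial_fun.add)
next
  case (mult p q)
  then obtain p' q' where "polynomial_fun p'" "\<forall>\<mu>\<in>bilinear_products. p' \<mu> = p (F \<mu>)"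
    "polynomial_fun q'" "\<forall>\<mu>\<in>bilinear_products. q' \<mu> = q (F \<mu>)" by blast
  then show ?case
    by (intro exI[of _ "\<lambda>\<mu>. p' \<mu> * q' \<mu>"]) (simp add: polynomial_fun.mult)
qed

lemma polynomial_fun_GL_action:
  assumes "polynomial_fun p"
  shows "\<exists>q. polynomial_fun q \<and> (\<forall>\<mu>\<in>bilinear_products. q \<mu> = p (GL_action g \<mu>))"
proof (rule polynomial_fun_subst[OF assms])
  fix i j k
  let ?h = "matrix_inv g"
  let ?q = "\<lambda>\<mu>. \<Sum>c\<in>UNIV. g $ k $ c *
    (\<Sum>a\<in>UNIV. \<Sum>b\<in>UNIV. (?h *v e i) $ a * (?h *v e j) $ b * structure_constant a b c \<mu>)"
  have "polynomial_fun ?q"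
    by (intro polynomial_fun_sum polynomial_fun.mult polynomial_fun.const polynomial_fun.coord)
  moreover have "?q \<mu> = structure_constant i j k (GL_action g \<mu>)" if "\<mu> \<in> bilinear_products" for \<mu>
    unfolding structure_constant_def[of i j k] GL_action_def
    by (subst matrix_vector_mult_def) (simp add: bilinear_product_expand_component[OF that])
  ultimately show "\<exists>q. polynomial_fun q \<and>
      (\<forall>\<mu>\<in>bilinear_products. q \<mu> = structure_constant i j k (GL_action g \<mu>))"
    by blast
qed

text \<open>Separating the points off \<open>Z\<close> one at a time is enough: the set of all
  polynomials vanishing on \<open>Z\<close> then cuts out \<open>Z\<close>.\<close>

lemma zariski_closedI:
  assumes "\<And>\<mu>. \<mu> \<in> bilinear_products \<Longrightarrow> \<mu> \<notin> Z \<Longrightarrow>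
      \<exists>p. polynomial_fun p \<and> p \<mu> \<noteq> 0 \<and> (\<forall>\<nu>\<in>Z. p \<nu> = 0)"
    and "Z \<subseteq> bilinear_products"
  shows "zariski_closed Z"
proof -
  let ?P = "{p. polynomial_fun p \<and> (\<forall>\<nu>\<in>Z. p \<nu> = 0)}"
  have "Z = zero_locus ?P"
  proof (intro equalityI subsetI)
    fix \<mu> assume "\<mu> \<in> Z"
    then show "\<mu> \<in> zero_locus ?P" using assms(2) by (auto simp: zero_locus_def)
  next
    fix \<mu> assume \<mu>: "\<mu> \<in> zero_locus ?P"
    show "\<mu> \<in> Z"
    proof (rule ccontr)
      assume "\<mu> \<notin> Z"
      have "\<mu> \<in> bilinear_products" using \<mu> by (simp add: zero_locus_def)
      from assms(1)[OF this \<open>\<mu> \<notin> Z\<close>]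
      obtain p where p: "polynomial_fun p" "p \<mu> \<noteq> 0" "\<forall>\<nu>\<in>Z. p \<nu> = 0"
        by (elim exE conjE)
      then have "p \<in> ?P" by (intro CollectI conjI)
      from zero_locusD[OF \<mu> this] p(2) show False by (rule notE[rotated])
    qed
  qed
  moreover have "\<forall>p\<in>?P. polynomial_fun p" by (intro ballI) (elim CollectE conjE)
  ultimately show ?thesis unfolding zariski_closed_def by (intro exI[of _ ?P] conjI)
qed

lemma zariski_closedD:
  assumes "zariski_closed Z" "\<mu> \<in> bilinear_products" "\<mu> \<notin> Z"
  shows "\<exists>p. polynomial_fun p \<and> p \<mu> \<noteq> 0 \<and> (\<forall>\<nu>\<in>Z. p \<nu> = 0)"
proof -
  obtain P where P: "\<forall>p\<in>P. polynomial_fun p" "Z = zero_locus P"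
    using assms(1) unfolding zariski_closed_def by (elim exE conjE)
  then have "\<not> (\<forall>p\<in>P. p \<mu> = 0)" using assms by (simp add: zero_locus_def)
  then obtain p where "p \<in> P" "p \<mu> \<noteq> 0" unfolding Set.ball_simps by (elim bexE)
  then show ?thesis using P by (intro exI[of _ p]) (simp add: zero_locus_def)
qed

lemma in_zariski_closure_iff:
  assumes "S \<subseteq> bilinear_products"
  shows "\<mu> \<in> zariski closure_of S \<longleftrightarrow> \<mu> \<in> bilinear_products \<and>
    (\<forall>p. polynomial_fun p \<longrightarrow> (\<forall>\<nu>\<in>S. p \<nu> = 0) \<longrightarrow> p \<mu> = 0)"
proof -
  let ?C = "zero_locus {p. polynomial_fun p \<and> (\<forall>\<nu>\<in>S. p \<nu> = 0)}"
  have "zariski_closed ?C"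
    unfolding zariski_closed_def
    by (rule exI[of _ "{p. polynomial_fun p \<and> (\<forall>\<nu>\<in>S. p \<nu> = 0)}"]) simp
  moreover have "S \<subseteq> ?C" using assms by (auto simp: zero_locus_def)
  moreover have "?C \<subseteq> T" if "S \<subseteq> T" "zariski_closed T" for T
  proof
    fix \<mu> assume "\<mu> \<in> ?C"
    then have \<mu>: "\<mu> \<in> bilinear_products"
      "\<And>p. polynomial_fun p \<Longrightarrow> \<forall>\<nu>\<in>S. p \<nu> = 0 \<Longrightarrow> p \<mu> = 0"
      by (auto simp: zero_locus_def)
    show "\<mu> \<in> T"
    proof (rule ccontr)
      assume "\<mu> \<notin> T"
      then obtain p where "polynomial_fun p" "p \<mu> \<noteq> 0" "\<forall>\<nu>\<in>T. p \<nu> = 0"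
        using zariski_closedD[OF \<open>zariski_closed T\<close> \<mu>(1)] by meson
      then show False using \<mu>(2) \<open>S \<subseteq> T\<close> by (meson subsetD)
    qed
  qed
  ultimately have "zariski closure_of S = ?C"
    by (intro closure_of_unique) (auto simp: closedin_zariski)
  then show ?thesis by (simp add: zero_locus_def imp_conjL)
qed

lemma zariski_closure_GL_action:
  assumes "\<mu> \<in> bilinear_products" "\<nu> \<in> zariski closure_of orbit \<mu>" "invertible g"
  shows "GL_action g \<nu> \<in> zariski closure_of orbit \<mu>"
proof -
  note o = orbit_subset_bilinear_products[OF assms(1)]
  have \<nu>: "\<nu> \<in> bilinear_products" "\<And>p. polynomial_fun p \<Longrightarrow> \<forall>\<nu>\<in>orbit \<mu>. p \<nu> = 0 \<Longrightarrow> p \<nu> = 0"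
    using assms(2) by (auto simp: in_zariski_closure_iff[OF o])
  have "p (GL_action g \<nu>) = 0" if p: "polynomial_fun p" "\<forall>\<nu>\<in>orbit \<mu>. p \<nu> = 0" for p
  proof -
    obtain q where q: "polynomial_fun q" "\<forall>\<mu>\<in>bilinear_products. q \<mu> = p (GL_action g \<mu>)"
      using polynomial_fun_GL_action[OF p(1)] by blast
    have "\<forall>\<nu>\<in>orbit \<mu>. q \<nu> = 0"
      using q(2) p(2) o orbit_GL_action[OF assms(3)] by auto
    then show ?thesis using \<nu>(2)[OF q(1)] q(2) \<nu>(1) by simp
  qed
  then show ?thesis
    unfolding in_zariski_closure_iff[OF o] using GL_action_mem[OF \<nu>(1)] by (intro conjI allI impI)
qed

lemma zariski_closed_dual_mock_lie: "zariski_closed (dual_mock_lie :: 'n::finite product set)"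
proof (rule zariski_closedI)
  show "dual_mock_lie \<subseteq> bilinear_products" by (auto simp: dual_mock_lie_def)
next
  fix \<mu> :: "'n product"
  assume \<mu>: "\<mu> \<in> bilinear_products" "\<mu> \<notin> dual_mock_lie"
  \<comment> \<open>Both identities are multilinear, so their coordinates on basis vectors,
    \<open>p1\<close> and \<open>p2\<close>, already cut out the variety.\<close>
  define p1 where "p1 i j k = (\<lambda>\<mu>::'n product. structure_constant i j k \<mu> + structure_constant j i k \<mu>)"
    for i j k
  define p2 where "p2 i j k l = (\<lambda>\<mu>::'n product. (\<Sum>a\<in>UNIV. structure_constant i j a \<mu> * structure_constant a k l \<mu>)
    + (\<Sum>a\<in>UNIV. structure_constant j k a \<mu> * structure_constant i a l \<mu>))" for i j k l
  have pol: "polynomial_fun (p1 i j k)" "polynomial_fun (p2 i j k l)" for i j k l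
    unfolding p1_def p2_def
    by (intro polynomial_fun_sum polynomial_fun.add polynomial_fun.mult polynomial_fun.coord)+
  have p2: "p2 i j k l \<nu> = (\<nu> (\<nu> (e i) (e j)) (e k) + \<nu> (e i) (\<nu> (e j) (e k))) $ l"
    if "\<nu> \<in> bilinear_products" for \<nu> i j k l
  proof -
    have 1: "\<nu> x (e k) $ l = (\<Sum>a\<in>UNIV. x $ a * structure_constant a k l \<nu>)" for x
    proof -
      have "\<nu> (\<Sum>a\<in>UNIV. x $ a *s e a) (e k) = (\<Sum>a\<in>UNIV. x $ a *s \<nu> (e a) (e k))"
        by (simp only: bilinear_product_simps[OF that])
      then show ?thesis by (simp add: basis_expansion structure_constant_def)
    qed
    have 2: "\<nu> (e i) x $ l = (\<Sum>a\<in>UNIV. x $ a * structure_constant i a l \<nu>)" for x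
    proof -
      have "\<nu> (e i) (\<Sum>a\<in>UNIV. x $ a *s e a) = (\<Sum>a\<in>UNIV. x $ a *s \<nu> (e i) (e a))"
        by (simp only: bilinear_product_simps[OF that])
      then show ?thesis by (simp add: basis_expansion structure_constant_def)
    qed
    show ?thesis
      unfolding p2_def vector_add_component 1[of "\<nu> (e i) (e j)"] 2[of "\<nu> (e j) (e k)"]
      by (simp only: structure_constant_def)
  qed
  have van: "p1 i j k \<nu> = 0" "p2 i j k l \<nu> = 0" if "\<nu> \<in> dual_mock_lie" for i j k l \<nu>
  proof -
    note \<nu> = dual_mock_lieD[OF that]
    show "p1 i j k \<nu> = 0" unfolding p1_def structure_constant_def by (subst \<nu>(2)) simp
    show "p2 i j k l \<nu> = 0" unfolding p2[OF \<nu>(1)] using \<nu>(3) by simp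
  qed
  have "\<exists>p\<in>{p1 i j k |i j k. True} \<union> {p2 i j k l |i j k l. True}. p \<mu> \<noteq> 0"
  proof (rule ccontr)
    assume "\<not> ?thesis"
    then have z: "p1 i j k \<mu> = 0" "p2 i j k l \<mu> = 0" for i j k l by blast+
    have b1: "\<mu> (e i) (e j) = - \<mu> (e j) (e i)" for i j
      using z(1)[of i j] by (simp add: p1_def structure_constant_def vec_eq_iff eq_neg_iff_add_eq_0)
    have b2: "\<mu> (\<mu> (e i) (e j)) (e k) = - \<mu> (e i) (\<mu> (e j) (e k))" for i j k
      using z(2)[of i j k] by (simp add: p2[OF \<mu>(1)] vec_eq_iff eq_neg_iff_add_eq_0)
    have "\<mu> = (\<lambda>x y. - \<mu> y x)"
      by (rule bilinear_product_eqI[OF \<mu>(1) bilinear_productsI b1])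
        (simp_all add: bilinear_product_simps[OF \<mu>(1)])
    then have a1: "\<mu> x y = - \<mu> y x" for x y by metis
    have a2: "\<mu> (\<mu> x y) z = - \<mu> x (\<mu> y z)" for x y z
    proof -
      \<comment> \<open>With the third argument frozen at a basis vector both sides are bilinear, so
        equality on basis vectors spreads to all \<open>x\<close>, \<open>y\<close>; expanding
        \<open>z\<close> settles the third argument.\<close>
      have "(\<lambda>x y. \<mu> (\<mu> x y) (e k)) = (\<lambda>x y. - \<mu> x (\<mu> y (e k)))" for k
        by (rule bilinear_product_eqI; (rule bilinear_productsI)?)
          (simp_all add: bilinear_product_simps[OF \<mu>(1)] b2)
      then have *: "\<mu> (\<mu> x y) (e k) = - \<mu> x (\<mu> y (e k))" for x y k by metis
      have "\<mu> (\<mu> x y) (\<Sum>k\<in>UNIV. z $ k *s e k) = - \<mu> x (\<mu> y (\<Sum>k\<in>UNIV. z $ k *s e k))"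
        unfolding bilinear_product_simps[OF \<mu>(1)] * by (simp add: sum_negf)
      then show ?thesis unfolding basis_expansion .
    qed
    show False using \<mu> a1 a2 unfolding dual_mock_lie_def by blast
  qed
  then obtain p where p: "p \<mu> \<noteq> 0" "(\<exists>i j k. p = p1 i j k) \<or> (\<exists>i j k l. p = p2 i j k l)"
    by (elim bexE UnE CollectE) blast+
  then have "polynomial_fun p" "\<forall>\<nu>\<in>dual_mock_lie. p \<nu> = 0"
    using pol van by auto
  with p(1) show "\<exists>p. polynomial_fun p \<and> p \<mu> \<noteq> 0 \<and> (\<forall>\<nu>\<in>dual_mock_lie. p \<nu> = 0)"
    by (intro exI[of _ p] conjI)
qed

subsection \<open>Restriction of polynomial functions to lines\<close>

definition is_poly :: "(complex \<Rightarrow> complex) \<Rightarrow> bool" where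
  "is_poly f \<longleftrightarrow> (\<exists>q. f = poly q)"

lemma is_poly_intros:
  "is_poly (\<lambda>s. c)" "is_poly (\<lambda>s. s)"
  "is_poly f \<Longrightarrow> is_poly h \<Longrightarrow> is_poly (\<lambda>s. f s + h s)"
  "is_poly f \<Longrightarrow> is_poly h \<Longrightarrow> is_poly (\<lambda>s. f s - h s)"
  "is_poly f \<Longrightarrow> is_poly h \<Longrightarrow> is_poly (\<lambda>s. f s * h s)"
  "is_poly f \<Longrightarrow> is_poly (\<lambda>s. f s ^ n)"
proof -
  show "is_poly (\<lambda>s. c)"
    unfolding is_poly_def by (rule exI[of _ "[:c:]"]) auto
  show "is_poly (\<lambda>s. s)"
    unfolding is_poly_def by (rule exI[of _ "[:0, 1:]"]) auto
  fix f h
  show "is_poly (\<lambda>s. f s ^ n)" if "is_poly f" for f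
  proof -
    obtain q where "f = poly q" using \<open>is_poly f\<close> by (auto simp: is_poly_def)
    then show ?thesis unfolding is_poly_def by (intro exI[of _ "q ^ n"]) auto
  qed
  assume "is_poly f" "is_poly h"
  then obtain p q where "f = poly p" "h = poly q" by (auto simp: is_poly_def)
  then show "is_poly (\<lambda>s. f s + h s)" "is_poly (\<lambda>s. f s - h s)" "is_poly (\<lambda>s. f s * h s)"
    unfolding is_poly_def
    by (intro exI[of _ "p + q"] exI[of _ "p - q"] exI[of _ "p * q"]; auto)+
qed

lemma is_poly_sum: "(\<And>i. i \<in> S \<Longrightarrow> is_poly (f i)) \<Longrightarrow> is_poly (\<lambda>s. \<Sum>i\<in>S. f i s)"
  by (induction S rule: infinite_finite_induct) (auto intro: is_poly_intros)

lemma is_poly_prod: "(\<And>i. i \<in> S \<Longrightarrow> is_poly (f i)) \<Longrightarrow> is_poly (\<lambda>s. \<Prod>i\<in>S. f i s)"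
  by (induction S rule: infinite_finite_induct) (auto intro: is_poly_intros)

lemma is_poly_det: "(\<And>i j. is_poly (\<lambda>s. A s $ i $ j)) \<Longrightarrow> is_poly (\<lambda>s. det (A s))"
  unfolding det_def by (intro is_poly_sum is_poly_intros is_poly_prod)

lemma is_poly_finite_zeros:
  assumes "is_poly f" "f a \<noteq> 0"
  shows "finite {s. f s = 0}"
proof -
  obtain q where q: "f = poly q" using assms(1) by (auto simp: is_poly_def)
  with assms(2) have "q \<noteq> 0" by auto
  then show ?thesis unfolding q by (rule poly_roots_finite)
qed

lemma is_poly_eq_0:
  assumes "is_poly f" "finite S" "\<And>s. s \<notin> S \<Longrightarrow> f s = 0"
  shows "f a = 0"
proof (rule ccontr)
  assume "f a \<noteq> 0"
  with assms have "finite (S \<union> {s. f s = 0})" using is_poly_finite_zeros by simp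
  moreover have "UNIV \<subseteq> S \<union> {s. f s = 0}" using assms(3) by auto
  ultimately have "finite (UNIV :: complex set)" by (rule rev_finite_subset)
  then show False using infinite_UNIV_char_0 by blast
qed

text \<open>Despite the name the parameter is complex: this is the affine line with
  \<open>\<mu>\<close> at 0 and \<open>\<nu>\<close> at 1, and removing finitely many points does
  not disconnect it.\<close>

definition segment_product :: "'n::finite product \<Rightarrow> 'n product \<Rightarrow> complex \<Rightarrow> 'n product" where
  "segment_product \<mu> \<nu> s = (\<lambda>x y. (1 - s) *s \<mu> x y + s *s \<nu> x y)"

lemma segment_product_ends [simp]: "segment_product \<mu> \<nu> 0 = \<mu>" "segment_product \<mu> \<nu> 1 = \<nu>"
  by (auto simp: segment_product_def)

lemma is_poly_segment_product:
  assumes "polynomial_fun p"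
  shows "is_poly (\<lambda>s. p (segment_product \<mu> \<nu> s))"
  using assms
proof induction
  case (coord i j k)
  show ?case unfolding structure_constant_def segment_product_def
    by (simp, intro is_poly_intros)
qed (auto intro: is_poly_intros)

text \<open>Along the line \<open>f\<close> has finitely many zeros, being nonzero at parameter 1. A
  polynomial vanishing on \<open>S\<close> thus vanishes on the line off a finite set, hence also at
  parameter 0.\<close>

lemma zariski_closure_segment:
  assumes "S \<subseteq> bilinear_products" "\<mu> \<in> bilinear_products" "polynomial_fun f" "f \<nu> \<noteq> 0"
    and "\<And>s. f (segment_product \<mu> \<nu> s) \<noteq> 0 \<Longrightarrow> segment_product \<mu> \<nu> s \<in> S"
  shows "\<mu> \<in> zariski closure_of S"
proof -
  have "p \<mu> = 0" if p: "polynomial_fun p" "\<forall>\<nu>\<in>S. p \<nu> = 0" for p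
  proof -
    have "finite {s. f (segment_product \<mu> \<nu> s) = 0}"
      using is_poly_finite_zeros[OF is_poly_segment_product[OF assms(3)], of \<mu> \<nu> 1] assms(4) by simp
    then have "p (segment_product \<mu> \<nu> 0) = 0"
      by (rule is_poly_eq_0[OF is_poly_segment_product[OF p(1)]]) (use assms(5) p(2) in blast)
    then show ?thesis by simp
  qed
  then show ?thesis using assms(2) by (simp add: in_zariski_closure_iff[OF assms(1)])
qed

text \<open>Cramer's rule, in the form that shows each entry of the inverse to be polynomial in the
  entries of \<open>h\<close> up to one factor \<open>det h\<close>.\<close>

lemma matrix_inv_det:
  fixes h :: "'a::field^'n^'n"
  assumes "invertible h"
  shows "matrix_inv h $ k $ l * det h = det (\<chi> i j. if j = k then axis l 1 $ i else h $ i $ j)"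
proof -
  show ?thesis
    using cramer_lemma[of k h "matrix_inv h *v axis l 1"]
    unfolding matrix_inv_mult_vec(1)[OF assms] matrix_vector_mult_axis_component by (rule sym)
qed

definition matrix_line :: "complex^'n^'n \<Rightarrow> complex^'n^'n \<Rightarrow> complex \<Rightarrow> complex^'n^'n" where
  "matrix_line a b s = (\<chi> i j. (1 - s) * a $ i $ j + s * b $ i $ j)"

lemma matrix_line_ends [simp]: "matrix_line a b 0 = a" "matrix_line a b 1 = b"
  by (simp_all add: matrix_line_def vec_eq_iff)

lemma is_poly_matrix_line: "is_poly (\<lambda>s. matrix_line a b s $ i $ j)"
  unfolding matrix_line_def by (simp, intro is_poly_intros)

text \<open>Acting by the inverse of the line puts the line itself, polynomial in \<open>s\<close>,
  into the arguments of \<open>\<mu>\<close>. Only the outer inverse has a denominator, one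
  determinant per structure constant, so a power of the determinant clears all of
  \<open>p\<close>.\<close>

lemma is_poly_orbit_line:
  assumes "polynomial_fun p" "\<mu> \<in> bilinear_products"
  shows "\<exists>d q. is_poly q \<and> (\<forall>s. det (matrix_line a b s) \<noteq> 0 \<longrightarrow>
     q s = p (GL_action (matrix_inv (matrix_line a b s)) \<mu>) * det (matrix_line a b s) ^ d)"
  using assms(1)
proof induction
  case (const c)
  show ?case by (rule exI[of _ 0], rule exI[of _ "\<lambda>s. c"]) (auto intro: is_poly_intros)
next
  case (coord i j k)
  let ?h = "matrix_line a b"
  let ?q = "\<lambda>s. \<Sum>c\<in>UNIV. det (\<chi> i' j'. if j' = k then axis c 1 $ i' else ?h s $ i' $ j') *
    (\<Sum>p\<in>UNIV. \<Sum>r\<in>UNIV. ?h s $ p $ i * ?h s $ r $ j * structure_constant p r c \<mu>)"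
  have "is_poly (\<lambda>s. if j' = k then axis c 1 $ i' else ?h s $ i' $ j')" for i' j' c
    by (cases "j' = k") (simp_all add: is_poly_intros is_poly_matrix_line)
  then have "is_poly ?q"
    by (intro is_poly_sum is_poly_intros is_poly_matrix_line is_poly_det) simp
  moreover have "?q s = structure_constant i j k (GL_action (matrix_inv (?h s)) \<mu>) * det (?h s) ^ 1"
    if "det (?h s) \<noteq> 0" for s
  proof -
    have inv: "invertible (?h s)" using that by (simp add: invertible_det_nz)
    have "matrix_inv (matrix_inv (?h s)) = ?h s"
      using invertibleD[OF inv] by (intro matrix_inv_eq)
    then have "structure_constant i j k (GL_action (matrix_inv (?h s)) \<mu>)
        = (\<Sum>c\<in>UNIV. matrix_inv (?h s) $ k $ c *
           (\<Sum>p\<in>UNIV. \<Sum>r\<in>UNIV. ?h s $ p $ i * ?h s $ r $ j * structure_constant p r c \<mu>))"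
      unfolding structure_constant_def[of i j k] GL_action_def
      by (subst matrix_vector_mult_def)
        (simp add: bilinear_product_expand_component[OF assms(2)])
    then show ?thesis
      by (simp add: sum_distrib_right mult.assoc mult.commute[of _ "det (?h s)"]
          flip: matrix_inv_det[OF inv])
        (simp add: sum_distrib_left sum_distrib_right mult_ac)
  qed
  ultimately show ?case by blast
next
  case (add p q)
  then obtain d1 q1 d2 q2 where *: "is_poly q1" "is_poly q2"
    "\<And>s. det (matrix_line a b s) \<noteq> 0 \<Longrightarrow>
     q1 s = p (GL_action (matrix_inv (matrix_line a b s)) \<mu>) * det (matrix_line a b s) ^ d1"
    "\<And>s. det (matrix_line a b s) \<noteq> 0 \<Longrightarrow>
     q2 s = q (GL_action (matrix_inv (matrix_line a b s)) \<mu>) * det (matrix_line a b s) ^ d2"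
    by metis
  show ?case
    by (rule exI[of _ "d1 + d2"], rule exI[of _ "\<lambda>s. q1 s * det (matrix_line a b s) ^ d2 +
          q2 s * det (matrix_line a b s) ^ d1"])
      (auto simp: * power_add algebra_simps intro!: is_poly_intros is_poly_det is_poly_matrix_line)
next
  case (mult p q)
  then obtain d1 q1 d2 q2 where *: "is_poly q1" "is_poly q2"
    "\<And>s. det (matrix_line a b s) \<noteq> 0 \<Longrightarrow>
     q1 s = p (GL_action (matrix_inv (matrix_line a b s)) \<mu>) * det (matrix_line a b s) ^ d1"
    "\<And>s. det (matrix_line a b s) \<noteq> 0 \<Longrightarrow>
     q2 s = q (GL_action (matrix_inv (matrix_line a b s)) \<mu>) * det (matrix_line a b s) ^ d2"
    by metis
  show ?case
    by (rule exI[of _ "d1 + d2"], rule exI[of _ "\<lambda>s. q1 s * q2 s"])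
      (auto simp: * power_add algebra_simps intro!: is_poly_intros)
qed

subsection \<open>Irreducibility of orbits, and components from open orbits\<close>

text \<open>If the orbit left both \<open>A\<close> and \<open>B\<close>, at \<open>g1\<close> and
  \<open>g2\<close>, join the inverses of these matrices by a line. After clearing determinants the
  two separating polynomials are nonzero in one variable, so some \<open>s\<close> avoids their
  zeros and the singular matrices; the orbit point there lies in neither set.\<close>

lemma irreducible_orbit:
  fixes \<mu> :: "'n::finite product"
  assumes "\<mu> \<in> bilinear_products"
    and "zariski_closed A" "zariski_closed B" "orbit \<mu> \<subseteq> A \<union> B"
  shows "orbit \<mu> \<subseteq> A \<or> orbit \<mu> \<subseteq> B"
proof (rule ccontr)
  assume "\<not> ?thesis"
  then obtain g1 g2 where g: "invertible g1" "GL_action g1 \<mu> \<notin> A" "invertible g2" "GL_action g2 \<mu> \<notin> B"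
    unfolding orbit_def by blast
  obtain p where p: "polynomial_fun p" "p (GL_action g1 \<mu>) \<noteq> 0" "\<forall>\<nu>\<in>A. p \<nu> = 0"
    using zariski_closedD[OF assms(2) GL_action_mem[OF assms(1)] g(2)] by blast
  obtain q where q: "polynomial_fun q" "q (GL_action g2 \<mu>) \<noteq> 0" "\<forall>\<nu>\<in>B. q \<nu> = 0"
    using zariski_closedD[OF assms(3) GL_action_mem[OF assms(1)] g(4)] by blast
  define a where "a = matrix_inv g1"
  define b where "b = matrix_inv g2"
  let ?h = "matrix_line a b"
  let ?\<mu> = "\<lambda>s. GL_action (matrix_inv (?h s)) \<mu>"
  have ab: "det a \<noteq> 0" "det b \<noteq> 0" "matrix_inv a = g1" "matrix_inv b = g2"
    using g invertibleD by (auto simp: a_def b_def intro!: matrix_inv_eq simp flip: invertible_det_nz)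
  obtain d1 q1 where q1: "is_poly q1" "\<And>s. det (?h s) \<noteq> 0 \<Longrightarrow> q1 s = p (?\<mu> s) * det (?h s) ^ d1"
    using is_poly_orbit_line[OF p(1) assms(1), of a b] by blast
  obtain d2 q2 where q2: "is_poly q2" "\<And>s. det (?h s) \<noteq> 0 \<Longrightarrow> q2 s = q (?\<mu> s) * det (?h s) ^ d2"
    using is_poly_orbit_line[OF q(1) assms(1), of a b] by blast
  have "q1 0 \<noteq> 0" "q2 1 \<noteq> 0" using q1(2)[of 0] q2(2)[of 1] ab p(2) q(2) by auto
  moreover have "finite {s. det (?h s) = 0}"
    using is_poly_finite_zeros[OF is_poly_det[OF is_poly_matrix_line], of a b 0] ab by simp
  ultimately have "finite ({s. q1 s = 0} \<union> {s. q2 s = 0} \<union> {s. det (?h s) = 0})"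
    using is_poly_finite_zeros[OF q1(1)] is_poly_finite_zeros[OF q2(1)] by simp
  from ex_new_if_finite[OF infinite_UNIV_char_0 this]
  obtain s where "s \<notin> {s. q1 s = 0} \<union> {s. q2 s = 0} \<union> {s. det (?h s) = 0}" ..
  then have s: "q1 s \<noteq> 0" "q2 s \<noteq> 0" "det (?h s) \<noteq> 0" by auto
  then have "invertible (matrix_inv (?h s))" by (intro invertibleD(3)) (simp add: invertible_det_nz)
  then have "?\<mu> s \<in> orbit \<mu>" unfolding orbit_def by blast
  then have "?\<mu> s \<in> A \<union> B" using assms(4) by blast
  then have "p (?\<mu> s) = 0 \<or> q (?\<mu> s) = 0" using p(3) q(3) by (elim UnE) simp_all
  then show False using s q1(2)[OF s(3)] q2(2)[OF s(3)] by auto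
qed

lemma irreducible_in_closure:
  assumes "S \<subseteq> topspace X" "S \<noteq> {}"
    and "\<And>A B. closedin X A \<Longrightarrow> closedin X B \<Longrightarrow> S \<subseteq> A \<union> B \<Longrightarrow> S \<subseteq> A \<or> S \<subseteq> B"
  shows "irreducible_in X (X closure_of S)"
  unfolding irreducible_in_def
proof (intro conjI allI impI)
  show "X closure_of S \<subseteq> topspace X" by (rule closure_of_subset_topspace)
  show "X closure_of S \<noteq> {}" using assms(1,2) closure_of_subset[of S X] by blast
  fix A B assume AB: "closedin X A \<and> closedin X B \<and> X closure_of S \<subseteq> A \<union> B"
  then have "S \<subseteq> A \<union> B" using assms(1) closure_of_subset[of S X] by blast
  with AB assms(3) have "S \<subseteq> A \<or> S \<subseteq> B" by blast
  then show "X closure_of S \<subseteq> A \<or> X closure_of S \<subseteq> B"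
    using AB closure_of_minimal by metis
qed

lemma irreducible_in_finite_cover:
  assumes "irreducible_in X S" "finite \<F>" "\<And>F. F \<in> \<F> \<Longrightarrow> closedin X F" "S \<subseteq> \<Union>\<F>"
  shows "\<exists>F\<in>\<F>. S \<subseteq> F"
  using assms(2-4)
proof (induction \<F>)
  case empty
  then show ?case using assms(1) by (auto simp: irreducible_in_def)
next
  case (insert F \<F>)
  have "closedin X (\<Union>\<F>)" using insert by (intro closedin_Union) auto
  then have "S \<subseteq> F \<or> S \<subseteq> \<Union>\<F>"
    using assms(1) insert.prems unfolding irreducible_in_def by auto
  then show ?case using insert by auto
qed

text \<open>An open \<open>U i\<close> inside the closure of \<open>U j\<close> would meet
  \<open>U j\<close>, so disjointness makes the closures pairwise incomparable. Each irreducible set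
  lies in one member of the finite closed cover, so these closures are exactly the maximal
  ones.\<close>

lemma irreducible_components_of_open_cover:
  assumes "finite I" "\<And>i. i \<in> I \<Longrightarrow> openin X (U i)" "\<And>i. i \<in> I \<Longrightarrow> U i \<noteq> {}"
    and irr: "\<And>i. i \<in> I \<Longrightarrow> irreducible_in X (X closure_of U i)"
    and disj: "\<And>i j. i \<in> I \<Longrightarrow> j \<in> I \<Longrightarrow> i \<noteq> j \<Longrightarrow> U i \<inter> U j = {}"
    and cover: "topspace X = (\<Union>i\<in>I. X closure_of U i)"
  shows "irreducible_components_of X = (\<lambda>i. X closure_of U i) ` I"
    and "inj_on (\<lambda>i. X closure_of U i) I"
proof -
  have sub: "i = j" if "i \<in> I" "j \<in> I" "X closure_of U i \<subseteq> X closure_of U j" for i j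
  proof -
    have "U i \<subseteq> X closure_of U j"
      using that(3) closure_of_subset[OF openin_subset[OF assms(2)[OF that(1)]]] by blast
    then have "U i \<inter> X closure_of U j \<noteq> {}" using assms(3)[OF that(1)] by blast
    then have "U i \<inter> U j \<noteq> {}"
      using openin_Int_closure_of_eq_empty[OF assms(2)[OF that(1)]] by blast
    then show ?thesis using disj that by blast
  qed
  then show "inj_on (\<lambda>i. X closure_of U i) I" by (intro inj_onI) auto
  have mem: "\<exists>i\<in>I. S \<subseteq> X closure_of U i" if "irreducible_in X S" for S
  proof -
    have "S \<subseteq> (\<Union>i\<in>I. X closure_of U i)" using that cover by (simp add: irreducible_in_def)
    then have "\<exists>F\<in>(\<lambda>i. X closure_of U i) ` I. S \<subseteq> F"
      using assms(1) by (intro irreducible_in_finite_cover[OF that]) auto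
    then show ?thesis by blast
  qed
  show "irreducible_components_of X = (\<lambda>i. X closure_of U i) ` I"
  proof (intro equalityI subsetI)
    fix C assume C: "C \<in> irreducible_components_of X"
    then obtain i where "i \<in> I" "C \<subseteq> X closure_of U i"
      using mem unfolding irreducible_components_of_def by blast
    then show "C \<in> (\<lambda>i. X closure_of U i) ` I"
      using C irr unfolding irreducible_components_of_def by blast
  next
    fix C assume "C \<in> (\<lambda>i. X closure_of U i) ` I"
    then obtain i where i: "i \<in> I" "C = X closure_of U i" by blast
    have "S = C" if S: "irreducible_in X S" "C \<subseteq> S" for S
    proof -
      obtain j where j: "j \<in> I" "S \<subseteq> X closure_of U j" using mem[OF S(1)] by blast
      then have "i = j" using sub i S by blast
      then show ?thesis using i j S by blast
    qed
    then show "C \<in> irreducible_components_of X"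
      unfolding irreducible_components_of_def using irr i by blast
  qed
qed

text \<open>The polynomial \<open>f\<close> certifies openness only near \<open>\<mu>\<close>. At
  another orbit point \<open>\<nu>\<close> the certificate is \<open>f\<close> composed with a group
  element moving \<open>\<nu>\<close> to \<open>\<mu>\<close>.\<close>

lemma openin_orbitI:
  assumes "\<mu> \<in> dual_mock_lie" "polynomial_fun f" "f \<mu> \<noteq> 0"
    and "\<And>\<nu>. \<nu> \<in> dual_mock_lie \<Longrightarrow> f \<nu> \<noteq> 0 \<Longrightarrow> \<nu> \<in> orbit \<mu>"
  shows "rigid \<mu>"
proof -
  have dml: "dual_mock_lie \<subseteq> (bilinear_products :: 'a product set)"
    by (auto simp: dual_mock_lie_def)
  have o: "orbit \<mu> \<subseteq> dual_mock_lie" using orbit_subset_dual_mock_lie assms(1) .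
  have "zariski_closed (dual_mock_lie - orbit \<mu>)"
  proof (rule zariski_closedI)
    show "dual_mock_lie - orbit \<mu> \<subseteq> bilinear_products" using dml by blast
    fix \<nu> :: "'a product" assume \<nu>: "\<nu> \<in> bilinear_products" "\<nu> \<notin> dual_mock_lie - orbit \<mu>"
    show "\<exists>p. polynomial_fun p \<and> p \<nu> \<noteq> 0 \<and> (\<forall>\<nu>'\<in>dual_mock_lie - orbit \<mu>. p \<nu>' = 0)"
    proof (cases "\<nu> \<in> dual_mock_lie")
      case False
      then show ?thesis using zariski_closedD[OF zariski_closed_dual_mock_lie \<nu>(1)] by blast
    next
      case True
      then have "\<nu> \<in> orbit \<mu>" using \<nu> by blast
      then obtain g where g: "invertible g" "\<mu> = GL_action g \<nu>"
        using orbit_sym unfolding orbit_def by blast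
      obtain q where q: "polynomial_fun q" "\<forall>\<mu>\<in>bilinear_products. q \<mu> = f (GL_action g \<mu>)"
        using polynomial_fun_GL_action[OF assms(2)] by blast
      have "q \<nu>' = 0" if \<nu>': "\<nu>' \<in> dual_mock_lie" "\<nu>' \<notin> orbit \<mu>" for \<nu>'
      proof (rule ccontr)
        assume "q \<nu>' \<noteq> 0"
        then have "f (GL_action g \<nu>') \<noteq> 0" using q \<nu>' dml by auto
        then have "GL_action g \<nu>' \<in> orbit \<mu>"
          using assms(4) dual_mock_lie_GL_action[OF \<nu>'(1) g(1)] by blast
        moreover have "GL_action g \<nu>' \<in> orbit \<nu>'" using g(1) unfolding orbit_def by blast
        ultimately show False using \<nu>'(2) orbit_sym orbit_trans by blast
      qed
      moreover have "q \<nu> \<noteq> 0" using q(2) \<nu>(1) g(2) assms(3) by auto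
      ultimately show ?thesis using q(1) by blast
    qed
  qed
  then have "closedin (subtopology zariski dual_mock_lie) (dual_mock_lie - orbit \<mu>)"
    by (intro closedin_subset_topspace) (auto simp: closedin_zariski)
  then have "openin (subtopology zariski dual_mock_lie)
      (topspace (subtopology zariski dual_mock_lie) - (dual_mock_lie - orbit \<mu>))"
    by (rule openin_diff[OF openin_topspace])
  moreover have "topspace (subtopology zariski dual_mock_lie) - (dual_mock_lie - orbit \<mu>) = orbit \<mu>"
    using dml o by (auto simp: topspace_zariski)
  ultimately show ?thesis using assms(1) by (simp add: rigid_def)
qed

subsection \<open>Skew products in block form\<close>

definition coord_proj :: "'n set \<Rightarrow> complex^'n^'n" where
  "coord_proj E = (\<chi> i j. if i = j \<and> i \<in> E then 1 else 0)"

lemma coord_proj_component: "(coord_proj E *v x) $ i = (if i \<in> E then x $ i else 0)"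
proof -
  have "(coord_proj E *v x) $ i = (\<Sum>j\<in>UNIV. if j = i then (if i \<in> E then x $ i else 0) else 0)"
    unfolding matrix_vector_mult_def coord_proj_def vec_lambda_beta by (rule sum.cong) auto
  then show ?thesis by simp
qed

lemma coord_proj_axis: "coord_proj E *v e i = (if i \<in> E then e i else 0)"
  by (auto simp: vec_eq_iff coord_proj_component axis_def)

text \<open>The skew maps \<open>\<complex>^E \<times> \<complex>^E \<rightarrow> \<complex>^(-E)\<close>, extended by zero.\<close>

definition block_products :: "'n::finite set \<Rightarrow> 'n product set" where
  "block_products E = {\<mu> \<in> bilinear_products. (\<forall>x y. \<mu> x y = - \<mu> y x) \<and>
     (\<forall>x y. \<mu> (coord_proj E *v x) y = \<mu> x y) \<and> (\<forall>x y. coord_proj E *v \<mu> x y = 0)}"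

lemma block_productsD:
  assumes "\<mu> \<in> block_products E"
  shows "\<mu> \<in> bilinear_products" "\<mu> x y = - \<mu> y x" "\<mu> (coord_proj E *v x) y = \<mu> x y"
    "coord_proj E *v \<mu> x y = 0" "\<mu> x (coord_proj E *v y) = \<mu> x y"
proof -
  show 1: "\<mu> \<in> bilinear_products" "\<mu> x y = - \<mu> y x" "\<mu> (coord_proj E *v x) y = \<mu> x y"
    "coord_proj E *v \<mu> x y = 0" for x y
    using assms unfolding block_products_def by blast+
  show "\<mu> x (coord_proj E *v y) = \<mu> x y"
    by (subst 1(2), subst 1(3)) (simp add: 1(2)[of y x])
qed

lemma block_products_component:
  assumes "\<mu> \<in> block_products E"
  shows "structure_constant i j k \<mu> = - structure_constant j i k \<mu>"
    "\<not> (i \<in> E \<and> j \<in> E \<and> k \<notin> E) \<Longrightarrow> structure_constant i j k \<mu> = 0"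
proof -
  note D = block_productsD[OF assms]
  show "structure_constant i j k \<mu> = - structure_constant j i k \<mu>"
    unfolding structure_constant_def by (subst D(2)) simp
  have "structure_constant i j k \<mu> = 0" if "i \<notin> E"
    using D(3)[of "e i" "e j"] that D(1)
    by (simp add: structure_constant_def coord_proj_axis bilinear_product_simps)
  moreover have "structure_constant i j k \<mu> = 0" if "j \<notin> E"
    using D(5)[of "e i" "e j"] that D(1)
    by (simp add: structure_constant_def coord_proj_axis bilinear_product_simps)
  moreover have "structure_constant i j k \<mu> = 0" if "k \<in> E"
    using coord_proj_component[of E "\<mu> (e i) (e j)" k] that
    by (simp add: structure_constant_def D(4))
  ultimately show "\<not> (i \<in> E \<and> j \<in> E \<and> k \<notin> E) \<Longrightarrow> structure_constant i j k \<mu> = 0"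
    by blast
qed

lemma segment_product_block:
  assumes "\<mu> \<in> block_products E" "\<nu> \<in> block_products E"
  shows "segment_product \<mu> \<nu> s \<in> block_products E"
proof -
  note D = block_productsD[OF assms(1)] block_productsD[OF assms(2)]
  have 1: "segment_product \<mu> \<nu> s \<in> bilinear_products"
    by (rule bilinear_productsI) (simp_all add: segment_product_def
        bilinear_product_simps[OF D(1)] bilinear_product_simps[OF D(6)] vec_eq_iff algebra_simps)
  have 2: "segment_product \<mu> \<nu> s x y = - segment_product \<mu> \<nu> s y x" for x y
    unfolding segment_product_def by (subst D(2), subst D(7)) simp
  have "segment_product \<mu> \<nu> s (coord_proj E *v x) y = segment_product \<mu> \<nu> s x y"
    "coord_proj E *v segment_product \<mu> \<nu> s x y = 0" for x y
    using D(3,4,8,9) by (simp_all add: segment_product_def vec.add vec.scale vec.diff)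
  with 1 2 show ?thesis unfolding block_products_def by blast
qed

definition block_matrix :: "'n::finite set \<Rightarrow> complex^'n^'n \<Rightarrow> bool" where
  "block_matrix E g \<longleftrightarrow> invertible g \<and> coord_proj E ** g = g ** coord_proj E"

lemma block_matrix_mult: "block_matrix E g \<Longrightarrow> block_matrix E h \<Longrightarrow> block_matrix E (g ** h)"
  by (simp add: block_matrix_def invertible_mult) (metis matrix_mul_assoc)

lemma block_matrix_inv:
  assumes "block_matrix E g"
  shows "block_matrix E (matrix_inv g)"
proof -
  have g: "invertible g" "coord_proj E ** g = g ** coord_proj E"
    using assms by (auto simp: block_matrix_def)
  have "matrix_inv g ** (coord_proj E ** g) ** matrix_inv g
      = matrix_inv g ** (g ** coord_proj E) ** matrix_inv g" by (simp add: g)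
  then have "matrix_inv g ** coord_proj E ** (g ** matrix_inv g)
      = (matrix_inv g ** g) ** coord_proj E ** matrix_inv g" by (simp add: matrix_mul_assoc)
  then show ?thesis using g by (simp add: invertibleD block_matrix_def)
qed

lemma block_matrix_mult_vec:
  "block_matrix E g \<Longrightarrow> coord_proj E *v (g *v x) = g *v (coord_proj E *v x)"
  by (simp add: block_matrix_def matrix_vector_mul_assoc)

text \<open>Here \<open>h\<close> lives on the input block and \<open>k\<close> on the output block.
  For \<open>matrix_inv h ** k\<close> the inputs see only the inverse, which acts on them as
  \<open>h\<close>, and the values see only \<open>k\<close>.\<close>

lemma block_products_transform:
  assumes "\<mu> \<in> block_products E" "invertible h" "invertible k"
    and h: "coord_proj E ** h = h ** coord_proj E" "\<And>x. coord_proj E *v x = 0 \<Longrightarrow> h *v x = x"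
    and k: "coord_proj E ** k = k ** coord_proj E" "\<And>x. coord_proj E *v (k *v x) = coord_proj E *v x"
  shows "\<exists>g. block_matrix E g \<and> (\<lambda>x y. k *v \<mu> (h *v x) (h *v y)) = GL_action g \<mu>"
proof (intro exI conjI)
  let ?Q = "coord_proj E"
  let ?g = "matrix_inv h ** k"
  note D = block_productsD[OF assms(1)]
  have bh: "block_matrix E h" "block_matrix E k" using assms by (auto simp: block_matrix_def)
  show g: "block_matrix E ?g" using bh by (intro block_matrix_mult block_matrix_inv)
  have "(matrix_inv k ** h) ** ?g = matrix_inv k ** (h ** matrix_inv h) ** k"
    by (simp add: matrix_mul_assoc)
  then have inv: "matrix_inv ?g = matrix_inv k ** h"
    using assms by (intro matrix_inv_eq) (simp add: invertibleD)
  have "?Q *v (matrix_inv ?g *v x) = ?Q *v (h *v x)" for x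
    using k(2)[of "matrix_inv k *v (h *v x)"] assms(3) by (simp add: inv flip: matrix_vector_mul_assoc)
  then have 1: "\<mu> (matrix_inv ?g *v x) (matrix_inv ?g *v y) = \<mu> (h *v x) (h *v y)" for x y
    using D(3,5) by metis
  have 2: "?g *v \<mu> x y = k *v \<mu> x y" for x y
  proof -
    have "?Q *v (k *v \<mu> x y) = 0" by (simp add: k(2) D(4))
    then have "h *v (k *v \<mu> x y) = k *v \<mu> x y" by (rule h(2))
    then have "matrix_inv h *v (h *v (k *v \<mu> x y)) = matrix_inv h *v (k *v \<mu> x y)" by simp
    then show ?thesis using assms(2) by (simp flip: matrix_vector_mul_assoc)
  qed
  show "(\<lambda>x y. k *v \<mu> (h *v x) (h *v y)) = GL_action ?g \<mu>"
    unfolding GL_action_def 1 2 ..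
qed

subsection \<open>Infinitesimally open orbits\<close>

text \<open>The derivative at the identity of the action of the block matrices on block products, up to
  the sign of the block of \<open>X\<close> indexed by \<open>E\<close>.\<close>

definition tangent_action :: "'n::finite product \<Rightarrow> complex^'n^'n \<Rightarrow> 'n \<Rightarrow> 'n \<Rightarrow> 'n \<Rightarrow> complex" where
  "tangent_action \<mu> X i j k = (\<Sum>p\<in>UNIV. X $ p $ i * structure_constant p j k \<mu>
     + X $ p $ j * structure_constant i p k \<mu> + X $ k $ p * structure_constant i j p \<mu>)"

definition coord_vector :: "'n::finite product \<Rightarrow> complex^('n \<times> 'n \<times> 'n)" where
  "coord_vector \<mu> = (\<chi> t. case t of (i, j, k) \<Rightarrow> structure_constant i j k \<mu>)"

definition skew_part :: "'n::finite set \<Rightarrow> complex^('n \<times> 'n \<times> 'n) \<Rightarrow> complex^('n \<times> 'n \<times> 'n)" where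
  "skew_part E v = (\<chi> t. case t of (i, j, k) \<Rightarrow>
     if i \<in> E \<and> j \<in> E \<and> k \<notin> E then (v $ (i, j, k) - v $ (j, i, k)) / 2 else 0)"

lemma skew_part_coord_vector:
  assumes "\<mu> \<in> block_products E"
  shows "skew_part E (coord_vector \<mu>) = coord_vector \<mu>"
proof -
  have "skew_part E (coord_vector \<mu>) $ (i, j, k) = coord_vector \<mu> $ (i, j, k)" for i j k
    using block_products_component(1)[OF assms, of j i k] block_products_component(2)[OF assms, of i j k]
    by (auto simp: skew_part_def coord_vector_def)
  then show ?thesis unfolding vec_eq_iff by auto
qed

lemma skew_part_idem: "skew_part E (skew_part E v) = skew_part E v"
  by (auto simp: vec_eq_iff skew_part_def diff_divide_distrib)

lemma skew_part_linear:
  "skew_part E (v + w) = skew_part E v + skew_part E w"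
  "skew_part E (v - w) = skew_part E v - skew_part E w"
  "skew_part E (c *s v) = c *s skew_part E v"
  by (auto simp: vec_eq_iff skew_part_def algebra_simps add_divide_distrib diff_divide_distrib)

text \<open>The structure constants after putting \<open>1 + X\<close> before both arguments and
  applying \<open>1 + X\<close> to the value. Avoiding the inverse on the arguments keeps this
  polynomial in \<open>X\<close>, at the price of the sign in \<open>tangent_action\<close>.\<close>

definition near_action :: "'n::finite product \<Rightarrow> complex^'n^'n \<Rightarrow> 'n \<Rightarrow> 'n \<Rightarrow> 'n \<Rightarrow> complex" where
  "near_action \<mu> X i j k = (\<Sum>a\<in>UNIV. \<Sum>b\<in>UNIV. \<Sum>c\<in>UNIV.
     ((if a = i then 1 else 0) + X $ a $ i) * ((if b = j then 1 else 0) + X $ b $ j) *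
     ((if c = k then 1 else 0) + X $ k $ c) * structure_constant a b c \<mu>)"

definition near_vector :: "'n::finite set \<Rightarrow> 'n product \<Rightarrow> complex^'n^'n \<Rightarrow> complex^('n \<times> 'n \<times> 'n)" where
  "near_vector E \<mu> X = (\<chi> t. case t of (i, j, k) \<Rightarrow>
     if i \<in> E \<and> j \<in> E \<and> k \<notin> E then near_action \<mu> X i j k else 0)"

definition tangent_vector :: "'n::finite set \<Rightarrow> 'n product \<Rightarrow> complex^'n^'n \<Rightarrow> complex^('n \<times> 'n \<times> 'n)" where
  "tangent_vector E \<mu> X = (\<chi> t. case t of (i, j, k) \<Rightarrow>
     if i \<in> E \<and> j \<in> E \<and> k \<notin> E then tangent_action \<mu> X i j k else 0)"

lemma has_derivative_vec:
  fixes f :: "'a::real_normed_vector \<Rightarrow> complex^'t"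
  assumes "\<And>t. ((\<lambda>x. f x $ t) has_derivative (\<lambda>x. f' x $ t)) F"
  shows "(f has_derivative f') F"
proof -
  have "bounded_linear (axis t :: complex \<Rightarrow> complex^'t)" for t
    unfolding linear_conv_bounded_linear[symmetric]
    by (rule linearI) (simp_all add: vec_eq_iff axis_def)
  then have "((\<lambda>x. \<Sum>t\<in>UNIV. axis t (f x $ t)) has_derivative (\<lambda>x. \<Sum>t\<in>UNIV. axis t (f' x $ t))) F"
    by (auto intro!: has_derivative_sum intro: bounded_linear.has_derivative[OF _ assms])
  moreover have "(\<Sum>t\<in>UNIV. axis t (v $ t)) = v" for v :: "complex^'t"
    by (simp add: vec_eq_iff axis_def if_distrib cong: if_cong)
  ultimately show ?thesis by simp
qed

lemma near_action_has_derivative: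
  fixes \<mu> :: "'n::finite product"
  shows "((\<lambda>X. near_action \<mu> X i j k) has_derivative (\<lambda>X. tangent_action \<mu> X i j k)) (at 0)"
proof -
  have entry: "((\<lambda>X::complex^'n^'n. c + X $ a $ b) has_derivative (\<lambda>X. X $ a $ b)) (at 0)"
    for c a b
    by (rule derivative_eq_intros bounded_linear_imp_has_derivative
        bounded_linear_compose[OF bounded_linear_vec_nth bounded_linear_vec_nth] refl | simp)+
  have term3: "((\<lambda>X. (\<alpha> + X $ a $ i) * (\<beta> + X $ b $ j) * (\<gamma> + X $ k $ c) * m) has_derivative
      (\<lambda>X. (X $ a $ i * \<beta> * \<gamma> + \<alpha> * X $ b $ j * \<gamma> + \<alpha> * \<beta> * X $ k $ c) * m)) (at 0)"
    for \<alpha> \<beta> \<gamma> m :: complex and a b c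
    using has_derivative_mult_left[OF has_derivative_mult[OF has_derivative_mult[OF
        entry[of \<alpha> a i] entry[of \<beta> b j]] entry[of \<gamma> k c]], of m]
    by (simp add: algebra_simps)
  have "((\<lambda>X. near_action \<mu> X i j k) has_derivative
    (\<lambda>X. \<Sum>a\<in>UNIV. \<Sum>b\<in>UNIV. \<Sum>c\<in>UNIV.
      (X $ a $ i * (if b = j then 1 else 0) * (if c = k then 1 else 0) +
       (if a = i then 1 else 0) * X $ b $ j * (if c = k then 1 else 0) +
       (if a = i then 1 else 0) * (if b = j then 1 else 0) * X $ k $ c) * structure_constant a b c \<mu>)) (at 0)"
    unfolding near_action_def by (intro has_derivative_sum term3)
  moreover have "(\<Sum>a\<in>UNIV. \<Sum>b\<in>UNIV. \<Sum>c\<in>UNIV.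
      (X $ a $ i * (if b = j then 1 else 0) * (if c = k then 1 else 0) +
       (if a = i then 1 else 0) * X $ b $ j * (if c = k then 1 else 0) +
       (if a = i then 1 else 0) * (if b = j then 1 else 0) * X $ k $ c) * structure_constant a b c \<mu>)
     = tangent_action \<mu> X i j k" for X
  proof -
    \<comment> \<open>The Kronecker symbols collapse the triple sum into three single sums, one for
      each differentiated factor.\<close>
    have d: "(\<Sum>a\<in>UNIV. (if a = b then 1 else 0) * h a) = (h b :: complex)" for b :: 'n and h
    proof -
      have "(\<Sum>a\<in>UNIV. (if a = b then 1 else 0) * h a) = (\<Sum>a\<in>UNIV. if a = b then h a else 0)"
        by (rule sum.cong) auto
      then show ?thesis by simp
    qed
    have "(\<Sum>a\<in>UNIV. \<Sum>b\<in>UNIV. \<Sum>c\<in>UNIV.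
      (X $ a $ i * (if b = j then 1 else 0) * (if c = k then 1 else 0) +
       (if a = i then 1 else 0) * X $ b $ j * (if c = k then 1 else 0) +
       (if a = i then 1 else 0) * (if b = j then 1 else 0) * X $ k $ c) * structure_constant a b c \<mu>)
     = (\<Sum>a\<in>UNIV. \<Sum>b\<in>UNIV. \<Sum>c\<in>UNIV. (if c = k then 1 else 0) * ((if b = j then 1 else 0) * (X $ a $ i * structure_constant a b c \<mu>)))
     + (\<Sum>a\<in>UNIV. (if a = i then 1 else 0) * (\<Sum>b\<in>UNIV. \<Sum>c\<in>UNIV. (if c = k then 1 else 0) * (X $ b $ j * structure_constant a b c \<mu>)))
     + (\<Sum>a\<in>UNIV. (if a = i then 1 else 0) * (\<Sum>b\<in>UNIV. (if b = j then 1 else 0) * (\<Sum>c\<in>UNIV. X $ k $ c * structure_constant a b c \<mu>)))"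
      by (simp only: sum_distrib_left sum.distrib[symmetric]) (simp add: algebra_simps)
    also have "\<dots> = tangent_action \<mu> X i j k"
      unfolding d tangent_action_def sum.distrib ..
    finally show ?thesis .
  qed
  ultimately show ?thesis by simp
qed

lemma near_vector_has_derivative:
  "(near_vector E \<mu> has_derivative tangent_vector E \<mu>) (at 0)"
proof (rule has_derivative_vec)
  fix t :: "'a \<times> 'a \<times> 'a"
  obtain i j k where t: "t = (i, j, k)" by (cases t)
  show "((\<lambda>X. near_vector E \<mu> X $ t) has_derivative (\<lambda>X. tangent_vector E \<mu> X $ t)) (at 0)"
    using near_action_has_derivative[of \<mu> i j k]
    by (cases "i \<in> E"; cases "j \<in> E"; cases "k \<in> E")
      (simp_all add: t near_vector_def tangent_vector_def)
qed

lemma continuous_det: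
  fixes A :: "'a::topological_space \<Rightarrow> complex^'n^'n"
  assumes "\<And>i j. continuous_on S (\<lambda>x. A x $ i $ j)"
  shows "continuous_on S (\<lambda>x. det (A x))"
  unfolding det_def by (intro continuous_intros assms)


lemma continuous_near_vector: "continuous_on S (near_vector E \<mu>)"
proof -
  have "continuous_on S (\<lambda>X. near_vector E \<mu> X $ t)" for t
    by (cases t; cases "fst t \<in> E"; cases "fst (snd t) \<in> E"; cases "snd (snd t) \<in> E")
      (auto simp: near_vector_def near_action_def intro!: continuous_intros)
  then have "continuous_on S (\<lambda>X. \<chi> t. near_vector E \<mu> X $ t)"
    by (rule continuous_on_vec_lambda)
  then show ?thesis by simp
qed

definition near_block :: "'n::finite set \<Rightarrow> complex^'n^'n \<Rightarrow> complex^'n^'n" where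
  "near_block E X = (\<chi> p q. (if p = q then 1 else 0) + (if p \<in> E \<and> q \<in> E then X $ p $ q else 0))"

lemma near_block_component:
  "(near_block E X *v x) $ p = x $ p + (if p \<in> E then (\<Sum>q\<in>E. X $ p $ q * x $ q) else 0)"
proof -
  have "(near_block E X *v x) $ p = (\<Sum>q\<in>UNIV. (if q = p then x $ q else 0) +
      (if q \<in> E then (if p \<in> E then X $ p $ q * x $ q else 0) else 0))"
    unfolding matrix_vector_mult_def near_block_def vec_lambda_beta
    by (rule sum.cong) (auto simp: algebra_simps)
  then show ?thesis by (simp add: sum.distrib flip: sum.inter_restrict)
qed

lemma near_block_commute: "coord_proj E ** near_block E X = near_block E X ** coord_proj E"
  unfolding matrix_eq matrix_vector_mul_assoc[symmetric] vec_eq_iff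
  by (simp add: coord_proj_component near_block_component)

lemma near_block_commute': "coord_proj E ** near_block (- E) X = near_block (- E) X ** coord_proj E"
  unfolding matrix_eq matrix_vector_mul_assoc[symmetric] vec_eq_iff
  by (simp add: coord_proj_component near_block_component)

lemma block_products_near:
  assumes "\<mu> \<in> block_products E" "det (near_block E X) \<noteq> 0" "det (near_block (- E) X) \<noteq> 0"
  shows "\<exists>g. block_matrix E g \<and> (\<lambda>x y. near_block (- E) X *v \<mu> (near_block E X *v x) (near_block E X *v y)) = GL_action g \<mu>"
proof (rule block_products_transform[OF assms(1) _ _ near_block_commute _ near_block_commute'])
  show "invertible (near_block E X)" "invertible (near_block (- E) X)"
    using assms by (simp_all add: invertible_det_nz)
  show "near_block E X *v x = x" if "coord_proj E *v x = 0" for x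
  proof -
    have "x $ q = 0" if "q \<in> E" for q
      using \<open>coord_proj E *v x = 0\<close> coord_proj_component[of E x q] that by simp
    then show ?thesis by (simp add: vec_eq_iff near_block_component)
  qed
  show "coord_proj E *v (near_block (- E) X *v x) = coord_proj E *v x" for x
    by (simp add: vec_eq_iff coord_proj_component near_block_component)
qed

text \<open>The structure constants vanish unless \<open>a\<close>, \<open>b\<close> lie in
  \<open>E\<close> and \<open>c\<close> does not, so only the two diagonal blocks of
  \<open>X\<close> contribute, and these are what \<open>near_block\<close> keeps.\<close>

lemma near_vector_eq:
  assumes "\<mu> \<in> block_products E"
  shows "coord_vector (\<lambda>x y. near_block (- E) X *v \<mu> (near_block E X *v x) (near_block E X *v y)) = near_vector E \<mu> X"
    (is "coord_vector ?\<nu> = _")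
proof -
  note bil = block_productsD(1)[OF assms]
  note z = block_products_component(2)[OF assms]
  have "structure_constant i j k ?\<nu> = near_vector E \<mu> X $ (i, j, k)" for i j k
  proof -
    have "structure_constant i j k ?\<nu> = (\<Sum>c\<in>UNIV. \<Sum>a\<in>UNIV. \<Sum>b\<in>UNIV.
        near_block E X $ a $ i * near_block E X $ b $ j * near_block (- E) X $ k $ c * structure_constant a b c \<mu>)"
      unfolding structure_constant_def[of i j k]
      by (subst matrix_vector_mult_def)
        (simp add: bilinear_product_expand_component[OF bil] sum_distrib_left mult_ac)
    also have "\<dots> = (\<Sum>a\<in>UNIV. \<Sum>c\<in>UNIV. \<Sum>b\<in>UNIV.
        near_block E X $ a $ i * near_block E X $ b $ j * near_block (- E) X $ k $ c * structure_constant a b c \<mu>)"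
      by (rule sum.swap)
    also have "\<dots> = (\<Sum>a\<in>UNIV. \<Sum>b\<in>UNIV. \<Sum>c\<in>UNIV.
        near_block E X $ a $ i * near_block E X $ b $ j * near_block (- E) X $ k $ c * structure_constant a b c \<mu>)"
      by (intro sum.cong refl sum.swap)
    also have "\<dots> = near_vector E \<mu> X $ (i, j, k)"
    proof (cases "i \<in> E \<and> j \<in> E \<and> k \<notin> E")
      case True
      have "near_block E X $ a $ i * near_block E X $ b $ j * near_block (- E) X $ k $ c * structure_constant a b c \<mu>
        = ((if a = i then 1 else 0) + X $ a $ i) * ((if b = j then 1 else 0) + X $ b $ j) *
          ((if c = k then 1 else 0) + X $ k $ c) * structure_constant a b c \<mu>" for a b c
        using True z[of a b c] by (cases "a \<in> E \<and> b \<in> E \<and> c \<notin> E") (auto simp: near_block_def)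
      then show ?thesis using True unfolding near_vector_def near_action_def by (simp only: if_True) simp
    next
      case False
      have zero: "near_block E X $ a $ i * near_block E X $ b $ j * near_block (- E) X $ k $ c * structure_constant a b c \<mu>
        = 0" for a b c
        using False z[of a b c] by (cases "a \<in> E \<and> b \<in> E \<and> c \<notin> E") (auto simp: near_block_def)
      show ?thesis unfolding zero near_vector_def using False by auto
    qed
    finally show ?thesis .
  qed
  then show ?thesis by (simp add: vec_eq_iff coord_vector_def)
qed

lemma block_products_GL_action:
  assumes "\<mu> \<in> block_products E" "block_matrix E g"
  shows "GL_action g \<mu> \<in> block_products E"
proof -
  note D = block_productsD[OF assms(1)]
  have 1: "GL_action g \<mu> x y = - GL_action g \<mu> y x" for x y
    unfolding GL_action_def by (subst D(2)) (simp add: vec.neg)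
  have 2: "GL_action g \<mu> (coord_proj E *v x) y = GL_action g \<mu> x y" for x y
    unfolding GL_action_def block_matrix_mult_vec[OF block_matrix_inv[OF assms(2)], symmetric] D(3) ..
  have 3: "coord_proj E *v GL_action g \<mu> x y = 0" for x y
    unfolding GL_action_def block_matrix_mult_vec[OF assms(2)] D(4) by simp
  show ?thesis unfolding block_products_def using GL_action_mem[OF D(1)] 1 2 3 by blast
qed

lemma coord_vector_inj:
  assumes "\<mu> \<in> bilinear_products" "\<nu> \<in> bilinear_products" "coord_vector \<mu> = coord_vector \<nu>"
  shows "\<mu> = \<nu>"
proof (rule bilinear_product_eqI[OF assms(1,2)])
  fix i j
  have "coord_vector \<mu> $ (i, j, k) = coord_vector \<nu> $ (i, j, k)" for k using assms(3) by simp
  then show "\<mu> (e i) (e j) = \<nu> (e i) (e j)"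
    by (simp add: vec_eq_iff coord_vector_def structure_constant_def)
qed


definition lin_comb :: "('t::finite \<Rightarrow> complex^'n^'n) \<Rightarrow> complex^'t \<Rightarrow> complex^'n^'n" where
  "lin_comb T v = (\<chi> p q. \<Sum>t\<in>UNIV. v $ t * T t $ p $ q)"

lemma lin_comb_simps:
  "lin_comb T (v + w) = lin_comb T v + lin_comb T w"
  "lin_comb T (c *s v) = (\<chi> p q. c * lin_comb T v $ p $ q)"
  "lin_comb T (axis t 1) = T t"
proof -
  show "lin_comb T (v + w) = lin_comb T v + lin_comb T w"
    by (simp add: lin_comb_def vec_eq_iff algebra_simps sum.distrib)
  show "lin_comb T (c *s v) = (\<chi> p q. c * lin_comb T v $ p $ q)"
    by (simp add: lin_comb_def vec_eq_iff sum_distrib_left mult.assoc)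
  have "(\<Sum>t'\<in>UNIV. axis t 1 $ t' * T t' $ p $ q) = (\<Sum>t'\<in>UNIV. if t' = t then T t' $ p $ q else 0)" for p q
    by (rule sum.cong) (auto simp: axis_def)
  then show "lin_comb T (axis t 1) = T t" by (simp add: lin_comb_def vec_eq_iff)
qed

lemma tangent_vector_linear:
  "tangent_vector E \<mu> (X + Y) = tangent_vector E \<mu> X + tangent_vector E \<mu> Y"
  "tangent_vector E \<mu> (\<chi> p q. c * X $ p $ q) = c *s tangent_vector E \<mu> X"
  by (auto simp: vec_eq_iff tangent_vector_def tangent_action_def algebra_simps sum.distrib sum_distrib_left)

text \<open>If \<open>T\<close> lists preimages of the skew parts of the basis vectors under the tangent map at \<open>D\<close>, this
  operator is the identity for \<open>\<mu> = D\<close>; wherever it is invertible, the tangent map at \<open>\<mu>\<close> is onto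
  the skew vectors.\<close>

definition open_operator where
  "open_operator E T \<mu> v = v - skew_part E v + tangent_vector E \<mu> (lin_comb T v)"

lemma open_operator_linear: "Vector_Spaces.linear (*s) (*s) (open_operator E T \<mu>)"
  by (auto simp: Vector_Spaces.linear_iff vec.vector_space_axioms open_operator_def skew_part_linear
      tangent_vector_linear lin_comb_simps vec_eq_iff algebra_simps)

text \<open>With \<open>T\<close> fixed, each matrix entry is a constant plus a linear combination
  of structure constants.\<close>

lemma polynomial_fun_open_operator:
  "polynomial_fun (\<lambda>\<mu>. det (matrix (open_operator E T \<mu>)))"
proof (rule polynomial_fun_det)
  fix t t' :: "'a \<times> 'a \<times> 'a"
  obtain i j k where t: "t = (i, j, k)" by (cases t)
  show "polynomial_fun (\<lambda>\<mu>. matrix (open_operator E T \<mu>) $ t $ t')"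
    by (cases "i \<in> E"; cases "j \<in> E"; cases "k \<in> E")
      (auto simp: t matrix_def open_operator_def lin_comb_simps tangent_vector_def tangent_action_def
        simp del: vector_minus_component
        intro!: polynomial_fun.add[OF polynomial_fun.const] polynomial_fun_sum polynomial_fun.add
          polynomial_fun.mult[OF polynomial_fun.const polynomial_fun.coord] polynomial_fun.const)
qed

text \<open>The orbit map takes values in the skew vectors, so it cannot be open into the whole
  coordinate space. A second, free parameter fills the complement: adding
  \<open>B - skew_part E B\<close> makes the derivative at the origin onto, with a right inverse
  read off from \<open>open_operator\<close>.\<close>

lemma block_orbit_local:
  fixes \<mu> :: "'n::finite product"
  assumes \<mu>: "\<mu> \<in> block_products E" and inv: "det (matrix (open_operator E T \<mu>)) \<noteq> 0"
  shows "\<exists>\<epsilon>>0. \<forall>\<nu>\<in>block_products E. dist (coord_vector \<mu>) (coord_vector \<nu>) < \<epsilon> \<longrightarrow>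
    (\<exists>g. block_matrix E g \<and> \<nu> = GL_action g \<mu>)"
proof -
  let ?F = "\<lambda>z. near_vector E \<mu> (fst z) + (snd z - skew_part E (snd z))"
  let ?F' = "\<lambda>z. tangent_vector E \<mu> (fst z) + (snd z - skew_part E (snd z))"
  let ?M = "matrix (open_operator E T \<mu>)"
  \<comment> \<open>Right inverse of \<open>?F'\<close>: applied to this pair, \<open>?F'\<close> is
    \<open>open_operator\<close> evaluated at \<open>matrix_inv ?M *v v\<close>, which gives back
    \<open>v\<close>.\<close>
  let ?g = "\<lambda>v. (lin_comb T (matrix_inv ?M *v v), matrix_inv ?M *v v)"
  let ?T = "{z. det (near_block E (fst z)) \<noteq> 0 \<and> det (near_block (- E) (fst z)) \<noteq> 0} ::
    ((complex^'n^'n) \<times> (complex^('n \<times> 'n \<times> 'n))) set"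
  have real_scale: "r *\<^sub>R v = complex_of_real r *s v" for r and v :: "complex^'t"
    unfolding vec_eq_iff vector_scaleR_component by (simp add: scaleR_conv_of_real)
  have bl_skew: "bounded_linear (\<lambda>v. skew_part E v)"
    unfolding linear_conv_bounded_linear[symmetric]
    by (rule linearI) (simp_all add: skew_part_linear real_scale)
  have cont_near: "continuous_on UNIV (\<lambda>z::(complex^'n^'n) \<times> (complex^('n \<times> 'n \<times> 'n)). det (near_block A (fst z)))" for A
  proof (rule continuous_det)
    fix i j
    show "continuous_on UNIV (\<lambda>z::(complex^'n^'n) \<times> (complex^('n \<times> 'n \<times> 'n)). near_block A (fst z) $ i $ j)"
      by (cases "i \<in> A"; cases "j \<in> A") (auto simp: near_block_def intro!: continuous_intros)
  qed
  have "?T = (\<lambda>z. det (near_block E (fst z))) -` (- {0}) \<inter> (\<lambda>z. det (near_block (- E) (fst z))) -` (- {0})"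
    by auto
  then have "open ?T"
    using open_vimage[OF _ cont_near] by (simp add: open_Int open_Compl)
  moreover have near_0: "near_block A 0 = mat 1" for A :: "'n set"
    by (auto simp: near_block_def mat_def vec_eq_iff)
  ultimately have "(0, 0) \<in> interior ?T" by (simp add: interior_open)
  moreover have "continuous_on UNIV ?F"
    by (intro continuous_intros continuous_on_compose2[OF continuous_near_vector[of UNIV]]
        linear_continuous_on[OF bl_skew] continuous_on_compose2[OF linear_continuous_on[OF bl_skew, of UNIV]]) auto
  moreover have "(?F has_derivative ?F') (at (0, 0))"
  proof (rule has_derivative_add)
    show "((\<lambda>z. near_vector E \<mu> (fst z)) has_derivative (\<lambda>z. tangent_vector E \<mu> (fst z))) (at (0, 0))"
      by (rule has_derivative_compose[OF bounded_linear_imp_has_derivative[OF bounded_linear_fst]])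
        (simp add: near_vector_has_derivative)
    show "((\<lambda>z. snd z - skew_part E (snd z)) has_derivative (\<lambda>z. snd z - skew_part E (snd z))) (at (0, 0))"
      by (intro bounded_linear_imp_has_derivative bounded_linear_sub bounded_linear_snd
          bounded_linear_compose[OF bl_skew bounded_linear_snd])
  qed
  moreover have "bounded_linear ?g"
    unfolding linear_conv_bounded_linear[symmetric]
  proof (rule linearI)
    have "lin_comb T (complex_of_real r *s v) = r *\<^sub>R lin_comb T v" for r v
      unfolding lin_comb_simps vec_eq_iff vector_scaleR_component by (simp add: scaleR_conv_of_real)
    then show "?g (r *\<^sub>R v) = r *\<^sub>R ?g v" for r v by (simp add: real_scale vec.scale)
  qed (simp add: vec.add lin_comb_simps)
  moreover have "?F' \<circ> ?g = id"
  proof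
    fix v
    have "?M *v (matrix_inv ?M *v v) = v"
      using inv by (intro matrix_inv_mult_vec) (simp add: invertible_det_nz)
    then have "open_operator E T \<mu> (matrix_inv ?M *v v) = v"
      by (simp only: matrix_works[OF open_operator_linear])
    then show "(?F' \<circ> ?g) v = id v" by (simp add: open_operator_def algebra_simps)
  qed
  \<comment> \<open>Sussmann's form of the open mapping theorem asks for continuity, and for
    differentiability with a bounded linear right inverse at the single point considered.\<close>
  ultimately have "?F (0, 0) \<in> interior (?F ` ?T)"
    by (intro sussmann_open_mapping[of UNIV _ _ ?F' ?g]) auto
  moreover have "?F (0, 0) = coord_vector \<mu>"
    using near_vector_eq[OF \<mu>, of 0] skew_part_linear(3)[of E 0 0] by (simp add: near_0)
  ultimately obtain \<epsilon> where \<epsilon>: "\<epsilon> > 0" "ball (coord_vector \<mu>) \<epsilon> \<subseteq> ?F ` ?T"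
    unfolding mem_interior by auto
  have "\<exists>g. block_matrix E g \<and> \<nu> = GL_action g \<mu>"
    if \<nu>: "\<nu> \<in> block_products E" "dist (coord_vector \<mu>) (coord_vector \<nu>) < \<epsilon>" for \<nu>
  proof -
    obtain X B where XB: "(X, B) \<in> ?T" "coord_vector \<nu> = ?F (X, B)"
      using \<nu>(2) \<epsilon>(2) by (force simp: subset_iff)
    define \<rho> where "\<rho> = (\<lambda>x y. near_block (- E) X *v \<mu> (near_block E X *v x) (near_block E X *v y))"
    obtain g where g: "block_matrix E g" "\<rho> = GL_action g \<mu>"
      using block_products_near[OF \<mu>, of X] XB(1) unfolding \<rho>_def by auto
    have \<rho>: "\<rho> \<in> block_products E" using block_products_GL_action[OF \<mu> g(1)] g(2) by simp
    have "near_vector E \<mu> X = coord_vector \<rho>" using near_vector_eq[OF \<mu>] by (simp add: \<rho>_def)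
    \<comment> \<open>The projection \<open>skew_part\<close> removes the auxiliary summand and
      fixes the coordinate vectors of both block products.\<close>
    then have "coord_vector \<nu> = skew_part E (coord_vector \<rho> + (B - skew_part E B))"
      using skew_part_coord_vector[OF \<nu>(1)] XB(2) by simp
    then have "coord_vector \<nu> = coord_vector \<rho>"
      by (simp add: skew_part_linear skew_part_idem skew_part_coord_vector[OF \<rho>])
    then have "\<nu> = \<rho>" using coord_vector_inj \<nu>(1) \<rho> block_productsD(1) by blast
    then show ?thesis using g by blast
  qed
  then show ?thesis using \<epsilon>(1) by blast
qed

lemma continuous_segment_product: "continuous_on S (\<lambda>s. coord_vector (segment_product \<mu> \<nu> s))"
proof -
  have "continuous_on S (\<lambda>s. coord_vector (segment_product \<mu> \<nu> s) $ t)" for t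
    by (cases t) (auto simp: coord_vector_def structure_constant_def segment_product_def intro!: continuous_intros)
  then have "continuous_on S (\<lambda>s. \<chi> t. coord_vector (segment_product \<mu> \<nu> s) $ t)"
    by (rule continuous_on_vec_lambda)
  then show ?thesis by simp
qed

theorem generic_block_orbit:
  fixes D :: "'n::finite product"
  assumes D: "D \<in> block_products E"
    and tangent: "\<And>b. (\<And>i j k. b i j k = - b j i k) \<Longrightarrow>
      \<exists>X. \<forall>i\<in>E. \<forall>j\<in>E. \<forall>k\<in>-E. tangent_action D X i j k = b i j k"
  shows "\<exists>f. polynomial_fun f \<and> f D \<noteq> 0 \<and>
    (\<forall>\<nu>\<in>block_products E. f \<nu> \<noteq> 0 \<longrightarrow> (\<exists>g. block_matrix E g \<and> \<nu> = GL_action g D))"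
proof -
  have "\<exists>X. tangent_vector E D X = skew_part E v" for v
  proof -
    have "\<exists>X. \<forall>i\<in>E. \<forall>j\<in>E. \<forall>k\<in>-E. tangent_action D X i j k = (v $ (i, j, k) - v $ (j, i, k)) / 2"
      by (rule tangent) (simp add: field_simps)
    then show ?thesis by (elim ex_forward) (auto simp: vec_eq_iff tangent_vector_def skew_part_def)
  qed
  then have "\<forall>t. \<exists>X. tangent_vector E D X = skew_part E (axis t 1)" by blast
  from choice[OF this] obtain T where "\<forall>t. tangent_vector E D (T t) = skew_part E (axis t 1)" ..
  note T = this[rule_format]
  let ?f = "\<lambda>\<mu>. det (matrix (open_operator E T \<mu>))"
  have "matrix (open_operator E T D) = mat 1"
    unfolding matrix_def open_operator_def lin_comb_simps T
    by (auto simp: vec_eq_iff mat_def axis_def)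
  then have fD: "?f D \<noteq> 0" by simp
  have "\<exists>g. block_matrix E g \<and> \<nu> = GL_action g D" if \<nu>: "\<nu> \<in> block_products E" "?f \<nu> \<noteq> 0" for \<nu>
  proof -
    let ?s = "segment_product D \<nu>"
    let ?S = "- {s. ?f (?s s) = 0}"
    \<comment> \<open>Lying in one block orbit is an equivalence relation on parameters whose
      classes are open in \<open>?S\<close>; a connected \<open>?S\<close> is therefore a single
      class.\<close>
    let ?R = "\<lambda>s s'. \<exists>g. block_matrix E g \<and> ?s s' = GL_action g (?s s)"
    have "finite {s. ?f (?s s) = 0}"
      using is_poly_finite_zeros[OF is_poly_segment_product[OF polynomial_fun_open_operator], of E T D \<nu> 0] fD
      by simp
    then have "connected ?S"
      by (intro path_connected_imp_connected path_connected_complement_countable countable_finite) auto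
    moreover have "0 \<in> ?S" "1 \<in> ?S" using fD \<nu>(2) by auto
    moreover have "?R s' s" if "?R s s'" for s s'
      using that GL_action_inverse block_matrix_inv unfolding block_matrix_def by metis
    moreover have "?R x z" if "?R x y" "?R y z" for x y z
      using that GL_action_mult block_matrix_mult unfolding block_matrix_def by metis
    moreover have "\<exists>U. openin (top_of_set ?S) U \<and> a \<in> U \<and> (\<forall>x\<in>U. ?R a x)" if "a \<in> ?S" for a
    proof -
      have blk: "?s s \<in> block_products E" for s using segment_product_block D \<nu>(1) by blast
      have fa: "?f (?s a) \<noteq> 0" using that by simp
      obtain \<epsilon> where \<epsilon>: "\<epsilon> > 0" "\<And>\<rho>. \<rho> \<in> block_products E \<Longrightarrow>
          dist (coord_vector (?s a)) (coord_vector \<rho>) < \<epsilon> \<Longrightarrow> \<exists>g. block_matrix E g \<and> \<rho> = GL_action g (?s a)"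
        using block_orbit_local[OF blk fa] by blast
      let ?U = "?S \<inter> (\<lambda>s. coord_vector (?s s)) -` ball (coord_vector (?s a)) \<epsilon>"
      have "openin (top_of_set ?S) ?U"
        by (rule continuous_openin_preimage_gen[OF continuous_segment_product open_ball])
      moreover have "a \<in> ?U" using that \<epsilon>(1) by simp
      moreover have "\<forall>x\<in>?U. ?R a x" using \<epsilon>(2) blk by simp
      ultimately show ?thesis by blast
    qed
    ultimately have "?R 0 1"
      by (rule connected_equivalence_relation)
    then show ?thesis by simp
  qed
  with fD show ?thesis
    by (intro exI[of _ ?f] conjI ballI impI polynomial_fun_open_operator)
qed

subsection \<open>Rigidity of block products\<close>

text \<open>Values have no coordinates in \<open>E\<close> and hence annihilate, so both sides of
  antiassociativity are zero.\<close>

lemma block_products_subset_dual_mock_lie: "block_products E \<subseteq> dual_mock_lie"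
proof
  fix \<mu> :: "'a product" assume \<mu>: "\<mu> \<in> block_products E"
  note D = block_productsD[OF \<mu>]
  have "\<mu> (\<mu> x y) z = 0" "\<mu> x (\<mu> y z) = 0" for x y z
    using D(3)[of "\<mu> x y" z] D(5)[of x "\<mu> y z"] by (simp_all add: D(4) bilinear_product_simps[OF D(1)])
  then have "\<mu> (\<mu> x y) z = - \<mu> x (\<mu> y z)" for x y z by simp
  then show "\<mu> \<in> dual_mock_lie" unfolding dual_mock_lie_def using D(1,2) by blast
qed

text \<open>The component of \<open>\<mu>\<close> in the linear space
  \<open>block_products E\<close>. It is linear in \<open>\<mu>\<close> and commutes with block
  matrices, which lets a polynomial condition on block products be pulled back to the whole
  variety.\<close>

definition block_truncation :: "'n::finite set \<Rightarrow> 'n product \<Rightarrow> 'n product" where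
  "block_truncation E \<mu> = (\<lambda>x y. \<mu> (coord_proj E *v x) (coord_proj E *v y) -
     coord_proj E *v \<mu> (coord_proj E *v x) (coord_proj E *v y))"

lemma coord_proj_idem [simp]: "coord_proj E *v (coord_proj E *v x) = coord_proj E *v x"
  by (simp add: vec_eq_iff coord_proj_component)

lemma block_truncation_mem:
  assumes "\<mu> \<in> dual_mock_lie"
  shows "block_truncation E \<mu> \<in> block_products E"
proof -
  note D = dual_mock_lieD[OF assms]
  have 1: "block_truncation E \<mu> \<in> bilinear_products"
    by (rule bilinear_productsI)
      (simp_all add: block_truncation_def bilinear_product_simps[OF D(1)] vec.add vec.scale vec.diff
        vec.scale_right_diff_distrib)
  have 2: "block_truncation E \<mu> x y = - block_truncation E \<mu> y x" for x y
    unfolding block_truncation_def D(2)[of "coord_proj E *v x" "coord_proj E *v y"] vec.neg by simp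
  have 3: "block_truncation E \<mu> (coord_proj E *v x) y = block_truncation E \<mu> x y"
    "coord_proj E *v block_truncation E \<mu> x y = 0" for x y
    by (simp_all add: block_truncation_def vec.diff)
  show ?thesis unfolding block_products_def using 1 2 3 by blast
qed

lemma block_truncation_id:
  "\<mu> \<in> block_products E \<Longrightarrow> block_truncation E \<mu> = \<mu>"
  by (simp add: block_truncation_def block_productsD(3-5) fun_eq_iff)

lemma block_truncation_GL_action:
  assumes "block_matrix E g"
  shows "block_truncation E (GL_action g \<mu>) = GL_action g (block_truncation E \<mu>)"
  unfolding block_truncation_def GL_action_def
  by (simp add: vec.diff block_matrix_mult_vec[OF assms] flip: block_matrix_mult_vec[OF block_matrix_inv[OF assms]])

lemma polynomial_fun_block_truncation:
  assumes "polynomial_fun p"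
  shows "\<exists>q. polynomial_fun q \<and> (\<forall>\<mu>\<in>bilinear_products. q \<mu> = p (block_truncation E \<mu>))"
proof (rule polynomial_fun_subst[OF assms])
  fix i j k
  let ?q = "if i \<in> E \<and> j \<in> E \<and> k \<notin> E then structure_constant i j k else (\<lambda>\<mu>. 0)"
  have "polynomial_fun ?q" by (simp add: polynomial_fun.intros)
  moreover have "?q \<mu> = structure_constant i j k (block_truncation E \<mu>)"
    if "\<mu> \<in> bilinear_products" for \<mu>
    by (auto simp: structure_constant_def block_truncation_def coord_proj_axis coord_proj_component
        bilinear_product_simps[OF that])
  ultimately show "\<exists>q. polynomial_fun q \<and>
      (\<forall>\<mu>\<in>bilinear_products. q \<mu> = structure_constant i j k (block_truncation E \<mu>))" by blast
qed

lemma invertible_columns: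
  fixes c :: "'n::finite \<Rightarrow> complex^'n"
  assumes "\<And>a. (\<Sum>i\<in>UNIV. a i *s c i) = 0 \<Longrightarrow> \<forall>i. a i = 0"
  obtains h where "invertible h" "\<And>i. h *v e i = c i" "\<And>x. h *v x = (\<Sum>i\<in>UNIV. x $ i *s c i)"
proof -
  let ?h = "(\<chi> p q. c q $ p) :: complex^'n^'n"
  have 1: "?h *v x = (\<Sum>i\<in>UNIV. x $ i *s c i)" for x
    by (simp add: matrix_vector_mult_def vec_eq_iff mult.commute)
  have "\<forall>x. ?h *v x = 0 \<longrightarrow> x = 0"
    using assms unfolding 1 by (auto simp: vec_eq_iff)
  then have "invertible ?h"
    using invertible_left_inverse matrix_left_invertible_ker by blast
  moreover have "?h *v e i = c i" for i by (simp add: vec_eq_iff)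
  ultimately show thesis using 1 that by blast
qed

text \<open>The lifts of the basis vectors outside \<open>E\<close> to products in \<open>\<mu>\<close> extend the identity of the span
  of \<open>E\<close> to an isomorphism: a defect of multiplicativity lies in the span of \<open>E\<close> and annihilates
  everything, hence vanishes.\<close>

lemma orbit_of_block_truncation:
  fixes D :: "'n::finite product"
  assumes \<mu>: "\<mu> \<in> dual_mock_lie" and D: "block_truncation E \<mu> = D"
    and two_step: "\<And>x y z. \<mu> (\<mu> x y) z = 0"
    and radical: "\<And>u. coord_proj E *v u = u \<Longrightarrow> (\<forall>i\<in>E. D u (e i) = 0) \<Longrightarrow> u = 0"
    and lift: "\<And>k. k \<notin> E \<Longrightarrow> \<exists>i\<in>E. \<exists>j\<in>E. D (e i) (e j) = e k"
  shows "\<mu> \<in> orbit D"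
proof -
  note M = dual_mock_lieD[OF \<mu>]
  have Dblock: "D \<in> block_products E" using block_truncation_mem[OF \<mu>, of E] D by simp
  note B = block_productsD[OF Dblock]
  have D_comp: "D x y $ k = \<mu> (coord_proj E *v x) (coord_proj E *v y) $ k" if "k \<notin> E" for x y k
    using that by (simp add: D[symmetric] block_truncation_def coord_proj_component)
  have two_step': "\<mu> z (\<mu> x y) = 0" for x y z
    using M(2)[of z "\<mu> x y"] two_step by simp
  have "\<exists>v. (k \<in> E \<longrightarrow> v = e k) \<and>
      (k \<notin> E \<longrightarrow> (\<exists>i\<in>E. \<exists>j\<in>E. D (e i) (e j) = e k \<and> v = \<mu> (e i) (e j)))" for k
  proof (cases "k \<in> E")
    case False
    then obtain i j where "i \<in> E" "j \<in> E" "D (e i) (e j) = e k" using lift by blast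
    then show ?thesis using False by (intro exI[of _ "\<mu> (e i) (e j)"]) blast
  qed blast
  then have "\<forall>k. \<exists>v. (k \<in> E \<longrightarrow> v = e k) \<and>
      (k \<notin> E \<longrightarrow> (\<exists>i\<in>E. \<exists>j\<in>E. D (e i) (e j) = e k \<and> v = \<mu> (e i) (e j)))" ..
  from choice[OF this] obtain c where c': "\<forall>k. (k \<in> E \<longrightarrow> c k = e k) \<and>
      (k \<notin> E \<longrightarrow> (\<exists>i\<in>E. \<exists>j\<in>E. D (e i) (e j) = e k \<and> c k = \<mu> (e i) (e j)))" ..
  then have c: "\<And>k. k \<in> E \<Longrightarrow> c k = e k"
    "\<And>k. k \<notin> E \<Longrightarrow> \<exists>i\<in>E. \<exists>j\<in>E. D (e i) (e j) = e k \<and> c k = \<mu> (e i) (e j)"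
    by simp_all
  \<comment> \<open>Outside \<open>E\<close> each lift has the coordinates of the basis vector it
    lifts, because \<open>D\<close> is the truncation of \<open>\<mu>\<close>. This is what makes
    the columns independent.\<close>
  have c_comp: "c i $ k = e i $ k" if "k \<notin> E" for i k
  proof (cases "i \<in> E")
    case False
    then obtain i' j' where ij: "i' \<in> E" "j' \<in> E" "D (e i') (e j') = e i" "c i = \<mu> (e i') (e j')"
      using c(2) by blast
    then show ?thesis using D_comp[OF that, of "e i'" "e j'"] by (simp add: coord_proj_axis)
  qed (simp add: c(1))
  have sum_comp: "(\<Sum>i\<in>UNIV. a i *s c i) $ k = a k" if "k \<notin> E" for a k
  proof -
    have "(\<Sum>i\<in>UNIV. a i *s c i) $ k = (\<Sum>i\<in>UNIV. a i * e i $ k)"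
      by (simp add: c_comp[OF that])
    also have "\<dots> = (\<Sum>i\<in>UNIV. if i = k then a i else 0)" by (rule sum.cong) (auto simp: axis_def)
    finally show ?thesis by simp
  qed
  have "\<forall>i. a i = 0" if a: "(\<Sum>i\<in>UNIV. a i *s c i) = 0" for a
  proof -
    have 1: "a k = 0" if "k \<notin> E" for k using sum_comp[OF that, of a] a by simp
    then have ac: "a i *s c i = a i *s e i" for i using c(1) by (cases "i \<in> E") auto
    have "(\<Sum>i\<in>UNIV. (\<chi> i. a i) $ i *s e i) = (\<Sum>i\<in>UNIV. a i *s c i)"
      unfolding ac by simp
    then have "(\<Sum>i\<in>UNIV. (\<chi> i. a i) $ i *s e i) = 0" using a by simp
    then show ?thesis unfolding basis_expansion by (simp add: vec_eq_iff)
  qed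
  then obtain h where h: "invertible h" "\<And>i. h *v e i = c i" "\<And>x. h *v x = (\<Sum>i\<in>UNIV. x $ i *s c i)"
    using invertible_columns[of c] by blast
  have c_ann: "\<mu> (c k) x = 0" "\<mu> x (c k) = 0" if "k \<notin> E" for k x
    using c(2)[OF that] two_step two_step' by auto
  have "h *v D (e i) (e j) = \<mu> (h *v e i) (h *v e j)" for i j
  proof (cases "i \<in> E \<and> j \<in> E")
    case False
    then have "D (e i) (e j) = 0"
      using B(3)[of "e i" "e j"] B(5)[of "e i" "e j"]
      by (auto simp: coord_proj_axis bilinear_product_simps[OF B(1)])
    then show ?thesis using False c_ann by (auto simp: h(2))
  next
    case True
    define w where "w = h *v D (e i) (e j) - \<mu> (e i) (e j)"
    have "\<mu> (D (e i) (e j) $ k *s c k) x = 0" for k x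
    proof (cases "k \<in> E")
      case True
      then show ?thesis using coord_proj_component[of E "D (e i) (e j)" k]
        by (simp add: B(4) bilinear_product_simps[OF M(1)])
    qed (simp add: c_ann bilinear_product_simps[OF M(1)])
    then have w_ann: "\<mu> w x = 0" for x
      by (simp add: w_def h(3) bilinear_product_simps(3,11)[OF M(1)] two_step)
    have w_E: "w $ k = 0" if "k \<notin> E" for k
    proof -
      have "w $ k = D (e i) (e j) $ k - \<mu> (e i) (e j) $ k"
        unfolding w_def h(3) vector_minus_component sum_comp[OF that] ..
      then show ?thesis using True D_comp[OF that, of "e i" "e j"] by (simp add: coord_proj_axis)
    qed
    then have Qw: "coord_proj E *v w = w" by (simp add: vec_eq_iff coord_proj_component)
    have "D w x = 0" for x
      unfolding D[symmetric] block_truncation_def by (simp add: Qw w_ann)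
    then have "w = 0" using radical[OF Qw] by blast
    then show ?thesis using True by (simp add: w_def h(2) c(1))
  qed
  then show ?thesis by (intro mem_orbitI[OF B(1) M(1) h(1)])
qed

text \<open>If \<open>f\<close> is nonzero on the truncation of a product, a block matrix moves that
  truncation to \<open>D\<close> exactly, and \<open>two_step\<close>, \<open>radical\<close> and
  \<open>lift\<close> rebuild an isomorphism with \<open>D\<close>. The closure statement uses the
  same \<open>f\<close> on lines ending in \<open>D\<close>.\<close>

theorem rigid_block_product:
  fixes D :: "'n::finite product"
  assumes D: "D \<in> block_products E"
    and tangent: "\<And>b. (\<And>i j k. b i j k = - b j i k) \<Longrightarrow>
      \<exists>X. \<forall>i\<in>E. \<forall>j\<in>E. \<forall>k\<in>-E. tangent_action D X i j k = b i j k"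
    and two_step: "\<And>\<mu> x y z. \<mu> \<in> dual_mock_lie \<Longrightarrow> block_truncation E \<mu> = D \<Longrightarrow> \<mu> (\<mu> x y) z = 0"
    and radical: "\<And>u. coord_proj E *v u = u \<Longrightarrow> (\<forall>i\<in>E. D u (e i) = 0) \<Longrightarrow> u = 0"
    and lift: "\<And>k. k \<notin> E \<Longrightarrow> \<exists>i\<in>E. \<exists>j\<in>E. D (e i) (e j) = e k"
  shows "rigid D \<and> block_products E \<subseteq> zariski closure_of orbit D"
proof (rule conjI)
  have "\<exists>f. polynomial_fun f \<and> f D \<noteq> 0 \<and>
      (\<forall>\<nu>\<in>block_products E. f \<nu> \<noteq> 0 \<longrightarrow> (\<exists>g. block_matrix E g \<and> \<nu> = GL_action g D))"
    by (rule generic_block_orbit[OF D]) (rule tangent)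
  then obtain f where f: "polynomial_fun f" "f D \<noteq> 0"
    "\<forall>\<nu>\<in>block_products E. f \<nu> \<noteq> 0 \<longrightarrow> (\<exists>g. block_matrix E g \<and> \<nu> = GL_action g D)"
    by (elim exE conjE)
  obtain q where q: "polynomial_fun q" "\<forall>\<mu>\<in>bilinear_products. q \<mu> = f (block_truncation E \<mu>)"
    using polynomial_fun_block_truncation[OF f(1)] by blast
  have Dd: "D \<in> dual_mock_lie" using block_products_subset_dual_mock_lie D by blast
  show "rigid D"
  proof (rule openin_orbitI[OF Dd q(1)])
    show "q D \<noteq> 0" using q(2) f(2) block_productsD(1)[OF D] by (simp add: block_truncation_id[OF D])
    fix \<nu> :: "'n product" assume \<nu>: "\<nu> \<in> dual_mock_lie" "q \<nu> \<noteq> 0"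
    then have "f (block_truncation E \<nu>) \<noteq> 0" using q(2) dual_mock_lieD(1)[OF \<nu>(1)] by simp
    then obtain g where g: "block_matrix E g" "block_truncation E \<nu> = GL_action g D"
      using f(3) block_truncation_mem[OF \<nu>(1)] by blast
    have inv: "invertible g" using g(1) by (simp add: block_matrix_def)
    let ?\<mu> = "GL_action (matrix_inv g) \<nu>"
    have \<mu>: "?\<mu> \<in> dual_mock_lie" using dual_mock_lie_GL_action[OF \<nu>(1)] invertibleD(3)[OF inv] .
    have D': "block_truncation E ?\<mu> = D"
      unfolding block_truncation_GL_action[OF block_matrix_inv[OF g(1)]] g(2)
      using GL_action_inverse[OF inv] by metis
    have "?\<mu> \<in> orbit D"
      by (rule orbit_of_block_truncation[OF \<mu> D' two_step[OF \<mu> D'] radical lift])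
    moreover have "GL_action g ?\<mu> = \<nu>" using GL_action_inverse[OF inv] by blast
    ultimately show "\<nu> \<in> orbit D" using orbit_GL_action[OF inv] by metis
  qed
  show "block_products E \<subseteq> zariski closure_of orbit D"
  proof
    fix \<mu> :: "'n product" assume \<mu>: "\<mu> \<in> block_products E"
    show "\<mu> \<in> zariski closure_of orbit D"
    proof (rule zariski_closure_segment[where f = f and \<nu> = D])
      show "orbit D \<subseteq> bilinear_products" "\<mu> \<in> bilinear_products"
        using orbit_subset_bilinear_products block_productsD(1) D \<mu> by blast+
      show "polynomial_fun f" "f D \<noteq> 0" by (rule f)+
      fix s assume "f (segment_product \<mu> D s) \<noteq> 0"
      then have "\<exists>g. block_matrix E g \<and> segment_product \<mu> D s = GL_action g D"
        using bspec[OF f(3) segment_product_block[OF \<mu> D]] by (rule rev_mp)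
      then show "segment_product \<mu> D s \<in> orbit D"
        unfolding orbit_def block_matrix_def by blast
    qed
  qed
qed

subsection \<open>Three-step dual mock-Lie algebras\<close>

text \<open>Both laws together give the cyclic rule (xy)z = (yz)x, hence alternation. The pentagon
  of bracketings of four factors has five edges, each changing the sign: one edge gives ((xy)z)w =
  -(xy)(zw), the other four give the same without the sign, so both sides vanish.\<close>

lemma dual_mock_lie_triple:
  assumes "\<mu> \<in> dual_mock_lie"
  shows "\<mu> x x = 0" "\<mu> (\<mu> x y) z = \<mu> (\<mu> y z) x" "\<mu> (\<mu> x y) z = - \<mu> (\<mu> x z) y"
    "\<mu> (\<mu> (\<mu> x y) z) w = 0" "\<mu> (\<mu> x y) (\<mu> z w) = 0"
proof -
  note D = dual_mock_lieD[OF assms]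
  note s = bilinear_product_simps[OF D(1)]
  show "\<mu> x x = 0" for x using D(2)[of x x] by (simp add: vec_eq_iff equal_neg_zero)
  show cyc: "\<mu> (\<mu> x y) z = \<mu> (\<mu> y z) x" for x y z
    using D(3)[of x y z] D(2)[of x "\<mu> y z"] by simp
  show "\<mu> (\<mu> x y) z = - \<mu> (\<mu> x z) y"
    using cyc[of x y z] D(2)[of y z] cyc[of x z y] s(5) by (metis)
  have a: "\<mu> (\<mu> (\<mu> x y) z) w = - \<mu> (\<mu> x y) (\<mu> z w)" for x y z w by (rule D(3))
  have "\<mu> (\<mu> x y) (\<mu> z w) = \<mu> (\<mu> (\<mu> x y) z) w" for x y z w
  proof -
    have "\<mu> (\<mu> x y) (\<mu> z w) = - \<mu> x (\<mu> y (\<mu> z w))" by (rule D(3))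
    also have "\<mu> y (\<mu> z w) = - \<mu> (\<mu> y z) w" using D(3)[of y z w] by simp
    also have "- \<mu> x (- \<mu> (\<mu> y z) w) = \<mu> x (\<mu> (\<mu> y z) w)" by (simp add: s)
    also have "\<dots> = - \<mu> (\<mu> x (\<mu> y z)) w" using D(3)[of x "\<mu> y z" w] by simp
    also have "\<mu> x (\<mu> y z) = - \<mu> (\<mu> x y) z" using D(3)[of x y z] by simp
    finally show ?thesis by (simp add: s)
  qed
  with a have b: "\<mu> (\<mu> x y) (\<mu> z w) = - \<mu> (\<mu> x y) (\<mu> z w)" for x y z w by metis
  then show z: "\<mu> (\<mu> x y) (\<mu> z w) = 0" for x y z w
    using b[of x y z w] by (simp add: vec_eq_iff equal_neg_zero)
  show "\<mu> (\<mu> (\<mu> x y) z) w = 0" using a z by simp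
qed

section \<open>Coordinates in dimension eight\<close>

lemma UNIV_8: "(UNIV :: 8 set) = {1, 2, 3, 4, 5, 6, 7, 8}"
proof -
  have "card {1, 2, 3, 4, 5, 6, 7, 8 :: 8} = CARD(8)" by simp
  then show ?thesis by (metis card_subset_eq finite_class.finite_UNIV subset_UNIV)
qed

lemma forall_8: "(\<forall>i::8. P i) \<longleftrightarrow> P 1 \<and> P 2 \<and> P 3 \<and> P 4 \<and> P 5 \<and> P 6 \<and> P 7 \<and> P 8"
proof
  assume P: "P 1 \<and> P 2 \<and> P 3 \<and> P 4 \<and> P 5 \<and> P 6 \<and> P 7 \<and> P 8"
  show "\<forall>i. P i"
  proof
    fix i :: 8
    have "i \<in> {1, 2, 3, 4, 5, 6, 7, 8}" unfolding UNIV_8[symmetric] by (rule UNIV_I)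
    then show "P i" using P by (elim insertE emptyE conjE) (hypsubst, assumption)+
  qed
qed (intro conjI; erule spec)

lemma sum_8: "sum f (UNIV :: 8 set) = f 1 + f 2 + f 3 + f 4 + f 5 + f 6 + f 7 + f 8"
  unfolding UNIV_8 by (simp add: add.assoc)

lemma table_product_bilinear: "table_product T \<in> bilinear_products"
proof (induction T)
  case Nil
  show ?case by (rule bilinear_productsI) (simp_all add: table_product_def)
next
  case (Cons t T)
  obtain i j v where t: "t = (i, j, v)" by (cases t)
  have 1: "table_product (t # T) x y = (x $ i * y $ j - x $ j * y $ i) *s v + table_product T x y" for x y
    by (simp add: table_product_def t)
  show ?case
    by (rule bilinear_productsI)
      (simp_all add: 1 bilinear_product_simps[OF Cons] vec_eq_iff algebra_simps)
qed

lemma axis_component: "e i $ j = (if j = i then 1 else 0)"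
  by (simp add: axis_def)

lemma D36_axis:
  "D36 (e i) (e j) = (if i = 1 \<and> j = 2 then e 4 else if i = 2 \<and> j = 1 then - e 4
     else if i = 1 \<and> j = 3 then e 5 else if i = 3 \<and> j = 1 then - e 5
     else if i = 2 \<and> j = 3 then e 6 else if i = 3 \<and> j = 2 then - e 6
     else if (i = 1 \<and> j = 6) \<or> (i = 5 \<and> j = 2) \<or> (i = 3 \<and> j = 4) \<or> (i = 3 \<and> j = 7) then e 8
     else if (i = 6 \<and> j = 1) \<or> (i = 2 \<and> j = 5) \<or> (i = 4 \<and> j = 3) \<or> (i = 7 \<and> j = 3) then - e 8
     else 0)" (is "?P i j")
proof -
  have "\<forall>i j. ?P i j"
    unfolding forall_8 by (simp add: D36_def table_product_def axis_component)
  then show ?thesis by blast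
qed

text \<open>The multiplication table of the subalgebra generated by \<open>x\<close>,
  \<open>y\<close>, \<open>w\<close>, products of two products excepted: every triple product is
  zero or the single \<open>z\<close> up to sign.\<close>

lemma free_triple_products:
  fixes \<mu> :: "'n::finite product" and x y w
  assumes \<mu>: "\<mu> \<in> dual_mock_lie"
  defines "z \<equiv> \<mu> (\<mu> x y) w"
  shows "\<mu> (\<mu> x w) y = - z \<and> \<mu> (\<mu> y w) x = z \<and> \<mu> (\<mu> x y) x = 0 \<and> \<mu> (\<mu> x y) y = 0 \<and>
    \<mu> (\<mu> x w) x = 0 \<and> \<mu> (\<mu> x w) w = 0 \<and> \<mu> (\<mu> y w) y = 0 \<and> \<mu> (\<mu> y w) w = 0 \<and>
    \<mu> x (\<mu> y w) = - z \<and> \<mu> y (\<mu> x w) = z \<and> \<mu> w (\<mu> x y) = - z \<and>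
    \<mu> x (\<mu> x y) = 0 \<and> \<mu> y (\<mu> x y) = 0 \<and> \<mu> x (\<mu> x w) = 0 \<and> \<mu> w (\<mu> x w) = 0 \<and>
    \<mu> y (\<mu> y w) = 0 \<and> \<mu> w (\<mu> y w) = 0 \<and> (\<forall>v. \<mu> z v = 0 \<and> \<mu> v z = 0)"
proof -
  note D = dual_mock_lieD[OF \<mu>] and s = bilinear_product_simps[OF dual_mock_lieD(1)[OF \<mu>]]
  note t = dual_mock_lie_triple[OF \<mu>]
  have r: "\<mu> (\<mu> x w) y = - z" "\<mu> (\<mu> y w) x = z" "\<mu> (\<mu> x y) x = 0" "\<mu> (\<mu> x y) y = 0"
    "\<mu> (\<mu> x w) x = 0" "\<mu> (\<mu> x w) w = 0" "\<mu> (\<mu> y w) y = 0" "\<mu> (\<mu> y w) w = 0"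
    using t(3)[of x w y] t(2)[of x y w] t(2)[of x x y] t(2)[of x y y] t(2)[of x w w] t(2)[of y w w]
      t(3)[of x w x] t(3)[of y w y] t(3)[of x y x] t(1) s by (auto simp: z_def)
  have l: "\<mu> x (\<mu> y w) = - z" "\<mu> y (\<mu> x w) = z" "\<mu> w (\<mu> x y) = - z"
    "\<mu> x (\<mu> x y) = 0" "\<mu> y (\<mu> x y) = 0" "\<mu> x (\<mu> x w) = 0" "\<mu> w (\<mu> x w) = 0"
    "\<mu> y (\<mu> y w) = 0" "\<mu> w (\<mu> y w) = 0"
    using D(2)[of x "\<mu> y w"] D(2)[of y "\<mu> x w"] D(2)[of w "\<mu> x y"] D(2)[of x "\<mu> x y"]
      D(2)[of y "\<mu> x y"] D(2)[of x "\<mu> x w"] D(2)[of w "\<mu> x w"] D(2)[of y "\<mu> y w"] D(2)[of w "\<mu> y w"] r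
    by (simp_all add: z_def)
  have z: "\<mu> z v = 0" for v unfolding z_def by (rule t(4))
  have "\<mu> v z = 0" for v using D(2)[of v z] z by simp
  with r l z show ?thesis by (intro conjI allI)
qed

text \<open>Multiplying the relation by yw, xw, xy isolates \<open>a1\<close>, \<open>a2\<close>,
  \<open>a3\<close>, since products of two products vanish; multiplying the rest by w, y, x isolates
  \<open>a4\<close>, \<open>a5\<close>, \<open>a6\<close>. The summand \<open>u\<close> can hold the
  triple product together with an annihilating eighth vector.\<close>

lemma seven_independent:
  assumes \<mu>: "\<mu> \<in> dual_mock_lie" and z: "\<mu> (\<mu> x y) w \<noteq> 0"
    and eq: "a1 *s x + a2 *s y + a3 *s w + a4 *s \<mu> x y + a5 *s \<mu> x w + a6 *s \<mu> y w + u = 0"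
    and u: "\<And>v. \<mu> u v = 0"
  shows "a1 = 0 \<and> a2 = 0 \<and> a3 = 0 \<and> a4 = 0 \<and> a5 = 0 \<and> a6 = 0 \<and> u = 0"
proof -
  note s = bilinear_product_simps[OF dual_mock_lieD(1)[OF \<mu>]]
  note t = dual_mock_lie_triple[OF \<mu>] and p = free_triple_products[OF \<mu>, where x = x and y = y and w = w]
  have 0: "\<mu> (a1 *s x + a2 *s y + a3 *s w + a4 *s \<mu> x y + a5 *s \<mu> x w + a6 *s \<mu> y w + u) v = 0" for v
    unfolding eq by (rule s)
  have a: "a1 = 0" "a2 = 0" "a3 = 0"
    using 0[of "\<mu> y w"] 0[of "\<mu> x w"] 0[of "\<mu> x y"] z by (simp_all add: s p t(5) u)
  have b: "a4 = 0" "a5 = 0" "a6 = 0"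
    using 0[of w] 0[of y] 0[of x] z by (simp_all add: s p a u)
  show ?thesis using a b eq by simp
qed

lemma function_8_exists:
  obtains c :: "8 \<Rightarrow> 'a" where "c 1 = c1" "c 2 = c2" "c 3 = c3" "c 4 = c4" "c 5 = c5" "c 6 = c6"
    "c 7 = c7" "c 8 = c8"
proof
  let ?c = "\<lambda>i::8. if i = 1 then c1 else if i = 2 then c2 else if i = 3 then c3 else if i = 4 then c4
    else if i = 5 then c5 else if i = 6 then c6 else if i = 7 then c7 else c8"
  show "?c 1 = c1" "?c 2 = c2" "?c 3 = c3" "?c 4 = c4" "?c 5 = c5" "?c 6 = c6" "?c 7 = c7" "?c 8 = c8"
    by simp_all
qed

lemma D36_bilinear: "D36 \<in> bilinear_products"
  unfolding D36_def by (rule table_product_bilinear)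

lemma orbit_D36_if_annihilator:
  fixes \<mu> :: "8 product"
  assumes \<mu>: "\<mu> \<in> dual_mock_lie" and z: "\<mu> (\<mu> x y) w \<noteq> 0"
    and v: "\<And>u. \<mu> v u = 0" "\<And>c. v \<noteq> c *s \<mu> (\<mu> x y) w"
  shows "\<mu> \<in> orbit D36"
proof -
  note s = bilinear_product_simps[OF dual_mock_lieD(1)[OF \<mu>]]
  note t = dual_mock_lie_triple[OF \<mu>] and p = free_triple_products[OF \<mu>, where x = x and y = y and w = w]
  have v': "\<mu> u v = 0" for u using dual_mock_lieD(2)[OF \<mu>, of u v] v(1) by simp
  have anti: "\<mu> y x = - \<mu> x y" "\<mu> w x = - \<mu> x w" "\<mu> w y = - \<mu> y w"
    by (rule dual_mock_lieD(2)[OF \<mu>])+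
  \<comment> \<open>In \<open>D36\<close> the vector \<open>e 7 - e 4\<close> annihilates
    everything; it is sent to \<open>v\<close>, so \<open>e 7\<close> goes to
    \<open>v + \<mu> x y\<close>. The sign at \<open>c 8\<close> reconciles x(yw) = -(xy)w with the
    table entry e1 e6 = e8.\<close>
  obtain c :: "8 \<Rightarrow> complex^8" where c: "c 1 = x" "c 2 = y" "c 3 = w" "c 4 = \<mu> x y" "c 5 = \<mu> x w"
    "c 6 = \<mu> y w" "c 7 = v + \<mu> x y" "c 8 = - \<mu> (\<mu> x y) w"
    by (rule function_8_exists)
  have "\<forall>i. a i = 0" if "(\<Sum>i\<in>UNIV. a i *s c i) = 0" for a
  proof -
    let ?u = "a 7 *s v - a 8 *s \<mu> (\<mu> x y) w"
    have "a 1 *s x + a 2 *s y + a 3 *s w + (a 4 + a 7) *s \<mu> x y + a 5 *s \<mu> x w + a 6 *s \<mu> y w + ?u = 0"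
      using that by (simp add: sum_8 c vec_eq_iff algebra_simps)
    moreover have "\<mu> ?u b = 0" for b by (simp add: s v p)
    ultimately have 1: "a 1 = 0 \<and> a 2 = 0 \<and> a 3 = 0 \<and> a 4 + a 7 = 0 \<and> a 5 = 0 \<and> a 6 = 0 \<and> ?u = 0"
      by (rule seven_independent[OF \<mu> z])
    have "a 7 = 0"
    proof (rule ccontr)
      assume "a 7 \<noteq> 0"
      then have "v = (a 8 / a 7) *s \<mu> (\<mu> x y) w" using 1 by (simp add: vec_eq_iff field_simps)
      then show False using v(2) by blast
    qed
    moreover have "a 8 = 0" using 1 z \<open>a 7 = 0\<close> by simp
    ultimately show ?thesis using 1 by (simp add: forall_8)
  qed
  then obtain h where h: "invertible h" "\<And>i. h *v e i = c i"
    using invertible_columns[of c] by blast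
  have "\<forall>i j. h *v D36 (e i) (e j) = \<mu> (h *v e i) (h *v e j)"
    unfolding forall_8 D36_axis h(2)
    by (simp add: h(2) c s t(1,5) v v' p anti vec.neg)
  then show ?thesis
    by (intro mem_orbitI[OF D36_bilinear dual_mock_lieD(1)[OF \<mu>] h(1)]) blast
qed

text \<open>The proof is by contradiction because the assumption supplies the coefficients: whatever
  annihilates is a multiple of \<open>?z\<close>. An eighth vector is corrected by \<open>x\<close>,
  \<open>y\<close>, \<open>w\<close> until xy, xw, yw kill it, and then by xy, xw, yw until
  \<open>x\<close>, \<open>y\<close>, \<open>w\<close> kill it. The result annihilates, which puts
  the eighth vector into the span of the seven.\<close>

lemma annihilator_of_three_step:
  fixes \<mu> :: "8 product"
  assumes \<mu>: "\<mu> \<in> dual_mock_lie" and z: "\<mu> (\<mu> x y) w \<noteq> 0"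
  shows "\<exists>v. (\<forall>u. \<mu> v u = 0) \<and> (\<forall>c. v \<noteq> c *s \<mu> (\<mu> x y) w)"
proof (rule ccontr)
  let ?z = "\<mu> (\<mu> x y) w"
  assume "\<not> ?thesis"
  then have ann: "\<exists>c. v = c *s ?z" if "\<forall>u. \<mu> v u = 0" for v using that by blast
  note s = bilinear_product_simps[OF dual_mock_lieD(1)[OF \<mu>]]
  note t = dual_mock_lie_triple[OF \<mu>] and p = free_triple_products[OF \<mu>, where x = x and y = y and w = w]
  obtain c :: "8 \<Rightarrow> complex^8" where c: "c 1 = x" "c 2 = y" "c 3 = w" "c 4 = \<mu> x y" "c 5 = \<mu> x w"
    "c 6 = \<mu> y w" "c 7 = 0" "c 8 = ?z"
    by (rule function_8_exists)
  \<comment> \<open>The seventh column is zero, so the matrix is not onto; any vector outside its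
    range completes the seven to a basis.\<close>
  let ?H = "(\<chi> i j. c j $ i) :: complex^8^8"
  have H: "?H *v a = a $ 1 *s x + a $ 2 *s y + a $ 3 *s w + a $ 4 *s \<mu> x y + a $ 5 *s \<mu> x w
      + a $ 6 *s \<mu> y w + a $ 8 *s ?z" for a
    by (simp add: vec_eq_iff matrix_vector_mult_def sum_8 c mult.commute)
  have "?H *v e 7 = 0" unfolding H by (simp add: axis_component)
  moreover have "e 7 \<noteq> (0 :: complex^8)" by (simp add: axis_eq_0_iff)
  ultimately have "\<not> (\<exists>B. B ** ?H = mat 1)" unfolding matrix_left_invertible_ker by blast
  then have "\<not> (\<exists>B. ?H ** B = mat 1)" using matrix_left_right_inverse by blast
  then have "\<not> surj ((*v) ?H)" unfolding matrix_right_invertible_surjective .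
  then obtain u0 where u0: "\<And>a. u0 \<noteq> ?H *v a" by (auto simp: surj_def)
  have u0': "u0 \<noteq> a1 *s x + a2 *s y + a3 *s w + a4 *s \<mu> x y + a5 *s \<mu> x w + a6 *s \<mu> y w + a8 *s ?z"
    for a1 a2 a3 a4 a5 a6 a8
    using u0[of "\<chi> i. if i = 1 then a1 else if i = 2 then a2 else if i = 3 then a3 else if i = 4 then a4
      else if i = 5 then a5 else if i = 6 then a6 else a8"] unfolding H by simp
  obtain d :: "8 \<Rightarrow> complex^8" where d: "d 1 = x" "d 2 = y" "d 3 = w" "d 4 = \<mu> x y" "d 5 = \<mu> x w"
    "d 6 = \<mu> y w" "d 7 = u0" "d 8 = ?z"
    by (rule function_8_exists)
  have "\<forall>i. a i = 0" if a: "(\<Sum>i\<in>UNIV. a i *s d i) = 0" for a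
  proof -
    have "a 7 = 0"
    proof (rule ccontr)
      assume n: "a 7 \<noteq> 0"
      have "u0 = (- a 1 / a 7) *s x + (- a 2 / a 7) *s y + (- a 3 / a 7) *s w + (- a 4 / a 7) *s \<mu> x y
        + (- a 5 / a 7) *s \<mu> x w + (- a 6 / a 7) *s \<mu> y w + (- a 8 / a 7) *s ?z"
      proof -
        have "a 7 * u0 $ i = - (a 1 * x $ i + a 2 * y $ i + a 3 * w $ i + a 4 * \<mu> x y $ i
            + a 5 * \<mu> x w $ i + a 6 * \<mu> y w $ i + a 8 * ?z $ i)" for i
          using arg_cong[OF a, of "\<lambda>v. v $ i"] by (simp add: sum_8 d) algebra
        then have "u0 $ i = - (a 1 * x $ i + a 2 * y $ i + a 3 * w $ i + a 4 * \<mu> x y $ i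
            + a 5 * \<mu> x w $ i + a 6 * \<mu> y w $ i + a 8 * ?z $ i) / a 7" for i
          using n by (metis nonzero_mult_div_cancel_left)
        then show ?thesis by (simp add: vec_eq_iff add_divide_distrib diff_divide_distrib)
      qed
      then show False using u0' by blast
    qed
    have "a 1 *s x + a 2 *s y + a 3 *s w + a 4 *s \<mu> x y + a 5 *s \<mu> x w + a 6 *s \<mu> y w + a 8 *s ?z = 0"
      using a \<open>a 7 = 0\<close> by (simp add: sum_8 d)
    moreover have "\<mu> (a 8 *s ?z) b = 0" for b by (simp add: s p)
    ultimately have 1: "a 1 = 0 \<and> a 2 = 0 \<and> a 3 = 0 \<and> a 4 = 0 \<and> a 5 = 0 \<and> a 6 = 0 \<and> a 8 *s ?z = 0"
      by (rule seven_independent[OF \<mu> z])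
    then show ?thesis using z \<open>a 7 = 0\<close> by (simp add: forall_8)
  qed
  then obtain h where h: "invertible h" "\<And>a. h *v a = (\<Sum>i\<in>UNIV. a $ i *s d i)"
    using invertible_columns[of d] by blast
  have all0: "\<forall>u. \<mu> v u = 0" if "\<mu> v x = 0" "\<mu> v y = 0" "\<mu> v w = 0" "\<mu> v (\<mu> x y) = 0"
    "\<mu> v (\<mu> x w) = 0" "\<mu> v (\<mu> y w) = 0" "\<mu> v u0 = 0" for v
  proof
    fix u
    have "u = h *v (matrix_inv h *v u)" using h(1) by simp
    then obtain a where "u = (\<Sum>i\<in>UNIV. a $ i *s d i)" unfolding h(2) by blast
    then show "\<mu> v u = 0" using that by (simp add: sum_8 d s p)
  qed
  have triple_ann: "\<exists>c. \<mu> (\<mu> a b) u = c *s ?z" for a b u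
    by (rule ann) (simp add: t(4))
  obtain \<alpha> \<beta> \<gamma> where abc: "\<mu> (\<mu> x y) u0 = \<alpha> *s ?z" "\<mu> (\<mu> x w) u0 = \<beta> *s ?z" "\<mu> (\<mu> y w) u0 = \<gamma> *s ?z"
    using triple_ann by metis
  \<comment> \<open>The signs are forced by (xy)w = z, (xw)y = -z and (yw)x = z.\<close>
  define u1 where "u1 = u0 - \<alpha> *s w + \<beta> *s y - \<gamma> *s x"
  have u0_eq: "u0 = u1 + \<alpha> *s w - \<beta> *s y + \<gamma> *s x" by (simp add: u1_def)
  have q: "\<mu> (\<mu> x y) u1 = 0" "\<mu> (\<mu> x w) u1 = 0" "\<mu> (\<mu> y w) u1 = 0"
    by (simp_all add: u1_def s p abc)
  have rot: "\<mu> (\<mu> a u1) b = - \<mu> (\<mu> a b) u1" for a b by (rule t(3))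
  have anti: "\<mu> y x = - \<mu> x y" "\<mu> w x = - \<mu> x w" "\<mu> w y = - \<mu> y w"
    by (rule dual_mock_lieD(2)[OF \<mu>])+
  have self: "\<mu> (\<mu> a u1) u1 = 0" for a using t(2)[of a u1 u1] by (simp add: t(1) s)
  \<comment> \<open>Rotating \<open>u1\<close> to the last place turns the products with generators
    into (ab)u1, already zero by \<open>q\<close>; products of two products vanish anyway.\<close>
  have ann1: "\<forall>u. \<mu> (\<mu> a u1) u = 0" if "a = x \<or> a = y \<or> a = w" for a
  proof (rule all0)
    have "\<mu> (\<mu> a b) u1 = 0" if "b = x \<or> b = y \<or> b = w" for b
      using that \<open>a = x \<or> a = y \<or> a = w\<close> by (elim disjE) (simp_all add: q anti s t(1))
    then show *: "\<mu> (\<mu> a u1) x = 0" "\<mu> (\<mu> a u1) y = 0" "\<mu> (\<mu> a u1) w = 0"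
      unfolding rot by simp_all
    show "\<mu> (\<mu> a u1) (\<mu> x y) = 0" "\<mu> (\<mu> a u1) (\<mu> x w) = 0" "\<mu> (\<mu> a u1) (\<mu> y w) = 0"
      by (rule t(5))+
    show "\<mu> (\<mu> a u1) u0 = 0" unfolding u0_eq by (simp add: s * self)
  qed
  obtain a b c' where abc': "\<mu> x u1 = a *s ?z" "\<mu> y u1 = b *s ?z" "\<mu> w u1 = c' *s ?z"
    using ann ann1 by metis
  \<comment> \<open>The signs are forced by x(yw) = -z, y(xw) = z and w(xy) = -z. Adding products
    keeps the first correction intact, as products of two products vanish.\<close>
  define u2 where "u2 = u1 + a *s \<mu> y w - b *s \<mu> x w + c' *s \<mu> x y"
  have "\<mu> x u2 = 0" "\<mu> y u2 = 0" "\<mu> w u2 = 0"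
    by (simp_all add: u2_def s p abc')
  moreover have "\<mu> (\<mu> x y) u2 = 0" "\<mu> (\<mu> x w) u2 = 0" "\<mu> (\<mu> y w) u2 = 0"
    by (simp_all add: u2_def s q t(5))
  ultimately have u2: "\<mu> u2 x = 0" "\<mu> u2 y = 0" "\<mu> u2 w = 0" "\<mu> u2 (\<mu> x y) = 0"
    "\<mu> u2 (\<mu> x w) = 0" "\<mu> u2 (\<mu> y w) = 0"
    using dual_mock_lieD(2)[OF \<mu>, of u2] by simp_all
  have u0_eq2: "u0 = u2 - a *s \<mu> y w + b *s \<mu> x w - c' *s \<mu> x y + \<alpha> *s w - \<beta> *s y + \<gamma> *s x"
    by (simp add: u2_def u1_def)
  have "\<mu> u2 u0 = 0" unfolding u0_eq2 by (simp add: s u2 t(1))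
  then obtain k where "u2 = k *s ?z" using ann all0[OF u2] by blast
  then have "u0 = \<gamma> *s x + (- \<beta>) *s y + \<alpha> *s w + (- c') *s \<mu> x y + b *s \<mu> x w + (- a) *s \<mu> y w + k *s ?z"
    unfolding u0_eq2 by (simp add: vec_eq_iff)
  then show False using u0' by blast
qed

theorem three_step_orbit_D36:
  fixes \<mu> :: "8 product"
  assumes "\<mu> \<in> dual_mock_lie" "\<mu> (\<mu> x y) w \<noteq> 0"
  shows "\<mu> \<in> orbit D36"
  using annihilator_of_three_step[OF assms] orbit_D36_if_annihilator[OF assms] by blast

subsection \<open>Two-step algebras are isomorphic to block products\<close>

lemma matrix_mult_vec_expand:
  fixes h :: "complex^'n^'m"
  shows "h *v x = (\<Sum>i\<in>UNIV. x $ i *s (h *v e i))"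
  by (simp add: vec_eq_iff) (simp add: matrix_vector_mult_def mult.commute)

lemma det_uminus: "det (- A :: complex^'n^'n) = (-1) ^ CARD('n) * det A"
proof -
  have "- A = (\<chi> i. (-1) *s A $ i)" by (simp add: vec_eq_iff)
  then show ?thesis using det_rows_mul[of "\<lambda>i. -1" "\<lambda>i. A $ i"] by simp
qed

text \<open>A skew matrix of even size has no one-dimensional kernel: increasing and decreasing a diagonal
  entry give matrices with equal determinants, by transposition, so neither change is visible.\<close>

lemma even_skew_kernel:
  fixes M :: "complex^'n^'n"
  assumes "even CARD('n)" and skew: "\<And>i j. M $ i $ j = - M $ j $ i"
    and z: "M *v z = 0" "z $ p \<noteq> 0"
  shows "\<exists>x. M *v x = 0 \<and> (\<forall>c. x \<noteq> c *s z)"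
proof (rule ccontr)
  assume "\<not> ?thesis"
  then have ker: "\<exists>c. x = c *s z" if "M *v x = 0" for x using that by blast
  let ?W = "(\<chi> i. if i = p then M $ i + e p else M $ i)"
  let ?W' = "(\<chi> i. if i = p then M $ i + (-1) *s e p else M $ i)"
  let ?d = "det (\<chi> i. if i = p then e p else M $ i)"
  have M: "(\<chi> i. if i = p then M $ i else M $ i) = M" by (simp add: vec_eq_iff)
  have "\<not> (\<forall>x. M *v x = 0 \<longrightarrow> x = 0)" using z by (metis zero_index)
  then have "det M = 0"
    using invertible_det_nz[of M] invertible_left_inverse[of M] matrix_left_invertible_ker[of M] by blast
  then have d: "det ?W = ?d" "det ?W' = - ?d"
    unfolding det_row_add[of p "\<lambda>i. M $ i"] det_row_mul M by simp_all
  have "transpose ?W = - ?W'"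
    unfolding vec_eq_iff
  proof (intro allI)
    fix i j
    show "transpose ?W $ i $ j = (- ?W') $ i $ j"
      using skew[of j i] by (cases "i = p"; cases "j = p") (simp_all add: transpose_def axis_def)
  qed
  then have "det ?W = det (- ?W')" by (simp only: det_transpose[of ?W, symmetric])
  also have "\<dots> = det ?W'" unfolding det_uminus using assms(1) by simp
  finally have "det ?W = 0" using d by simp
  then have "\<not> (\<forall>x. ?W *v x = 0 \<longrightarrow> x = 0)"
    using invertible_det_nz[of ?W] invertible_left_inverse[of ?W] matrix_left_invertible_ker[of ?W] by blast
  then obtain x where x: "?W *v x = 0" "x \<noteq> 0" by blast
  have W: "(?W *v x) $ i = (M *v x) $ i + (if i = p then x $ p else 0)" for i
  proof -
    have "(\<Sum>j\<in>UNIV. e p $ j * x $ j) = (\<Sum>j\<in>UNIV. if j = p then x $ j else 0)"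
      by (rule sum.cong) (auto simp: axis_def)
    then show ?thesis by (simp add: matrix_vector_mult_def algebra_simps sum.distrib)
  qed
  \<comment> \<open>Since \<open>M\<close> is skew and kills \<open>z\<close>, pairing
    \<open>M *v x\<close> with \<open>z\<close> gives 0; pairing \<open>?W *v x = 0\<close> with
    \<open>z\<close> then leaves \<open>z $ p * x $ p = 0\<close>. So \<open>x\<close> is a nonzero
    kernel vector of \<open>M\<close> with \<open>x $ p = 0\<close>, which no nonzero multiple of
    \<open>z\<close> is.\<close>
  have "(\<Sum>i\<in>UNIV. z $ i * (M *v x) $ i) = (\<Sum>i\<in>UNIV. \<Sum>j\<in>UNIV. z $ i * (M $ i $ j * x $ j))"
    by (simp add: matrix_vector_mult_def sum_distrib_left)
  also have "\<dots> = (\<Sum>j\<in>UNIV. \<Sum>i\<in>UNIV. z $ i * (M $ i $ j * x $ j))" by (rule sum.swap)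
  also have "\<dots> = (\<Sum>j\<in>UNIV. x $ j * - (M *v z) $ j)"
    unfolding matrix_vector_mult_def vec_lambda_beta sum_negf[symmetric] sum_distrib_left
    by (intro sum.cong refl) (subst skew, simp)
  finally have "(\<Sum>i\<in>UNIV. z $ i * (M *v x) $ i) = 0" by (simp add: z)
  moreover have "(\<Sum>i\<in>UNIV. z $ i * (?W *v x) $ i) =
      (\<Sum>i\<in>UNIV. z $ i * (M *v x) $ i + (if i = p then z $ p * x $ p else 0))"
    unfolding W by (intro sum.cong) (auto simp: algebra_simps)
  ultimately have "z $ p * x $ p = 0" using x(1) by (simp add: sum.distrib)
  then have "x $ p = 0" using z(2) by simp
  then have "(M *v x) $ i = 0" for i using W[of i] x(1) by (cases "i = p") simp_all
  then have "M *v x = 0" by (simp add: vec_eq_iff)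
  then obtain c where "x = c *s z" using ker by blast
  then show False using \<open>x $ p = 0\<close> x(2) z(2) by auto
qed

text \<open>A basis of \<open>Z\<close> is extended to the whole space; the indices outside
  \<open>E\<close> number the part in \<open>Z\<close>.\<close>

lemma adapted_basis:
  fixes Z :: "(complex^'n) set"
  assumes "vec.subspace Z" "vec.dim Z = card (- E)"
  shows "\<exists>h :: complex^'n^'n. invertible h \<and> (\<forall>x. h *v x \<in> Z \<longleftrightarrow> coord_proj E *v x = 0)"
proof -
  obtain B where B: "finite B" "B \<subseteq> Z" "vec.independent B" "vec.span B = Z" "card B = vec.dim Z"
    using vec.basis_subspace_exists[OF assms(1)] by blast
  obtain B' where B': "B \<subseteq> B'" "vec.independent B'" "UNIV \<subseteq> vec.span B'"
    using vec.maximal_independent_subset_extend[of B UNIV] B(3) by auto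
  have "card B' = CARD('n)"
    using vec.basis_card_eq_dim[of B' UNIV] B' by (simp add: vec_dim_card del: vec.dim_UNIV)
  moreover have fin: "finite B'" using B'(2) vec.finiteI_independent by blast
  ultimately have card: "card (B' - B) = card E"
    using B(1,5) B'(1) assms(2) by (simp add: card_Diff_subset Compl_eq_Diff_UNIV)
      (metis card_mono diff_diff_cancel finite_class.finite_UNIV subset_UNIV)
  obtain f1 where f1: "bij_betw f1 (- E) B"
    using finite_same_card_bij[of "- E" B] B assms(2) by auto
  obtain f2 where f2: "bij_betw f2 E (B' - B)"
    using finite_same_card_bij[of E "B' - B"] card fin by auto
  define c where "c i = (if i \<in> E then f2 i else f1 i)" for i
  have "bij_betw c E (B' - B)" using f2 by (rule bij_betw_cong[THEN iffD1, rotated]) (simp add: c_def)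
  moreover have cB: "bij_betw c (- E) B" using f1 by (rule bij_betw_cong[THEN iffD1, rotated]) (simp add: c_def)
  ultimately have "bij_betw c (E \<union> - E) ((B' - B) \<union> B)" by (rule bij_betw_combine) auto
  then have bij: "bij_betw c UNIV B'" using B'(1) by (simp add: Un_absorb2)
  have "\<forall>i. a i = 0" if a: "(\<Sum>i\<in>UNIV. a i *s c i) = 0" for a
  proof
    fix i
    have inv: "the_inv_into UNIV c (c j) = j" for j
      using bij by (simp add: bij_betw_def the_inv_into_f_f)
    have "(\<Sum>v\<in>B'. a (the_inv_into UNIV c v) *s v) = (\<Sum>i\<in>UNIV. a i *s c i)"
      by (subst sum.reindex_bij_betw[OF bij, symmetric]) (simp add: inv)
    then have "a (the_inv_into UNIV c (c i)) = 0"
      using a bij by (intro vec.independentD[OF B'(2) fin subset_refl]) (auto simp: bij_betw_def)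
    then show "a i = 0" by (simp add: inv)
  qed
  then obtain h where h: "invertible h" "\<And>i. h *v e i = c i" "\<And>x. h *v x = (\<Sum>i\<in>UNIV. x $ i *s c i)"
    using invertible_columns[of c] by blast
  let ?S = "{x :: complex^'n. coord_proj E *v x = 0}"
  have 1: "h *v x \<in> Z" if "coord_proj E *v x = 0" for x
    unfolding h(3)
  proof (rule vec.subspace_sum[OF assms(1)])
    fix i
    show "x $ i *s c i \<in> Z"
    proof (cases "i \<in> E")
      case True
      then show ?thesis
        using arg_cong[OF that, of "\<lambda>v. v $ i"] vec.subspace_0[OF assms(1)]
        by (simp add: coord_proj_component)
    next
      case False
      then have "c i \<in> B" using cB by (auto simp: bij_betw_def)
      then show ?thesis using B(2) vec.subspace_scale[OF assms(1)] by blast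
    qed
  qed
  have "vec.subspace ?S" by (simp add: vec.subspace_def vec.add vec.scale)
  then have "vec.subspace ((*v) h ` ?S)" by (rule vec.subspace_image)
  moreover have "B \<subseteq> (*v) h ` ?S"
  proof
    fix v assume "v \<in> B"
    then obtain i where "i \<notin> E" "v = c i" using cB by (auto simp: bij_betw_def)
    then show "v \<in> (*v) h ` ?S" by (intro image_eqI[of _ _ "e i"]) (simp_all add: h(2) coord_proj_axis)
  qed
  ultimately have "Z \<subseteq> (*v) h ` ?S" using vec.span_minimal B(4) by blast
  then have 2: "coord_proj E *v x = 0" if "h *v x \<in> Z" for x
    using that inj_matrix_vector_mult[OF h(1)] by (auto simp: inj_def)
  show ?thesis using h(1) 1 2 by blast
qed

text \<open>Any \<open>Z\<close> between the values and the annihilator becomes the coordinate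
  subspace outside \<open>E\<close>; values in \<open>Z\<close> and trivial products with
  \<open>Z\<close> are then precisely the block conditions. The freedom in \<open>Z\<close> is what
  accommodates large annihilators.\<close>

lemma block_product_from_subspace:
  assumes \<mu>: "\<mu> \<in> dual_mock_lie" and Z: "vec.subspace Z" "vec.dim Z = card (- E)"
    and im: "\<And>x y. \<mu> x y \<in> Z" and ann: "\<And>u x. u \<in> Z \<Longrightarrow> \<mu> u x = 0"
  shows "\<exists>g. invertible g \<and> GL_action g \<mu> \<in> block_products E"
proof -
  note s = bilinear_product_simps[OF dual_mock_lieD(1)[OF \<mu>]]
  obtain h where h: "invertible h" "\<And>x. h *v x \<in> Z \<longleftrightarrow> coord_proj E *v x = 0"
    using adapted_basis[OF Z] by blast
  let ?\<nu> = "GL_action (matrix_inv h) \<mu>"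
  have inv: "matrix_inv (matrix_inv h) = h" using invertibleD[OF h(1)] by (intro matrix_inv_eq)
  have \<nu>: "?\<nu> \<in> dual_mock_lie" using dual_mock_lie_GL_action[OF \<mu>] invertibleD(3)[OF h(1)] .
  have 1: "coord_proj E *v ?\<nu> x y = 0" for x y
    using im h(1) by (simp add: GL_action_def flip: h(2))
  have 2: "?\<nu> (coord_proj E *v x) y = ?\<nu> x y" for x y
  proof -
    have "h *v (x - coord_proj E *v x) \<in> Z" unfolding h(2) by (simp add: vec.diff)
    from ann[OF this, of "h *v y"] show ?thesis by (simp add: GL_action_def inv vec.diff s)
  qed
  have "?\<nu> \<in> block_products E"
    unfolding block_products_def using dual_mock_lieD(1,2)[OF \<nu>] 1 2 by blast
  then show ?thesis using invertibleD(3)[OF h(1)] by blast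
qed

lemma subspace_between:
  fixes S T :: "(complex^'n) set"
  assumes "vec.subspace T" "S \<subseteq> T" "vec.dim S \<le> k" "k \<le> vec.dim T"
  obtains Z where "vec.subspace Z" "S \<subseteq> Z" "Z \<subseteq> T" "vec.dim Z = k"
proof -
  obtain B where B: "B \<subseteq> S" "vec.independent B" "S \<subseteq> vec.span B" "card B = vec.dim S"
    using vec.basis_exists by blast
  obtain B' where B': "B \<subseteq> B'" "B' \<subseteq> T" "vec.independent B'" "T \<subseteq> vec.span B'"
    using vec.maximal_independent_subset_extend[of B T] B assms(2) by blast
  have "card B' = vec.dim T" "finite B'"
    using vec.basis_card_eq_dim B' vec.finiteI_independent by blast+
  then obtain C where C: "B \<subseteq> C" "C \<subseteq> B'" "card C = k"
    using exists_subset_between[of B k B'] B'(1) B(4) assms(3,4) by auto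
  show thesis
  proof
    show "vec.subspace (vec.span C)" by (rule vec.subspace_span)
    show "S \<subseteq> vec.span C" using B(3) vec.span_mono[OF C(1)] by blast
    show "vec.span C \<subseteq> T" using C(2) B'(2) assms(1) by (intro vec.span_minimal) auto
    show "vec.dim (vec.span C) = k"
      using vec.dim_span_eq_card_independent[OF vec.independent_mono[OF B'(3) C(2)]] C(3) by simp
  qed
qed

text \<open>Annihilators of dimension 2, 3 or 4 serve as \<open>Z\<close> themselves. Smaller ones
  are excluded by parity, and for larger ones \<open>Z\<close> is inserted between the few products
  and the annihilator.\<close>

lemma two_step_block_product:
  fixes \<mu> :: "8 product"
  assumes \<mu>: "\<mu> \<in> dual_mock_lie" and two_step: "\<And>x y z. \<mu> (\<mu> x y) z = 0"
  shows "\<exists>E\<in>{{1,2,3,4,5,6}, {1,2,3,4,5}, {1,2,3,4}}. \<exists>g. invertible g \<and> GL_action g \<mu> \<in> block_products E"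
proof -
  note s = bilinear_product_simps[OF dual_mock_lieD(1)[OF \<mu>]]
  define Ann where "Ann = {u. \<forall>x. \<mu> u x = 0}"
  have Ann: "vec.subspace Ann" by (simp add: Ann_def vec.subspace_def s)
  have im: "\<mu> x y \<in> Ann" for x y using two_step by (simp add: Ann_def)
  have ann': "\<mu> x u = 0" if "u \<in> Ann" for u x
    using that dual_mock_lieD(2)[OF \<mu>, of x u] by (simp add: Ann_def)
  have card: "card (- {1,2,3,4,5,6 :: 8}) = 2" "card (- {1,2,3,4,5 :: 8}) = 3" "card (- {1,2,3,4 :: 8}) = 4"
    "card (- {1,2,3 :: 8}) = 5"
    by (simp_all add: card_Diff_subset Compl_eq_Diff_UNIV del: Diff_UNIV)
  have ge2: "vec.dim Ann \<ge> 2"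
  proof (rule ccontr)
    assume less: "\<not> 2 \<le> vec.dim Ann"
    have "\<exists>x y. \<mu> x y \<noteq> 0"
    proof (rule ccontr)
      assume "\<not> ?thesis"
      then have "Ann = UNIV" by (auto simp: Ann_def)
      then show False using less by (simp add: vec_dim_card del: vec.dim_UNIV)
    qed
    then obtain x0 y0 where z0: "\<mu> x0 y0 \<noteq> 0" by blast
    define z where "z = \<mu> x0 y0"
    have z: "z \<noteq> 0" "z \<in> Ann" using z0 im by (simp_all add: z_def)
    then obtain p where p: "z $ p \<noteq> 0" by (auto simp: vec_eq_iff)
    \<comment> \<open>All products are now multiples of \<open>z\<close>, so \<open>\<mu>\<close> is
      a skew form \<open>M\<close> on an even-dimensional space. Its kernel contains
      \<open>z\<close>, hence also a vector off that line, and this vector annihilates too.\<close>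
    have "Ann \<subseteq> vec.span {z}"
      using less z by (intro vec.card_ge_dim_independent) auto
    then have Annz: "\<exists>c. u = c *s z" if "u \<in> Ann" for u
      using that by (auto simp: vec.span_singleton)
    have coef: "\<mu> x y = (\<mu> x y $ p / z $ p) *s z" for x y
    proof -
      obtain c where "\<mu> x y = c *s z" using Annz im by blast
      then show ?thesis using p by simp
    qed
    define M :: "complex^8^8" where "M = (\<chi> i j. \<mu> (e i) (e j) $ p / z $ p)"
    have M: "(M *v x) $ i = \<mu> (e i) x $ p / z $ p" for x i
    proof -
      have "\<mu> (e i) (\<Sum>j\<in>UNIV. x $ j *s e j) $ p / z $ p = (\<Sum>j\<in>UNIV. x $ j * \<mu> (e i) (e j) $ p / z $ p)"
        unfolding s by (simp add: sum_divide_distrib)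
      then show ?thesis
        unfolding basis_expansion by (simp add: matrix_vector_mult_def M_def mult.commute)
    qed
    have skew: "M $ i $ j = - M $ j $ i" for i j
      using dual_mock_lieD(2)[OF \<mu>, of "e i" "e j"] by (simp add: M_def)
    have Mz: "M *v z = 0" by (simp add: vec_eq_iff M ann'[OF z(2)])
    have "\<exists>x. M *v x = 0 \<and> (\<forall>c. x \<noteq> c *s z)"
      by (rule even_skew_kernel[OF _ skew Mz p]) simp
    then obtain x where x: "M *v x = 0" "\<And>c. x \<noteq> c *s z" by blast
    have "\<mu> (e i) x = 0" for i
    proof -
      have "\<mu> (e i) x $ p / z $ p = 0" using M[of x i] x(1) by simp
      then show ?thesis by (subst coef) simp
    qed
    then have "\<mu> x (e i) = 0" for i using dual_mock_lieD(2)[OF \<mu>, of x "e i"] by simp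
    then have "\<mu> x (\<Sum>i\<in>UNIV. u $ i *s e i) = 0" for u unfolding s by simp
    then have "x \<in> Ann" unfolding basis_expansion Ann_def by blast
    then show False using Annz x(2) by blast
  qed
  show ?thesis
  proof (cases "vec.dim Ann \<le> 4")
    case True
    have "\<exists>g. invertible g \<and> GL_action g \<mu> \<in> block_products E" if "vec.dim Ann = card (- E)" for E
      using block_product_from_subspace[OF \<mu> Ann that im] by (simp add: Ann_def)
    moreover have "vec.dim Ann = 2 \<or> vec.dim Ann = 3 \<or> vec.dim Ann = 4" using True ge2 by linarith
    ultimately show ?thesis using card by (elim disjE) simp_all
  next
    case False
    have "vec.subspace Ann" "{} \<subseteq> Ann" "vec.dim ({} :: (complex^8) set) \<le> 5" "5 \<le> vec.dim Ann"
      using False Ann by auto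
    then obtain Z5 where Z5: "vec.subspace Z5" "Z5 \<subseteq> Ann" "vec.dim Z5 = 5"
      by (rule subspace_between)
    have "vec.dim Z5 = card (- {1,2,3 :: 8})" unfolding card(4) by (rule Z5(3))
    then obtain h :: "complex^8^8" where h: "invertible h" "\<And>x. h *v x \<in> Z5 \<longleftrightarrow> coord_proj {1,2,3} *v x = 0"
      using adapted_basis[OF Z5(1)] by blast
    let ?x = "h *v e 1" and ?y = "h *v e 2" and ?w = "h *v e 3"
    let ?A = "{\<mu> x y |x y. True}"
    have hE: "h *v e i \<in> Ann" if "i \<notin> {1,2,3}" for i
      using that Z5(2) h(2)[of "e i"] by (auto simp: coord_proj_axis)
    have mem: "\<mu> u v \<in> vec.span {\<mu> ?x ?y, \<mu> ?x ?w, \<mu> ?y ?w}" for u v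
    proof -
      let ?a = "matrix_inv h *v u" and ?b = "matrix_inv h *v v"
      have u: "u = (\<Sum>i\<in>UNIV. ?a $ i *s (h *v e i))" "v = (\<Sum>i\<in>UNIV. ?b $ i *s (h *v e i))"
        using matrix_mult_vec_expand[of h ?a] matrix_mult_vec_expand[of h ?b]
        unfolding matrix_inv_mult_vec(1)[OF h(1)] .
      have 0: "\<mu> (h *v e i) t = 0" "\<mu> t (h *v e i) = 0" if "i \<notin> {1,2,3}" for i t
        using hE[OF that] ann'[OF hE[OF that]] unfolding Ann_def by blast+
      have anti: "\<mu> ?y ?x = - \<mu> ?x ?y" "\<mu> ?w ?x = - \<mu> ?x ?w" "\<mu> ?w ?y = - \<mu> ?y ?w"
        by (rule dual_mock_lieD(2)[OF \<mu>])+
      have "\<mu> u v = \<mu> (\<Sum>i\<in>UNIV. ?a $ i *s (h *v e i)) (\<Sum>i\<in>UNIV. ?b $ i *s (h *v e i))"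
        by (rule arg_cong2[OF u])
      also have "\<dots> = (?a $ 1 * ?b $ 2 - ?a $ 2 * ?b $ 1) *s \<mu> ?x ?y
        + (?a $ 1 * ?b $ 3 - ?a $ 3 * ?b $ 1) *s \<mu> ?x ?w + (?a $ 2 * ?b $ 3 - ?a $ 3 * ?b $ 2) *s \<mu> ?y ?w"
        unfolding sum_8
        by (simp add: s 0 anti dual_mock_lie_triple(1)[OF \<mu>]) (simp add: vec_eq_iff algebra_simps)
      finally have uv: "\<mu> u v = (?a $ 1 * ?b $ 2 - ?a $ 2 * ?b $ 1) *s \<mu> ?x ?y
        + (?a $ 1 * ?b $ 3 - ?a $ 3 * ?b $ 1) *s \<mu> ?x ?w
        + (?a $ 2 * ?b $ 3 - ?a $ 3 * ?b $ 2) *s \<mu> ?y ?w" .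
      show ?thesis
        unfolding uv by (intro vec.span_add vec.span_scale vec.span_base insertI1 insertI2)
    qed
    then have "?A \<subseteq> vec.span {\<mu> ?x ?y, \<mu> ?x ?w, \<mu> ?y ?w}" by blast
    then have "vec.dim ?A \<le> card {\<mu> ?x ?y, \<mu> ?x ?w, \<mu> ?y ?w}" by (rule vec.dim_le_card) simp
    also have "\<dots> \<le> 4"
      by (rule order_trans[OF card_length[of "[\<mu> ?x ?y, \<mu> ?x ?w, \<mu> ?y ?w]", simplified]]) simp
    finally have "vec.dim ?A \<le> 4" .
    moreover have "?A \<subseteq> Ann" using im by blast
    moreover have "4 \<le> vec.dim Ann" using False by simp
    ultimately obtain Z where Z: "vec.subspace Z" "?A \<subseteq> Z" "Z \<subseteq> Ann" "vec.dim Z = 4"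
      using subspace_between[OF Ann, of ?A 4] by blast
    have "\<exists>g. invertible g \<and> GL_action g \<mu> \<in> block_products {1,2,3,4}"
      by (rule block_product_from_subspace[OF \<mu> Z(1)])
        (use Z card(3) in \<open>auto simp: Ann_def\<close>)
    then show ?thesis by blast
  qed
qed

subsection \<open>Excluding three-step algebras\<close>

text \<open>Every product with an element of the span of \<open>e 4, \<dots>, e 8\<close> lies in the line of \<open>e 8\<close>, and this span
  meets every subspace of codimension at most four.\<close>

lemma orbit_D36_thin:
  fixes \<mu> :: "8 product"
  assumes "\<mu> \<in> orbit D36"
  shows "\<exists>z. \<forall>R. card R \<le> 4 \<longrightarrow>
    (\<exists>u. u \<noteq> 0 \<and> (\<forall>i\<in>R. u $ i = 0) \<and> (\<forall>x. \<exists>c. \<mu> x u = c *s z))"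
proof -
  obtain g where g: "invertible g" "\<mu> = GL_action g D36" using assms by (auto simp: orbit_def)
  \<comment> \<open>The line, spanned by \<open>g *v e 8\<close>, is fixed before \<open>R\<close>,
    so that \<open>R\<close> may later depend on it. The vector \<open>u\<close> exists because
    dimensions 5 and at least 4 exceed 8 together.\<close>
  have "\<exists>u. u \<noteq> 0 \<and> (\<forall>i\<in>R. u $ i = 0) \<and> (\<forall>x. \<exists>c. \<mu> x u = c *s (g *v e 8))"
    if R: "card R \<le> 4" for R :: "8 set"
  proof -
    let ?K = "{a :: complex^8. \<forall>i. i \<notin> - {1,2,3} \<longrightarrow> a $ i = 0}"
    let ?S = "(*v) g ` ?K"
    let ?T = "{u :: complex^8. \<forall>i. i \<notin> - R \<longrightarrow> u $ i = 0}"
    have S0: "vec.subspace ?K" "vec.subspace ?T" by (simp_all add: vec.subspace_def)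
    then have S: "vec.subspace ?S" using vec.subspace_image by blast
    have "vec.dim ?S = vec.dim ?K"
      by (rule vec.dim_image_eq[OF matrix_vector_mul_linear_gen])
        (rule inj_on_subset[OF inj_matrix_vector_mult[OF g(1)] subset_UNIV])
    also have "\<dots> = 5"
      unfolding dim_substandard_cart by (simp add: card_Diff_subset Compl_eq_Diff_UNIV)
    finally have "vec.dim ?S = 5" .
    moreover have "vec.dim ?T \<ge> 4"
      unfolding dim_substandard_cart using R by (simp add: card_Diff_subset Compl_eq_Diff_UNIV)
    moreover have "vec.dim {x + y |x y. x \<in> ?S \<and> y \<in> ?T} \<le> 8"
      using vec.dim_subset_UNIV[of "{x + y |x y. x \<in> ?S \<and> y \<in> ?T}"]
      by (simp add: vec.dimension_def card_cart_basis)
    ultimately have "vec.dim (?S \<inter> ?T) \<noteq> 0"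
      using vec.dim_sums_Int[OF S S0(2)] by linarith
    then obtain u where u: "u \<in> ?S" "u \<in> ?T" "u \<noteq> 0" unfolding vec.dim_eq_0 by blast
    then obtain a where a: "u = g *v a" "a $ 1 = 0" "a $ 2 = 0" "a $ 3 = 0" by auto
    have "\<exists>c. \<mu> x u = c *s (g *v e 8)" for x
    proof -
      let ?b = "matrix_inv g *v x"
      have "\<exists>c. D36 ?b a = c *s e 8"
        by (rule exI[of _ "D36 ?b a $ 8"])
          (simp add: vec_eq_iff forall_8 D36_def table_product_def axis_component a)
      then obtain c where "D36 ?b a = c *s e 8" ..
      then show ?thesis using g(1) by (auto simp: g(2) a(1) GL_action_def vec.scale)
    qed
    then show ?thesis using u by blast
  qed
  then show ?thesis by blast
qed

text \<open>A three-step \<open>\<mu>\<close> has, for each small \<open>R\<close>, a nonzero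
  \<open>u\<close> vanishing on \<open>R\<close> with all products on the line of \<open>z\<close>.
  As \<open>R\<close> covers the complement of \<open>E\<close>, this \<open>u\<close> survives
  truncation, and the products \<open>D x u\<close> lie on the line of the part of \<open>z\<close>
  outside \<open>E\<close>; \<open>thin\<close> rules this out.\<close>

lemma two_step_if_truncation:
  fixes \<mu> D :: "8 product"
  assumes \<mu>: "\<mu> \<in> dual_mock_lie" and D: "block_truncation E \<mu> = D"
    and thin: "\<And>z. \<exists>R. - E \<subseteq> R \<and> card R \<le> 4 \<and>
      (\<forall>u. (\<forall>i\<in>R. u $ i = 0) \<longrightarrow> (\<forall>x. \<exists>c. D x u = c *s z) \<longrightarrow> u = 0)"
  shows "\<mu> (\<mu> x y) w = 0"
proof (rule ccontr)
  assume "\<mu> (\<mu> x y) w \<noteq> 0"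
  then have "\<mu> \<in> orbit D36" by (rule three_step_orbit_D36[OF \<mu>])
  from orbit_D36_thin[OF this] obtain z where z: "\<And>R. card R \<le> 4 \<Longrightarrow>
    \<exists>u. u \<noteq> 0 \<and> (\<forall>i\<in>R. u $ i = 0) \<and> (\<forall>x. \<exists>c. \<mu> x u = c *s z)" by blast
  obtain R where R: "- E \<subseteq> R" "card R \<le> 4"
    "\<And>u. (\<forall>i\<in>R. u $ i = 0) \<Longrightarrow> (\<forall>x. \<exists>c. D x u = c *s (z - coord_proj E *v z)) \<Longrightarrow> u = 0"
    using thin[of "z - coord_proj E *v z"] by blast
  obtain u where u: "u \<noteq> 0" "\<forall>i\<in>R. u $ i = 0" "\<forall>x. \<exists>c. \<mu> x u = c *s z" using z[OF R(2)] by blast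
  have Qu: "coord_proj E *v u = u" using u(2) R(1) by (auto simp: vec_eq_iff coord_proj_component)
  have "\<exists>c. D x u = c *s (z - coord_proj E *v z)" for x
  proof -
    obtain c where "\<mu> (coord_proj E *v x) u = c *s z" using u(3) by blast
    then have "D x u = c *s (z - coord_proj E *v z)"
      by (simp add: D[symmetric] block_truncation_def Qu vec.scale vec.scale_right_diff_distrib)
    then show ?thesis ..
  qed
  then show False using R(3)[OF u(2)] u(1) by blast
qed

text \<open>Collinearity with unknown scalars becomes polynomial: the 2 by 2 minors vanish.\<close>

lemma collinear_minor:
  fixes z :: "complex^'n"
  assumes "\<forall>x. \<exists>c. f x = c *s z"
  shows "f x $ k * f y $ l = f x $ l * f y $ k"
proof -
  obtain a b where "f x = a *s z" "f y = b *s z" using assms by blast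
  then show ?thesis by simp
qed

subsection \<open>The three two-step algebras\<close>

lemma table_product_block:
  assumes "\<And>i j v. (i, j, v) \<in> set T \<Longrightarrow> i \<in> E \<and> j \<in> E \<and> coord_proj E *v v = 0"
  shows "table_product T \<in> block_products E"
proof -
  have "(\<forall>x y. table_product T x y = - table_product T y x) \<and>
     (\<forall>x y. table_product T (coord_proj E *v x) y = table_product T x y) \<and>
     (\<forall>x y. coord_proj E *v table_product T x y = 0)"
    using assms
  proof (induction T)
    case Nil
    then show ?case by (simp add: table_product_def)
  next
    case (Cons t T)
    obtain i j v where t: "t = (i, j, v)" by (cases t)
    have 1: "table_product (t # T) x y = (x $ i * y $ j - x $ j * y $ i) *s v + table_product T x y" for x y
      by (simp add: table_product_def t)
    have IH: "\<And>x y. table_product T x y = - table_product T y x"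
      "\<And>x y. table_product T (coord_proj E *v x) y = table_product T x y"
      "\<And>x y. coord_proj E *v table_product T x y = 0"
    proof -
      have "i \<in> E \<and> j \<in> E \<and> coord_proj E *v v = 0" if "(i, j, v) \<in> set T" for i j v
        using Cons.prems[of i j v] that by simp
      from Cons.IH[OF this]
      show "\<And>x y. table_product T x y = - table_product T y x"
        "\<And>x y. table_product T (coord_proj E *v x) y = table_product T x y"
        "\<And>x y. coord_proj E *v table_product T x y = 0" by blast+
    qed
    have v: "i \<in> E" "j \<in> E" "coord_proj E *v v = 0" using Cons.prems[of i j v] by (auto simp: t)
    have "table_product (t # T) x y = - table_product (t # T) y x" for x y
      unfolding 1 IH(1)[of x y] by (simp add: vec_eq_iff algebra_simps)
    moreover have "table_product (t # T) (coord_proj E *v x) y = table_product (t # T) x y" for x y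
      unfolding 1 by (simp add: IH(2) v coord_proj_component)
    moreover have "coord_proj E *v table_product (t # T) x y = 0" for x y
      unfolding 1 by (simp add: vec.add vec.diff vec.scale IH(3) v)
    ultimately show ?case by blast
  qed
  then show ?thesis unfolding block_products_def using table_product_bilinear by blast
qed

lemma tangent_action_skew:
  assumes "D \<in> block_products E"
  shows "tangent_action D X j i k = - tangent_action D X i j k"
proof -
  note c = block_products_component(1)[OF assms]
  have "X $ p $ j * structure_constant p i k D + X $ p $ i * structure_constant j p k D
      + X $ k $ p * structure_constant j i p D = - (X $ p $ i * structure_constant p j k D
      + X $ p $ j * structure_constant i p k D + X $ k $ p * structure_constant i j p D)" for p
    using c[of p i k] c[of p j k] c[of i j p] by simp
  then show ?thesis unfolding tangent_action_def by (simp only: sum_negf)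
qed

text \<open>Skewness in \<open>i\<close>, \<open>j\<close> reduces the equations to one orientation
  of each pair, listed in \<open>P\<close>.\<close>

lemma tangent_action_surjI:
  assumes "D \<in> block_products E" "\<And>i j k. b i j k = - b j i k"
    and "\<forall>i\<in>E. \<forall>j\<in>E. i = j \<or> (i, j) \<in> P \<or> (j, i) \<in> P"
    and "\<forall>(i, j)\<in>P. \<forall>k\<in>-E. tangent_action D X i j k = b i j k"
  shows "\<exists>X. \<forall>i\<in>E. \<forall>j\<in>E. \<forall>k\<in>-E. tangent_action D X i j k = b i j k"
proof (intro exI[of _ X] ballI)
  fix i j k assume ijk: "i \<in> E" "j \<in> E" "k \<in> - E"
  then consider "i = j" | "(i, j) \<in> P" | "(j, i) \<in> P" using assms(3) by blast
  then show "tangent_action D X i j k = b i j k"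
  proof cases
    case 1
    then show ?thesis
      using tangent_action_skew[OF assms(1), of X i i k] assms(2)[of i i k]
      by (simp add: equal_neg_zero)
  next
    case 2
    then show ?thesis using assms(4) ijk by blast
  next
    case 3
    then have "tangent_action D X j i k = b j i k" using assms(4) ijk by blast
    then show ?thesis
      using tangent_action_skew[OF assms(1), of X i j k] assms(2)[of i j k] by simp
  qed
qed

lemma Compl_6: "- {1,2,3,4,5,6} = ({7,8} :: 8 set)"
  unfolding Compl_eq_Diff_UNIV UNIV_8 by (simp add: insert_Diff_if)

lemma D17_block: "D17 \<in> block_products {1,2,3,4,5,6}"
  unfolding D17_def by (rule table_product_block) (auto simp: coord_proj_axis vec.add vec.neg)

lemma D17_component: "D17 x y $ k = (if k = 7 then (x $ 1 * y $ 2 - x $ 2 * y $ 1) + (x $ 5 * y $ 6 - x $ 6 * y $ 5) else if k = 8 then (x $ 3 * y $ 4 - x $ 4 * y $ 3) + (x $ 5 * y $ 6 - x $ 6 * y $ 5) else 0)"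
  by (simp add: D17_def table_product_def axis_component)

lemma D17_tangent:
  assumes "\<And>i j k. b i j k = - b j i k"
  shows "\<exists>X. \<forall>i\<in>{1,2,3,4,5,6}. \<forall>j\<in>{1,2,3,4,5,6}. \<forall>k\<in>- {1,2,3,4,5,6}. tangent_action D17 X i j k = b i j k"
proof (rule tangent_action_surjI[OF D17_block assms, where P = "{(1, 2), (1, 3), (1, 4), (1, 5), (1, 6), (2, 3), (2, 4), (2, 5), (2, 6), (3, 4), (3, 5), (3, 6), (4, 5), (4, 6), (5, 6)}"])
  \<comment> \<open>One solution of 30 linear equations in the 36 + 4 entries of the diagonal
    blocks. For indices from two different pairs among {1,2}, {3,4}, {5,6} the equations decouple
    into small triangular systems; the three pairs themselves are met by diagonal entries and the
    lower block.\<close>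
  let ?X = "(\<chi> p q.
      if p = 1 then (if q = 1 then b 1 2 7 + b 3 4 7 - b 5 6 7 else if q = 3 then - b 2 3 7 else if q = 4 then - b 2 4 7 else if q = 5 then - b 2 5 7 + b 2 5 8 else if q = 6 then - b 2 6 7 + b 2 6 8 else 0)
      else if p = 2 then (if q = 3 then b 1 3 7 else if q = 4 then b 1 4 7 else if q = 5 then b 1 5 7 - b 1 5 8 else if q = 6 then b 1 6 7 - b 1 6 8 else 0)
      else if p = 3 then (if q = 1 then b 1 4 8 else if q = 2 then b 2 4 8 else if q = 3 then b 1 2 8 + b 3 4 8 - b 5 6 8 else if q = 5 then b 4 5 7 - b 4 5 8 else if q = 6 then b 4 6 7 - b 4 6 8 else 0)
      else if p = 4 then (if q = 1 then - b 1 3 8 else if q = 2 then - b 2 3 8 else if q = 5 then - b 3 5 7 + b 3 5 8 else if q = 6 then - b 3 6 7 + b 3 6 8 else 0)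
      else if p = 5 then (if q = 1 then b 1 6 8 else if q = 2 then b 2 6 8 else if q = 3 then b 3 6 7 else if q = 4 then b 4 6 7 else 0)
      else if p = 6 then (if q = 1 then - b 1 5 8 else if q = 2 then - b 2 5 8 else if q = 3 then - b 3 5 7 else if q = 4 then - b 4 5 7 else 0)
      else if p = 7 then (if q = 7 then - b 3 4 7 + b 5 6 7 else if q = 8 then b 3 4 7 else 0)
      else if p = 8 then (if q = 7 then b 1 2 8 else if q = 8 then - b 1 2 8 + b 5 6 8 else 0)
      else 0)"
  show "\<forall>(i, j)\<in>{(1, 2), (1, 3), (1, 4), (1, 5), (1, 6), (2, 3), (2, 4), (2, 5), (2, 6), (3, 4), (3, 5), (3, 6), (4, 5), (4, 6), (5, 6)}. \<forall>k\<in>- {1,2,3,4,5,6}. tangent_action D17 ?X i j k = b i j k"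
    unfolding Compl_6 tangent_action_def structure_constant_def D17_component sum_8
    by (simp add: axis_component)
  show "\<forall>i\<in>{1,2,3,4,5,6}. \<forall>j\<in>{1,2,3,4,5,6}. i = j \<or> (i, j) \<in> {(1, 2), (1, 3), (1, 4), (1, 5), (1, 6), (2, 3), (2, 4), (2, 5), (2, 6), (3, 4), (3, 5), (3, 6), (4, 5), (4, 6), (5, 6)} \<or> (j, i) \<in> {(1, 2), (1, 3), (1, 4), (1, 5), (1, 6), (2, 3), (2, 4), (2, 5), (2, 6), (3, 4), (3, 5), (3, 6), (4, 5), (4, 6), (5, 6)}"
    by simp
qed

lemma D17_lift: "k \<notin> {1,2,3,4,5,6} \<Longrightarrow> \<exists>i\<in>{1,2,3,4,5,6}. \<exists>j\<in>{1,2,3,4,5,6}. D17 (e i) (e j) = e k"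
proof -
  have "D17 (e 1) (e 2) = e 7" "D17 (e 3) (e 4) = e 8" by (simp_all add: vec_eq_iff forall_8 D17_component axis_component)
  moreover assume "k \<notin> {1,2,3,4,5,6}"
  then have "k \<in> {7,8}" unfolding Compl_6[symmetric] by simp
  ultimately show ?thesis by auto
qed

lemma Compl_5: "- {1,2,3,4,5} = ({6,7,8} :: 8 set)"
  unfolding Compl_eq_Diff_UNIV UNIV_8 by (simp add: insert_Diff_if)

lemma D30_block: "D30 \<in> block_products {1,2,3,4,5}"
  unfolding D30_def by (rule table_product_block) (auto simp: coord_proj_axis vec.add vec.neg)

lemma D30_component: "D30 x y $ k = (if k = 6 then (x $ 1 * y $ 2 - x $ 2 * y $ 1) + (x $ 4 * y $ 5 - x $ 5 * y $ 4) else if k = 7 then (x $ 1 * y $ 3 - x $ 3 * y $ 1) + (x $ 2 * y $ 5 - x $ 5 * y $ 2) else if k = 8 then (x $ 2 * y $ 3 - x $ 3 * y $ 2) + (x $ 1 * y $ 4 - x $ 4 * y $ 1) else 0)"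
  by (simp add: D30_def table_product_def axis_component)

lemma D30_tangent:
  assumes "\<And>i j k. b i j k = - b j i k"
  shows "\<exists>X. \<forall>i\<in>{1,2,3,4,5}. \<forall>j\<in>{1,2,3,4,5}. \<forall>k\<in>- {1,2,3,4,5}. tangent_action D30 X i j k = b i j k"
proof (rule tangent_action_surjI[OF D30_block assms, where P = "{(1, 2), (1, 3), (1, 4), (1, 5), (2, 3), (2, 4), (2, 5), (3, 4), (3, 5), (4, 5)}"])
  \<comment> \<open>One solution of the 30 linear equations (ten pairs, three values of
    \<open>k\<close>) in the 25 + 9 entries of the diagonal blocks; entries outside these blocks
    meet only vanishing structure constants.\<close>
  let ?X = "(\<chi> p q.
      if p = 1 then (if q = 1 then b 1 2 6 / 2 + b 1 3 7 / 2 + b 1 4 8 - b 2 3 8 / 2 - b 4 5 6 else if q = 2 then - b 1 4 7 / 2 + b 2 3 7 / 2 + b 2 4 8 / 2 + b 3 4 6 / 2 else if q = 3 then b 3 4 8 else if q = 4 then - b 3 4 7 else 0)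
      else if p = 2 then (if q = 1 then b 1 3 8 / 2 + b 1 5 7 / 2 - b 2 5 8 / 2 - b 3 5 6 / 2 else if q = 2 then b 1 2 6 / 2 - b 1 3 7 / 2 + b 2 3 8 / 2 + b 2 5 7 else if q = 3 then b 3 5 7 else if q = 5 then - b 3 5 8 else 0)
      else if p = 3 then (if q = 1 then - b 1 2 8 - b 1 3 6 + b 2 5 6 + b 3 5 7 + b 4 5 8 else if q = 2 then b 1 2 7 - b 1 4 6 + b 2 3 6 + b 3 4 8 - b 4 5 7 else if q = 3 then b 1 3 7 / 2 + b 2 3 8 / 2 else if q = 4 then b 1 4 7 / 2 - b 2 3 7 / 2 + b 2 4 8 / 2 - b 3 4 6 / 2 else if q = 5 then - b 1 3 8 / 2 + b 1 5 7 / 2 + b 2 5 8 / 2 + b 3 5 6 / 2 else 0)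
      else if p = 4 then (if q = 1 then b 1 5 6 + b 3 5 8 else if q = 2 then - b 1 3 6 + b 2 5 6 + b 3 5 7 else if q = 3 then b 3 5 6 else if q = 4 then - b 1 3 7 / 2 + b 2 3 8 / 2 + b 2 5 7 + b 4 5 6 else if q = 5 then b 1 5 8 else 0)
      else if p = 5 then (if q = 1 then - b 1 4 6 + b 2 3 6 + b 3 4 8 else if q = 2 then - b 2 4 6 + b 3 4 7 else if q = 3 then - b 3 4 6 else if q = 4 then b 2 4 7 else if q = 5 then b 1 3 7 / 2 + b 1 4 8 - b 2 3 8 / 2 - b 4 5 6 else 0)
      else if p = 6 then (if q = 6 then - b 1 4 8 - b 2 5 7 + b 4 5 6 else if q = 7 then b 1 3 6 - b 3 5 7 else if q = 8 then b 2 3 6 + b 3 4 8 else 0)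
      else if p = 7 then (if q = 6 then b 4 5 7 else if q = 7 then - b 1 2 6 / 2 - b 1 4 8 + b 4 5 6 else if q = 8 then b 1 4 7 / 2 + b 2 3 7 / 2 - b 2 4 8 / 2 + b 3 4 6 / 2 else 0)
      else if p = 8 then (if q = 6 then b 4 5 8 else if q = 7 then b 1 3 8 / 2 - b 1 5 7 / 2 + b 2 5 8 / 2 - b 3 5 6 / 2 else if q = 8 then - b 1 2 6 / 2 - b 2 5 7 else 0)
      else 0)"
  show "\<forall>(i, j)\<in>{(1, 2), (1, 3), (1, 4), (1, 5), (2, 3), (2, 4), (2, 5), (3, 4), (3, 5), (4, 5)}. \<forall>k\<in>- {1,2,3,4,5}. tangent_action D30 ?X i j k = b i j k"
    unfolding Compl_5 tangent_action_def structure_constant_def D30_component sum_8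
    by (simp add: axis_component)
  show "\<forall>i\<in>{1,2,3,4,5}. \<forall>j\<in>{1,2,3,4,5}. i = j \<or> (i, j) \<in> {(1, 2), (1, 3), (1, 4), (1, 5), (2, 3), (2, 4), (2, 5), (3, 4), (3, 5), (4, 5)} \<or> (j, i) \<in> {(1, 2), (1, 3), (1, 4), (1, 5), (2, 3), (2, 4), (2, 5), (3, 4), (3, 5), (4, 5)}"
    by simp
qed

lemma D30_lift: "k \<notin> {1,2,3,4,5} \<Longrightarrow> \<exists>i\<in>{1,2,3,4,5}. \<exists>j\<in>{1,2,3,4,5}. D30 (e i) (e j) = e k"
proof -
  have "D30 (e 1) (e 2) = e 6" "D30 (e 1) (e 3) = e 7" "D30 (e 2) (e 3) = e 8" by (simp_all add: vec_eq_iff forall_8 D30_component axis_component)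
  moreover assume "k \<notin> {1,2,3,4,5}"
  then have "k \<in> {6,7,8}" unfolding Compl_5[symmetric] by simp
  ultimately show ?thesis by auto
qed

lemma Compl_4: "- {1,2,3,4} = ({5,6,7,8} :: 8 set)"
  unfolding Compl_eq_Diff_UNIV UNIV_8 by (simp add: insert_Diff_if)

lemma D33_block: "D33 \<in> block_products {1,2,3,4}"
  unfolding D33_def by (rule table_product_block) (auto simp: coord_proj_axis vec.add vec.neg)

lemma D33_component: "D33 x y $ k = (if k = 5 then (x $ 1 * y $ 2 - x $ 2 * y $ 1) else if k = 6 then (x $ 2 * y $ 3 - x $ 3 * y $ 2) else if k = 7 then (x $ 3 * y $ 4 - x $ 4 * y $ 3) else if k = 8 then (x $ 4 * y $ 1 - x $ 1 * y $ 4) else 0)"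
  by (simp add: D33_def table_product_def axis_component)

lemma D33_tangent:
  assumes "\<And>i j k. b i j k = - b j i k"
  shows "\<exists>X. \<forall>i\<in>{1,2,3,4}. \<forall>j\<in>{1,2,3,4}. \<forall>k\<in>- {1,2,3,4}. tangent_action D33 X i j k = b i j k"
proof (rule tangent_action_surjI[OF D33_block assms, where P = "{(1, 2), (1, 3), (1, 4), (2, 3), (2, 4), (3, 4)}"])
  \<comment> \<open>The products on the 4-cycle 1, 2, 3, 4 are independent, so the lower block alone
    solves the equations for neighbours. The listed entries of the upper block, which join
    neighbours, affect only the diagonals (1,3) and (2,4) and solve those.\<close>
  let ?X = "(\<chi> p q.
      if p = 1 then (if q = 2 then - b 2 4 8 else if q = 4 then - b 2 4 5 else 0)
      else if p = 2 then (if q = 1 then b 1 3 6 else if q = 3 then b 1 3 5 else 0)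
      else if p = 3 then (if q = 2 then b 2 4 7 else if q = 4 then b 2 4 6 else 0)
      else if p = 4 then (if q = 1 then - b 1 3 7 else if q = 3 then - b 1 3 8 else 0)
      else if p = 5 then (if q = 5 then b 1 2 5 else if q = 6 then b 2 3 5 else if q = 7 then b 3 4 5 else if q = 8 then - b 1 4 5 else 0)
      else if p = 6 then (if q = 5 then b 1 2 6 else if q = 6 then b 2 3 6 else if q = 7 then b 3 4 6 else if q = 8 then - b 1 4 6 else 0)
      else if p = 7 then (if q = 5 then b 1 2 7 else if q = 6 then b 2 3 7 else if q = 7 then b 3 4 7 else if q = 8 then - b 1 4 7 else 0)
      else if p = 8 then (if q = 5 then b 1 2 8 else if q = 6 then b 2 3 8 else if q = 7 then b 3 4 8 else if q = 8 then - b 1 4 8 else 0)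
      else 0)"
  show "\<forall>(i, j)\<in>{(1, 2), (1, 3), (1, 4), (2, 3), (2, 4), (3, 4)}. \<forall>k\<in>- {1,2,3,4}. tangent_action D33 ?X i j k = b i j k"
    unfolding Compl_4 tangent_action_def structure_constant_def D33_component sum_8
    by (simp add: axis_component)
  show "\<forall>i\<in>{1,2,3,4}. \<forall>j\<in>{1,2,3,4}. i = j \<or> (i, j) \<in> {(1, 2), (1, 3), (1, 4), (2, 3), (2, 4), (3, 4)} \<or> (j, i) \<in> {(1, 2), (1, 3), (1, 4), (2, 3), (2, 4), (3, 4)}"
    by simp
qed

lemma D33_lift: "k \<notin> {1,2,3,4} \<Longrightarrow> \<exists>i\<in>{1,2,3,4}. \<exists>j\<in>{1,2,3,4}. D33 (e i) (e j) = e k"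
proof -
  have "D33 (e 1) (e 2) = e 5" "D33 (e 2) (e 3) = e 6" "D33 (e 3) (e 4) = e 7" "D33 (e 4) (e 1) = e 8" by (simp_all add: vec_eq_iff forall_8 D33_component axis_component)
  moreover assume "k \<notin> {1,2,3,4}"
  then have "k \<in> {5,6,7,8}" unfolding Compl_4[symmetric] by simp
  ultimately show ?thesis by auto
qed

section \<open>Trivial radicals and the absence of thin vectors\<close>

lemma D17_radical:
  assumes "coord_proj {1,2,3,4,5,6} *v u = u" "\<forall>i\<in>{1,2,3,4,5,6}. D17 u (e i) = 0"
  shows "u = 0"
proof -
  have 1: "u $ 7 = 0" "u $ 8 = 0"
    using arg_cong[OF assms(1), of "\<lambda>v. v $ 7"] arg_cong[OF assms(1), of "\<lambda>v. v $ 8"]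
    by (simp_all add: coord_proj_component)
  have 2: "D17 u (e i) $ k = 0" if "i \<in> {1,2,3,4,5,6}" for i k
    using assms(2) that by (metis zero_index)
  show ?thesis
    using 2[of 1 7] 2[of 2 7] 2[of 3 8] 2[of 4 8] 2[of 5 7] 2[of 6 7] 1
    by (simp add: D17_component axis_component vec_eq_iff forall_8)
qed

lemma D30_radical:
  assumes "coord_proj {1,2,3,4,5} *v u = u" "\<forall>i\<in>{1,2,3,4,5}. D30 u (e i) = 0"
  shows "u = 0"
proof -
  have 1: "u $ 6 = 0" "u $ 7 = 0" "u $ 8 = 0"
    using arg_cong[OF assms(1), of "\<lambda>v. v $ 6"] arg_cong[OF assms(1), of "\<lambda>v. v $ 7"]
      arg_cong[OF assms(1), of "\<lambda>v. v $ 8"]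
    by (simp_all add: coord_proj_component)
  have 2: "D30 u (e i) $ k = 0" if "i \<in> {1,2,3,4,5}" for i k
    using assms(2) that by (metis zero_index)
  show ?thesis
    using 2[of 1 6] 2[of 1 7] 2[of 1 8] 2[of 2 6] 2[of 2 7] 1
    by (simp add: D30_component axis_component vec_eq_iff forall_8)
qed

lemma D33_radical:
  assumes "coord_proj {1,2,3,4} *v u = u" "\<forall>i\<in>{1,2,3,4}. D33 u (e i) = 0"
  shows "u = 0"
proof -
  have 1: "u $ 5 = 0" "u $ 6 = 0" "u $ 7 = 0" "u $ 8 = 0"
    using arg_cong[OF assms(1), of "\<lambda>v. v $ 5"] arg_cong[OF assms(1), of "\<lambda>v. v $ 6"]
      arg_cong[OF assms(1), of "\<lambda>v. v $ 7"] arg_cong[OF assms(1), of "\<lambda>v. v $ 8"]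
    by (simp_all add: coord_proj_component)
  have 2: "D33 u (e i) $ k = 0" if "i \<in> {1,2,3,4}" for i k
    using assms(2) that by (metis zero_index)
  show ?thesis
    using 2[of 1 5] 2[of 1 8] 2[of 2 5] 2[of 2 6] 1
    by (simp add: D33_component axis_component vec_eq_iff forall_8)
qed

text \<open>\<open>R\<close> has two coordinates to spare beyond 7 and 8, chosen according to
  \<open>z\<close>. If \<open>z $ 8 = 0\<close>, the form in coordinate 8 must vanish on
  \<open>u\<close>, and it is nondegenerate on the span of e3, ..., e6; \<open>z $ 7 = 0\<close> is
  symmetric. If neither is zero, \<open>u\<close> is confined to e1, ..., e4, where multiplying by
  e1, e2 gives multiples of e7 and by e3, e4 multiples of e8, none of them on the line of
  \<open>z\<close> unless zero.\<close>

lemma D17_thin: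
  "\<exists>R. - {1,2,3,4,5,6} \<subseteq> R \<and> card R \<le> 4 \<and>
    (\<forall>u. (\<forall>i\<in>R. u $ i = 0) \<longrightarrow> (\<forall>x. \<exists>c. D17 x u = c *s z) \<longrightarrow> u = 0)"
proof -
  have zero: "D17 x u $ k = 0" if "\<forall>x. \<exists>c. D17 x u = c *s z" "z $ k = 0" for x u k
    using that by (metis mult_zero_right vector_smult_component)
  have zero': "D17 x u = 0" if "\<forall>x. \<exists>c. D17 x u = c *s z" "D17 x u $ k = 0" "z $ k \<noteq> 0" for x u k
    using that by (metis mult_eq_0_iff vector_mul_eq_0 vector_smult_component)
  consider "z $ 8 = 0" | "z $ 7 = 0" | "z $ 7 \<noteq> 0" "z $ 8 \<noteq> 0" by blast
  then show ?thesis
  proof cases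
    case 1
    have "u = 0" if "\<forall>i\<in>{1,2,7,8}. u $ i = 0" "\<forall>x. \<exists>c. D17 x u = c *s z" for u
      using that(1) zero[OF that(2) 1, of "e 3"] zero[OF that(2) 1, of "e 4"]
        zero[OF that(2) 1, of "e 5"] zero[OF that(2) 1, of "e 6"]
      by (simp add: D17_component axis_component vec_eq_iff forall_8)
    then show ?thesis unfolding Compl_6 by (intro exI[of _ "{1,2,7,8}"]) simp
  next
    case 2
    have "u = 0" if "\<forall>i\<in>{3,4,7,8}. u $ i = 0" "\<forall>x. \<exists>c. D17 x u = c *s z" for u
      using that(1) zero[OF that(2) 2, of "e 1"] zero[OF that(2) 2, of "e 2"]
        zero[OF that(2) 2, of "e 5"] zero[OF that(2) 2, of "e 6"]
      by (simp add: D17_component axis_component vec_eq_iff forall_8)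
    then show ?thesis unfolding Compl_6 by (intro exI[of _ "{3,4,7,8}"]) simp
  next
    case 3
    have "u = 0" if u: "\<forall>i\<in>{5,6,7,8}. u $ i = 0" "\<forall>x. \<exists>c. D17 x u = c *s z" for u
    proof -
      have a: "D17 (e i) u = 0" if "i \<in> {1,2}" for i
        by (rule zero'[OF u(2) _ 3(2)]) (use that in \<open>auto simp: D17_component axis_component\<close>)
      have b: "D17 (e i) u = 0" if "i \<in> {3,4}" for i
        by (rule zero'[OF u(2) _ 3(1)]) (use that in \<open>auto simp: D17_component axis_component\<close>)
      show ?thesis
        using u(1) arg_cong[OF a[of 1], of "\<lambda>v. v $ 7"] arg_cong[OF a[of 2], of "\<lambda>v. v $ 7"]
          arg_cong[OF b[of 3], of "\<lambda>v. v $ 8"] arg_cong[OF b[of 4], of "\<lambda>v. v $ 8"]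
        by (simp add: D17_component axis_component vec_eq_iff forall_8)
    qed
    then show ?thesis unfolding Compl_6 by (intro exI[of _ "{5,6,7,8}"]) simp
  qed
qed

lemma D30_thin:
  "\<exists>R. - {1,2,3,4,5} \<subseteq> R \<and> card R \<le> 4 \<and>
    (\<forall>u. (\<forall>i\<in>R. u $ i = 0) \<longrightarrow> (\<forall>x. \<exists>c. D30 x u = c *s z) \<longrightarrow> u = 0)"
proof -
  have "u = 0" if u: "\<forall>i\<in>{6,7,8}. u $ i = 0" "\<forall>x. \<exists>c. D30 x u = c *s z" for u
  proof -
    note m = collinear_minor[OF u(2)]
    \<comment> \<open>Each minor is picked so that, given the coordinates already known to vanish,
      it reduces to the square of one coordinate up to sign.\<close>
    have u1: "u $ 1 = 0" using m[of "e 3" 7 "e 4" 8] by (simp add: D30_component axis_component)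
    have u2: "u $ 2 = 0" using m[of "e 3" 7 "e 5" 8] by (simp add: D30_component axis_component u1)
    have u4: "u $ 4 = 0" using m[of "e 1" 6 "e 5" 8] by (simp add: D30_component axis_component u1 u2)
    have u5: "u $ 5 = 0" using m[of "e 2" 6 "e 4" 7] by (simp add: D30_component axis_component u1 u2)
    have u3: "u $ 3 = 0" using m[of "e 1" 7 "e 2" 8] by (simp add: D30_component axis_component u1 u2 u4 u5)
    show ?thesis using u(1) u1 u2 u3 u4 u5 by (simp add: vec_eq_iff forall_8)
  qed
  then show ?thesis unfolding Compl_5 by (intro exI[of _ "{6,7,8}"]) simp
qed

lemma D33_thin:
  "\<exists>R. - {1,2,3,4} \<subseteq> R \<and> card R \<le> 4 \<and>
    (\<forall>u. (\<forall>i\<in>R. u $ i = 0) \<longrightarrow> (\<forall>x. \<exists>c. D33 x u = c *s z) \<longrightarrow> u = 0)"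
proof -
  have "u = 0" if u: "\<forall>i\<in>{5,6,7,8}. u $ i = 0" "\<forall>x. \<exists>c. D33 x u = c *s z" for u
  proof -
    note m = collinear_minor[OF u(2)]
    have "u $ 2 = 0" using m[of "e 1" 5 "e 3" 6] by (simp add: D33_component axis_component)
    moreover have "u $ 4 = 0" using m[of "e 1" 8 "e 3" 7] by (simp add: D33_component axis_component)
    moreover have "u $ 1 = 0" using m[of "e 2" 5 "e 4" 8] by (simp add: D33_component axis_component)
    moreover have "u $ 3 = 0" using m[of "e 2" 6 "e 4" 7] by (simp add: D33_component axis_component)
    ultimately show ?thesis using u(1) by (simp add: vec_eq_iff forall_8)
  qed
  then show ?thesis unfolding Compl_4 by (intro exI[of _ "{5,6,7,8}"]) simp
qed

lemma rigid_D17: "rigid D17 \<and> block_products {1,2,3,4,5,6} \<subseteq> zariski closure_of orbit D17"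
proof (rule rigid_block_product[OF D17_block])
  show "\<exists>X. \<forall>i\<in>{1,2,3,4,5,6}. \<forall>j\<in>{1,2,3,4,5,6}. \<forall>k\<in>- {1,2,3,4,5,6}. tangent_action D17 X i j k = b i j k"
    if "\<And>i j k. b i j k = - b j i k" for b using that by (rule D17_tangent)
  show "\<mu> (\<mu> x y) z = 0" if "\<mu> \<in> dual_mock_lie" "block_truncation {1,2,3,4,5,6} \<mu> = D17" for \<mu> x y z
    using that D17_thin by (rule two_step_if_truncation)
qed (rule D17_radical D17_lift; assumption)+

lemma rigid_D30: "rigid D30 \<and> block_products {1,2,3,4,5} \<subseteq> zariski closure_of orbit D30"
proof (rule rigid_block_product[OF D30_block])
  show "\<exists>X. \<forall>i\<in>{1,2,3,4,5}. \<forall>j\<in>{1,2,3,4,5}. \<forall>k\<in>- {1,2,3,4,5}. tangent_action D30 X i j k = b i j k"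
    if "\<And>i j k. b i j k = - b j i k" for b using that by (rule D30_tangent)
  show "\<mu> (\<mu> x y) z = 0" if "\<mu> \<in> dual_mock_lie" "block_truncation {1,2,3,4,5} \<mu> = D30" for \<mu> x y z
    using that D30_thin by (rule two_step_if_truncation)
qed (rule D30_radical D30_lift; assumption)+

lemma rigid_D33: "rigid D33 \<and> block_products {1,2,3,4} \<subseteq> zariski closure_of orbit D33"
proof (rule rigid_block_product[OF D33_block])
  show "\<exists>X. \<forall>i\<in>{1,2,3,4}. \<forall>j\<in>{1,2,3,4}. \<forall>k\<in>- {1,2,3,4}. tangent_action D33 X i j k = b i j k"
    if "\<And>i j k. b i j k = - b j i k" for b using that by (rule D33_tangent)
  show "\<mu> (\<mu> x y) z = 0" if "\<mu> \<in> dual_mock_lie" "block_truncation {1,2,3,4} \<mu> = D33" for \<mu> x y z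
    using that D33_thin by (rule two_step_if_truncation)
qed (rule D33_radical D33_lift; assumption)+

subsection \<open>The algebra D36 and the conclusion\<close>

lemma D36_dual_mock_lie: "D36 \<in> dual_mock_lie"
proof -
  have "D36 x y = - D36 y x" for x y
    by (simp add: vec_eq_iff forall_8 D36_def table_product_def axis_component)
  moreover have "D36 (D36 x y) z = - D36 x (D36 y z)" for x y z
    by (simp add: vec_eq_iff forall_8 D36_def table_product_def axis_component algebra_simps)
  ultimately show ?thesis unfolding dual_mock_lie_def using D36_bilinear by blast
qed

lemma D36_three_step: "D36 (D36 (e 1) (e 2)) (e 3) $ 8 = -1"
  by (simp add: D36_axis)

lemma rigid_D36: "rigid D36"
proof -
  \<comment> \<open>The eighth coordinate of (e1 e2) e3 as a polynomial; nonvanishing forces a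
    nonzero triple product, and at \<open>D36\<close> its value is -1.\<close>
  define q where "q = (\<lambda>\<mu> :: 8 product. \<Sum>p\<in>UNIV. structure_constant 1 2 p \<mu> * structure_constant p 3 8 \<mu>)"
  have q: "polynomial_fun q"
    unfolding q_def by (intro polynomial_fun_sum polynomial_fun.mult polynomial_fun.coord)
  have q': "q \<mu> = \<mu> (\<mu> (e 1) (e 2)) (e 3) $ 8" if "\<mu> \<in> bilinear_products" for \<mu>
  proof -
    have "\<mu> (\<Sum>p\<in>UNIV. \<mu> (e 1) (e 2) $ p *s e p) (e 3) $ 8 = q \<mu>"
      unfolding bilinear_product_simps[OF that] by (simp add: q_def structure_constant_def)
    then show ?thesis unfolding basis_expansion by simp
  qed
  show ?thesis
  proof (rule openin_orbitI[OF D36_dual_mock_lie q])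
    show "q D36 \<noteq> 0" unfolding q'[OF D36_bilinear] D36_three_step by simp
    fix \<nu> :: "8 product" assume "\<nu> \<in> dual_mock_lie" "q \<nu> \<noteq> 0"
    then have "\<nu> (\<nu> (e 1) (e 2)) (e 3) \<noteq> 0" using q'[OF dual_mock_lieD(1)] by auto
    then show "\<nu> \<in> orbit D36" by (rule three_step_orbit_D36[OF \<open>\<nu> \<in> dual_mock_lie\<close>])
  qed
qed

section \<open>Telling the four orbits apart\<close>

definition annihilator :: "'n::finite product \<Rightarrow> (complex^'n) set" where
  "annihilator \<mu> = {u. \<forall>x. \<mu> u x = 0}"

lemma dim_annihilator_orbit:
  assumes "\<nu> \<in> orbit \<mu>"
  shows "vec.dim (annihilator \<nu>) = vec.dim (annihilator \<mu>)"
proof -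
  obtain g where g: "invertible g" "\<nu> = GL_action g \<mu>" using assms by (auto simp: orbit_def)
  have iff: "u \<in> annihilator \<nu> \<longleftrightarrow> matrix_inv g *v u \<in> annihilator \<mu>" for u
  proof
    assume u: "u \<in> annihilator \<nu>"
    have "\<mu> (matrix_inv g *v u) x = 0" for x
    proof -
      have "GL_action g \<mu> u (g *v x) = 0" using u g(2) by (simp add: annihilator_def)
      then have "matrix_inv g *v (g *v \<mu> (matrix_inv g *v u) x) = matrix_inv g *v 0"
        using g(1) by (simp add: GL_action_def)
      then show ?thesis using g(1) by simp
    qed
    then show "matrix_inv g *v u \<in> annihilator \<mu>" by (simp add: annihilator_def)
  qed (simp add: annihilator_def g(2) GL_action_def)
  have "annihilator \<nu> = (*v) g ` annihilator \<mu>"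
  proof (intro equalityI subsetI)
    fix u assume "u \<in> annihilator \<nu>"
    then show "u \<in> (*v) g ` annihilator \<mu>"
      using iff[of u] matrix_inv_mult_vec(1)[OF g(1), of u] by (intro image_eqI) auto
  next
    fix u assume "u \<in> (*v) g ` annihilator \<mu>"
    then obtain x where x: "u = g *v x" "x \<in> annihilator \<mu>" by blast
    show "u \<in> annihilator \<nu>" unfolding iff x(1) matrix_inv_mult_vec(2)[OF g(1)] by (rule x(2))
  qed
  moreover have "vec.dim ((*v) g ` annihilator \<mu>) = vec.dim (annihilator \<mu>)"
    by (rule vec.dim_image_eq[OF matrix_vector_mul_linear_gen])
      (rule inj_on_subset[OF inj_matrix_vector_mult[OF g(1)] subset_UNIV])
  ultimately show ?thesis by simp
qed

text \<open>Coordinates outside \<open>E\<close> always annihilate in a block product, and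
  \<open>radical\<close> leaves nothing else.\<close>

lemma dim_annihilator_block:
  fixes D :: "'n::finite product"
  assumes D: "D \<in> block_products E"
    and radical: "\<And>u. coord_proj E *v u = u \<Longrightarrow> (\<forall>i\<in>E. D u (e i) = 0) \<Longrightarrow> u = 0"
  shows "vec.dim (annihilator D) = card (- E)"
proof -
  note B = block_productsD[OF D]
  have "annihilator D = {u. \<forall>i. i \<notin> - E \<longrightarrow> u $ i = 0}"
  proof (intro equalityI subsetI CollectI allI impI)
    fix u i assume u: "u \<in> annihilator D" and i: "i \<notin> - E"
    have "coord_proj E *v u = 0"
      by (rule radical) (use u in \<open>simp_all add: annihilator_def B(3)\<close>)
    then show "u $ i = 0" using i coord_proj_component[of E u i] by simp
  next
    fix u :: "complex^'n" assume "u \<in> {u. \<forall>i. i \<notin> - E \<longrightarrow> u $ i = 0}"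
    then have "coord_proj E *v u = 0" by (simp add: vec_eq_iff coord_proj_component)
    then have "D u x = 0" for x using B(3)[of u x] by (simp add: bilinear_product_simps[OF B(1)])
    then show "u \<in> annihilator D" by (simp add: annihilator_def)
  qed
  then show ?thesis by (simp only: dim_substandard_cart)
qed

lemma orbit_disjoint:
  assumes "\<mu> \<notin> orbit \<nu>"
  shows "orbit \<mu> \<inter> orbit \<nu> = {}"
  using assms orbit_sym orbit_trans by blast

text \<open>Vanishing of all triple products is preserved by isomorphism; it holds for block
  products and fails for \<open>D36\<close>.\<close>

lemma D36_notin_block_orbit:
  assumes "D \<in> block_products E"
  shows "D36 \<notin> orbit D"
proof
  assume "D36 \<in> orbit D"
  then obtain g where g: "invertible g" "D36 = GL_action g D" by (auto simp: orbit_def)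
  have "D (D x y) z = 0" for x y z
    using block_productsD(3)[OF assms, of "D x y" z]
    by (simp add: block_productsD(4)[OF assms] bilinear_product_simps[OF block_productsD(1)[OF assms]])
  then have "GL_action g D (GL_action g D x y) z = 0" for x y z
    using g(1) by (simp add: GL_action_def)
  then have "D36 (D36 (e 1) (e 2)) (e 3) = 0" using g(2) by simp
  then show False using D36_three_step by simp
qed

theorem theorem6:
  "irreducible_components_of (subtopology zariski (dual_mock_lie :: 8 product set)) =
     {zariski closure_of orbit D17, zariski closure_of orbit D30,
      zariski closure_of orbit D33, zariski closure_of orbit D36} \<and>
   card (irreducible_components_of (subtopology zariski (dual_mock_lie :: 8 product set))) = 4 \<and>
   (\<forall>\<mu> \<in> {D17, D30, D33, D36}. rigid \<mu>)"
proof -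
  let ?X = "subtopology zariski (dual_mock_lie :: 8 product set)"
  let ?I = "{D17, D30, D33, D36}"
  have rigid: "rigid \<mu>" if "\<mu> \<in> ?I" for \<mu>
    using that rigid_D17 rigid_D30 rigid_D33 rigid_D36 by auto
  have dml: "\<mu> \<in> dual_mock_lie" if "\<mu> \<in> ?I" for \<mu> using rigid[OF that] by (simp add: rigid_def)
  have top: "topspace ?X = dual_mock_lie"
    using dual_mock_lieD(1) by (auto simp: topspace_zariski)
  have closed: "closedin zariski (dual_mock_lie :: 8 product set)"
    by (simp add: closedin_zariski zariski_closed_dual_mock_lie)
  have sub: "orbit \<mu> \<subseteq> dual_mock_lie" if "\<mu> \<in> ?I" for \<mu> using orbit_subset_dual_mock_lie dml that by blast
  \<comment> \<open>The variety is Zariski closed, so closures in the subspace and in the space of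
    all bilinear products coincide.\<close>
  have clo: "?X closure_of orbit \<mu> = zariski closure_of orbit \<mu>" if "\<mu> \<in> ?I" for \<mu>
    using closure_of_minimal[OF sub[OF that] closed] sub[OF that]
    by (simp add: closure_of_subtopology Int_absorb1 Int_absorb2)
  have "vec.dim (annihilator D17) = card (- {1,2,3,4,5,6 :: 8})"
    by (rule dim_annihilator_block[OF D17_block]) (rule D17_radical)
  moreover have "vec.dim (annihilator D30) = card (- {1,2,3,4,5 :: 8})"
    by (rule dim_annihilator_block[OF D30_block]) (rule D30_radical)
  moreover have "vec.dim (annihilator D33) = card (- {1,2,3,4 :: 8})"
    by (rule dim_annihilator_block[OF D33_block]) (rule D33_radical)
  ultimately have dims: "vec.dim (annihilator D17) = 2" "vec.dim (annihilator D30) = 3"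
    "vec.dim (annihilator D33) = 4"
    unfolding Compl_6 Compl_5 Compl_4 by simp_all
  \<comment> \<open>The annihilator dimensions 2, 3, 4 are constant on orbits.\<close>
  have "D30 \<notin> orbit D17" "D33 \<notin> orbit D17" "D33 \<notin> orbit D30"
    using dim_annihilator_orbit[of D30 D17] dim_annihilator_orbit[of D33 D17]
      dim_annihilator_orbit[of D33 D30] dims by auto
  moreover have "D36 \<notin> orbit D17" "D36 \<notin> orbit D30" "D36 \<notin> orbit D33"
    using D36_notin_block_orbit D17_block D30_block D33_block by blast+
  ultimately have distinct: "D17 \<noteq> D30" "D17 \<noteq> D33" "D17 \<noteq> D36" "D30 \<noteq> D33" "D30 \<noteq> D36" "D33 \<noteq> D36"
    and disj: "orbit D30 \<inter> orbit D17 = {}" "orbit D33 \<inter> orbit D17 = {}" "orbit D33 \<inter> orbit D30 = {}"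
      "orbit D36 \<inter> orbit D17 = {}" "orbit D36 \<inter> orbit D30 = {}" "orbit D36 \<inter> orbit D33 = {}"
    using mem_orbit_self by (metis orbit_disjoint)+
  have cover: "\<mu> \<in> (\<Union>D\<in>?I. zariski closure_of orbit D)" if \<mu>: "\<mu> \<in> dual_mock_lie" for \<mu>
  proof (cases "\<exists>x y z. \<mu> (\<mu> x y) z \<noteq> 0")
    case True
    then have "\<mu> \<in> orbit D36" using three_step_orbit_D36[OF \<mu>] by blast
    moreover have "orbit D36 \<subseteq> zariski closure_of orbit D36"
      by (rule closure_of_subset) (use orbit_subset_bilinear_products[OF D36_bilinear] in \<open>simp add: topspace_zariski\<close>)
    ultimately show ?thesis by blast
  next
    case False
    then have "\<mu> (\<mu> x y) z = 0" for x y z by simp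
    from two_step_block_product[OF \<mu> this]
    obtain E g where E: "E \<in> {{1,2,3,4,5,6}, {1,2,3,4,5}, {1,2,3,4}}"
      and g: "invertible g" "GL_action g \<mu> \<in> block_products E"
      by (elim bexE exE conjE)
    note cl = rigid_D17[THEN conjunct2, THEN subsetD] rigid_D30[THEN conjunct2, THEN subsetD]
      rigid_D33[THEN conjunct2, THEN subsetD]
    have "GL_action g \<mu> \<in> zariski closure_of orbit D17 \<or> GL_action g \<mu> \<in> zariski closure_of orbit D30 \<or>
      GL_action g \<mu> \<in> zariski closure_of orbit D33"
      using E
    proof (elim insertE emptyE)
      assume "E = {1,2,3,4,5,6}"
      then show ?thesis using g(2) cl(1) by simp
    next
      assume "E = {1,2,3,4,5}"
      then show ?thesis using g(2) cl(2) by simp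
    next
      assume "E = {1,2,3,4}"
      then show ?thesis using g(2) cl(3) by simp
    qed
    then have "\<exists>D\<in>?I. GL_action g \<mu> \<in> zariski closure_of orbit D" by (simp, blast)
    then obtain D where D: "D \<in> ?I" "GL_action g \<mu> \<in> zariski closure_of orbit D"
      by (elim bexE)
    \<comment> \<open>Only an isomorphic copy of \<open>\<mu>\<close> is a block product; orbit
      closures are invariant under the group, so it can be moved back.\<close>
    have "GL_action (matrix_inv g) (GL_action g \<mu>) \<in> zariski closure_of orbit D"
      using zariski_closure_GL_action[OF dual_mock_lieD(1)[OF dml[OF D(1)]] D(2) invertibleD(3)[OF g(1)]] .
    moreover have "GL_action (matrix_inv g) (GL_action g \<mu>) = \<mu>" using GL_action_inverse[OF g(1)] by metis
    ultimately show ?thesis using D(1) by auto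
  qed
  have irr: "irreducible_in ?X (?X closure_of orbit \<mu>)" if "\<mu> \<in> ?I" for \<mu>
  proof (rule irreducible_in_closure)
    show "orbit \<mu> \<subseteq> topspace ?X" using sub that top by blast
    show "orbit \<mu> \<noteq> {}" using mem_orbit_self by blast
    fix A B assume "closedin ?X A" "closedin ?X B" "orbit \<mu> \<subseteq> A \<union> B"
    then show "orbit \<mu> \<subseteq> A \<or> orbit \<mu> \<subseteq> B"
      using irreducible_orbit[OF dual_mock_lieD(1)[OF dml[OF that]]] closedin_closed_subtopology[OF closed]
      by (simp add: closedin_zariski)
  qed
  have op: "openin ?X (orbit \<mu>)" if "\<mu> \<in> ?I" for \<mu> using rigid[OF that] by (simp add: rigid_def)
  have ne: "orbit \<mu> \<noteq> {}" if "\<mu> \<in> ?I" for \<mu> using mem_orbit_self by blast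
  have disj': "orbit \<mu> \<inter> orbit \<nu> = {}" if "\<mu> \<in> ?I" "\<nu> \<in> ?I" "\<mu> \<noteq> \<nu>" for \<mu> \<nu>
    using that by (elim insertE emptyE) (simp_all add: disj disj[THEN trans[OF Int_commute]])
  have cov: "topspace ?X = (\<Union>\<mu>\<in>?I. ?X closure_of orbit \<mu>)"
  proof
    show "topspace ?X \<subseteq> (\<Union>\<mu>\<in>?I. ?X closure_of orbit \<mu>)" using cover top clo by auto
    show "(\<Union>\<mu>\<in>?I. ?X closure_of orbit \<mu>) \<subseteq> topspace ?X"
      by (intro UN_least closure_of_subset_topspace)
  qed
  have "finite ?I" by simp
  then have comp: "irreducible_components_of ?X = (\<lambda>\<mu>. ?X closure_of orbit \<mu>) ` ?I"
    by (rule irreducible_components_of_open_cover(1)[OF _ op ne irr disj' cov])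
  have inj: "inj_on (\<lambda>\<mu>. ?X closure_of orbit \<mu>) ?I"
    by (rule irreducible_components_of_open_cover(2)[OF \<open>finite ?I\<close> op ne irr disj' cov])
  have "card ?I = 4" using distinct by simp
  then have "card (irreducible_components_of ?X) = 4" unfolding comp card_image[OF inj] .
  moreover have "irreducible_components_of ?X = (\<lambda>\<mu>. zariski closure_of orbit \<mu>) ` ?I"
    unfolding comp using clo by (intro image_cong refl)
  ultimately show ?thesis using rigid by simp
qed

end
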